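(* Let $d\ge 3$, $0\le\eta<\frac12$, $\epsilon\in(0,1)$, $\delta\in(0,1)$. Suppose the labeling oracle $\mathcal{O}$ satisfies the $\eta$-bounded noise condition with respect to a unit vector $u$, and the initial unit vector $v_0$ satisfies $\theta(v_0,u)\in[0,\frac\pi2]$. Run ACTIVE-PERCEPTRON with inputs $\mathcal{O}$, $v_0$, $\epsilon$, $\delta$, sample schedule $m_k=\Theta\!\left(\frac{d}{(1-2\eta)^2}\left(\ln\frac{d}{(1-2\eta)^2}+\ln\frac k\delta\right)\right)$ and band widths $b_k=\Theta\!\left(\frac{2^{-k}(1-2\eta)}{\sqrt d\,\ln(k m_k/\delta)}\right)$ (with appropriate absolute constants in the $\Theta$'s). Then with probability at least $1-\delta$: (1) the output $v$ satisfies $\mathbb{P}[\operatorname{sign}(v\cdot X)\neq\operatorname{sign}(u\cdot X)]\le\epsilon$; (2) the number of label queries is $O\!\left(\frac{d}{(1-2\eta)^2}\ln\frac1\epsilon\left(\ln\frac{d}{(1-2\eta)^2}+\ln\frac1\delta+\ln\ln\frac1\epsilon\right)\right)$; (3) the number of unlabeled examples drawn is $O\!\left(\frac{d}{(1-2\eta)^3}\left(\ln\frac{d}{(1-2\eta)^2}+\ln\frac1\delta+\ln\ln\frac1\epsilon\right)^2\frac1\epsilon\ln\frac1\epsilon\right)$; (4) the running time is $O\!\left(\frac{d^2}{(1-2\eta)^3}\left(\ln\frac{d}{(1-2\eta)^2}+\ln\frac1\delta+\ln\ln\frac1\epsilon\right)^2\frac1\epsilon\ln\frac1\epsilon\ri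ght)$.
   Context: $\mathbb{S}^{d-1}$ is the unit sphere in $\mathbb{R}^d$; $X$ is uniform on $\mathbb{S}^{d-1}$. Data $(X,Y)\in\mathbb{S}^{d-1}\times\{-1,+1\}$ are drawn from a distribution $D$ whose marginal on $X$ is uniform on $\mathbb{S}^{d-1}$; the oracle $\mathcal{O}$ queried at $x$ returns an independent draw from the conditional law of $Y$ given $X=x$. For unit vectors, $\theta(v_1,v_2)=\arccos(v_1\cdot v_2)$. $\eta$-bounded noise w.r.t. $u$: for all $x$, $\mathbb{P}[Y\neq\operatorname{sign}(u\cdot x)\mid X=x]\le\eta$. Procedure MODIFIED-PERCEPTRON$(\mathcal{O},w_0,\theta,\delta,m,b)$: for $t=0,\dots,m-1$: let $R_t=\{x\in\mathbb{S}^{d-1}: \frac b2\le w_t\cdot x\le b\}$; draw unlabeled points uniformly from $\mathbb{S}^{d-1}$ until one lies in $R_t$, call it $x_t$, query $\mathcal{O}$ for its label $y_t$; set $w_{t+1}=w_t-2\,\mathbb{1}\{y_t\,w_t\cdot x_t<0\}(w_t\cdot x_t)\,x_t$. Return $w_m$. Algorithm ACTIVE-PERCEPTRON$(\mathcal{O},v_0,\epsilon,\delta,\{m_k\},\{b_k\})$: let $k_0=\lceil\log_2\frac1\epsilon\rceil$; for $k=1,\dots,k_0$ set $v_k=$ MODIFIED-PERCEPTRON$(\mathcal{O},v_{k-1},\frac{\pi}{2^k},\frac{\delta}{k(k+1)},m_k,b_k)$; return $v_{k_0}$. Running time counts arithmetic operations on $d$-dimensional vectors (processing one example costs $O(d)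$).
   Formalization: In the bounds (2)–(4) every logarithm ln x is read as max(1, ln x); with literal logarithms the bounds fail for ε near 1, where ln(1/ε) tends to 0 and ln ln(1/ε) is negative although at least m_1 labels are queried. *)

theory Defs
  imports "HOL-Probability.Probability"
begin

type_synonym vec = "nat \<Rightarrow> real"

text \<open>Vectors of R^d are represented as functions nat => real that are
  extensional on the index set {..<d}.\<close>

definition dotp :: "nat \<Rightarrow> vec \<Rightarrow> vec \<Rightarrow> real" where
  "dotp d x y = (\<Sum>i<d. x i * y i)"

definition unit_sphere :: "nat \<Rightarrow> vec set" where
  "unit_sphere d = {x \<in> extensional {..<d}. dotp d x x = 1}"

definition vec_space :: "nat \<Rightarrow> vec measure" where
  "vec_space d = PiM {..<d} (\<lambda>_. borel)"

text \<open>Uniform distribution on the unit sphere S^(d-1): the law of a standard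
  Gaussian vector normalised to unit length (the rotation invariant
  probability measure on the sphere).\<close>
definition sphere_measure :: "nat \<Rightarrow> vec measure" where
  "sphere_measure d =
     distr (PiM {..<d} (\<lambda>_. density lborel std_normal_density)) (vec_space d)
       (\<lambda>x. restrict (\<lambda>i. x i / sqrt (dotp d x x)) {..<d})"

definition theta :: "nat \<Rightarrow> vec \<Rightarrow> vec \<Rightarrow> real" where
  "theta d v1 v2 = arccos (dotp d v1 v2)"

text \<open>sign with values +1/-1 (the value at 0 is immaterial: a null event)\<close>
definition sgn1 :: "real \<Rightarrow> real" where
  "sgn1 t = (if t \<ge> 0 then 1 else -1)"

text \<open>The label distribution: p x = P[Y = +1 | X = x].  eta-bounded noise
  with respect to u.\<close>
definition bounded_noise :: "nat \<Rightarrow> vec \<Rightarrow> real \<Rightarrow> (vec \<Rightarrow> real) \<Rightarrow> bool" where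
  "bounded_noise d u \<eta> p \<longleftrightarrow>
     (\<forall>x\<in>unit_sphere d. (if sgn1 (dotp d u x) = 1 then 1 - p x else p x) \<le> \<eta>)"

text \<open>Randomness of a run: an i.i.d. stream of pairs (x, r), x uniform on the
  sphere (the unlabeled draws) and r uniform on [0,1]; if x is queried, its
  label is +1 iff r <= p x, i.e. an independent draw from the law of Y given X = x.\<close>
definition sample_space :: "nat \<Rightarrow> (vec \<times> real) stream measure" where
  "sample_space d =
     stream_space (sphere_measure d \<Otimes>\<^sub>M uniform_measure lborel {0..1::real})"

definition label :: "(vec \<Rightarrow> real) \<Rightarrow> vec \<Rightarrow> real \<Rightarrow> real" where
  "label p x r = (if r \<le> p x then 1 else -1)"

definition inband :: "nat \<Rightarrow> vec \<Rightarrow> real \<Rightarrow> vec \<Rightarrow> bool" where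
  "inband d w b x \<longleftrightarrow> b / 2 \<le> dotp d w x \<and> dotp d w x \<le> b"

definition next_acc :: "nat \<Rightarrow> vec \<Rightarrow> real \<Rightarrow> (vec \<times> real) stream \<Rightarrow> nat \<Rightarrow> nat" where
  "next_acc d w b s i = (LEAST j. i \<le> j \<and> inband d w b (fst (s !! j)))"

text \<open>One iteration of MODIFIED-PERCEPTRON; the state is (w_t, number of
  unlabeled examples drawn so far).\<close>
definition mp_step :: "nat \<Rightarrow> (vec \<Rightarrow> real) \<Rightarrow> real \<Rightarrow> (vec \<times> real) stream
    \<Rightarrow> vec \<times> nat \<Rightarrow> vec \<times> nat" where
  "mp_step d p b s st =
     (let w = fst st; j = next_acc d w b s (snd st); x = fst (s !! j);
          y = label p x (snd (s !! j));
          w' = (if y * dotp d w x < 0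
                then restrict (\<lambda>k. w k - 2 * dotp d w x * x k) {..<d} else w)
      in (w', Suc j))"

definition modified_perceptron :: "nat \<Rightarrow> (vec \<Rightarrow> real) \<Rightarrow> nat \<Rightarrow> real
    \<Rightarrow> (vec \<times> real) stream \<Rightarrow> vec \<times> nat \<Rightarrow> vec \<times> nat" where
  "modified_perceptron d p m b s st = (mp_step d p b s ^^ m) st"

fun ap_state :: "nat \<Rightarrow> (vec \<Rightarrow> real) \<Rightarrow> (nat \<Rightarrow> nat) \<Rightarrow> (nat \<Rightarrow> real)
    \<Rightarrow> (vec \<times> real) stream \<Rightarrow> vec \<Rightarrow> nat \<Rightarrow> vec \<times> nat" where
  "ap_state d p ms bs s v0 0 = (v0, 0)"
| "ap_state d p ms bs s v0 (Suc k) =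
     modified_perceptron d p (ms (Suc k)) (bs (Suc k)) s (ap_state d p ms bs s v0 k)"

definition num_epochs :: "real \<Rightarrow> nat" where
  "num_epochs \<epsilon> = nat \<lceil>log 2 (1 / \<epsilon>)\<rceil>"

definition ap_output :: "nat \<Rightarrow> (vec \<Rightarrow> real) \<Rightarrow> real \<Rightarrow> (nat \<Rightarrow> nat) \<Rightarrow> (nat \<Rightarrow> real)
    \<Rightarrow> (vec \<times> real) stream \<Rightarrow> vec \<Rightarrow> vec" where
  "ap_output d p \<epsilon> ms bs s v0 = fst (ap_state d p ms bs s v0 (num_epochs \<epsilon>))"

definition ap_unlabeled :: "nat \<Rightarrow> (vec \<Rightarrow> real) \<Rightarrow> real \<Rightarrow> (nat \<Rightarrow> nat) \<Rightarrow> (nat \<Rightarrow> real)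
    \<Rightarrow> (vec \<times> real) stream \<Rightarrow> vec \<Rightarrow> nat" where
  "ap_unlabeled d p \<epsilon> ms bs s v0 = snd (ap_state d p ms bs s v0 (num_epochs \<epsilon>))"

text \<open>Each epoch k issues exactly m_k label queries.\<close>
definition ap_queries :: "real \<Rightarrow> (nat \<Rightarrow> nat) \<Rightarrow> nat" where
  "ap_queries \<epsilon> ms = (\<Sum>k=1..num_epochs \<epsilon>. ms k)"

text \<open>Cost model: processing one example (an inner product with the
  current iterate, or an update) costs d vector-coordinate operations.\<close>
definition ap_time :: "nat \<Rightarrow> (vec \<Rightarrow> real) \<Rightarrow> real \<Rightarrow> (nat \<Rightarrow> nat) \<Rightarrow> (nat \<Rightarrow> real)
    \<Rightarrow> (vec \<times> real) stream \<Rightarrow> vec \<Rightarrow> nat" where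
  "ap_time d p \<epsilon> ms bs s v0 = d * (ap_unlabeled d p \<epsilon> ms bs s v0 + ap_queries \<epsilon> ms)"

definition Ln :: "real \<Rightarrow> real" where
  "Ln x = max 1 (ln x)"

end

theory Submission
  imports Defs
begin

text \<open>
  The potential of an iterate w is 1 - w . u. Conditioned on the band, the component of x orthogonal
  to w is symmetric and of size about 1/sqrt d, so the noise bound makes the expected potential drop
  by order b (1 - 2 eta) s / sqrt d per query, s being the sine of the angle between w and u, while a
  single step changes it by at most 2 b (b + s). Hence exp (lambda * potential) contracts in
  expectation as long as the angle is comparable to its target. Backward induction on the number of
  remaining queries turns this into a bound on the failure probability of an epoch, without stopping
  times: above a cap the claimed bound exceeds 1, and close to the target one step cannot leave the
  safe region. The failure probability from epoch k on is at most delta / (4 k), which telescopes.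

  Each raw draw falls into the band with probability at least b sqrt d / 64, so the number of
  unlabeled examples has exponential tails and it suffices to follow finitely many raw draws.
  Uniform points on the sphere are normalised Gaussian vectors; a product of plane rotations maps any
  orthonormal pair to the first two coordinates, where the estimates are one-dimensional integrals.
\<close>

section \<open>Rotation invariance of the Gaussian measure\<close>

text \<open>Write N = 1 - 2 eta, h = 2^-k, s for the sine of the angle and L for the logarithm in
  the width of epoch k. The scales are forced. A loss of exp (- 2 L) per query near the target needs
  lambda of order L / h^2. The second-order term (lambda b s)^2 of the exponential must stay below
  the drift lambda b N s / sqrt d; for s of order h this means b of order h N / (sqrt d L), the
  prescribed width. The contraction per query is then of order N^2 / d, and lowering an exponent of
  order L takes order d L / N^2 queries. The drift also competes with a bias of order b^2 from the
  component of u along w, which a narrow band keeps smaller. All of this is relative to the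
  probability of the band, so that probability is needed from above as well as from below. A further
  obstacle: \<open>next_acc\<close> is a \<open>LEAST\<close> that need not be attained. Wrong
  outcomes are therefore counted only on runs completed within finitely many draws, and
  incompleteness is charged separately. This also makes waiting for an accepted draw harmless, since
  a rejected draw leaves the state as it is.\<close>

abbreviation normal1 :: "real measure" where
  "normal1 \<equiv> density lborel (\<lambda>x. ennreal (std_normal_density x))"

lemma prob_space_normal1: "prob_space normal1"
  by (rule prob_space_normal_density) simp

interpretation normal1: prob_space normal1
  by (rule prob_space_normal1)

interpretation normal_product: product_prob_space "\<lambda>_::nat. normal1" UNIV
  by standard

definition gaussian :: "nat \<Rightarrow> vec measure" where
  "gaussian d = PiM {..<d} (\<lambda>_. normal1)"

lemma sets_gaussian[measurable_cong]: "sets (gaussian d) = sets (vec_space d)"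
  by (auto simp: gaussian_def vec_space_def intro!: sets_PiM_cong)

lemma space_vec_space: "space (vec_space d) = extensional {..<d}"
  by (simp add: vec_space_def space_PiM PiE_def)

lemma prob_space_gaussian: "prob_space (gaussian d)"
  unfolding gaussian_def by (rule prob_space_PiM) (rule prob_space_normal1)

text \<open>A rotation is a product of two one-variable affine substitutions: for fixed y the
  rotated first coordinate becomes the variable, with Jacobian 1 / |c|; after Fubini, for fixed x,
  the rotated second coordinate, with Jacobian |c|. The factors cancel, and c must be nonzero for
  the first substitution. \<open>g\<close> is the planar Gaussian density, which sees only x^2 +
  y^2.\<close>

lemma nn_integral_rotate_nz:
  fixes f :: "real \<Rightarrow> real \<Rightarrow> ennreal"
  assumes [measurable]: "case_prod f \<in> borel_measurable (borel \<Otimes>\<^sub>M borel)"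
    and cs: "c\<^sup>2 + s\<^sup>2 = 1" and c: "c \<noteq> 0"
  shows "(\<integral>\<^sup>+y. \<integral>\<^sup>+x. f (c * x - s * y) (s * x + c * y) \<partial>normal1 \<partial>normal1) =
         (\<integral>\<^sup>+y. \<integral>\<^sup>+x. f x y \<partial>normal1 \<partial>normal1)"
proof -
  define g :: "real \<Rightarrow> real \<Rightarrow> ennreal" where
    "g x y = ennreal (exp (- (x\<^sup>2 + y\<^sup>2) / 2) / (2 * pi))" for x y
  have gm[measurable]: "case_prod g \<in> borel_measurable (borel \<Otimes>\<^sub>M borel)"
    unfolding g_def by measurable
  have dens: "ennreal (std_normal_density y) * (ennreal (std_normal_density x) * a) = g x y * a" for x y a
  proof -
    have "std_normal_density y * std_normal_density x = exp (- (x\<^sup>2 + y\<^sup>2) / 2) / (2 * pi)"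
      by (simp add: std_normal_density_def exp_add[symmetric] field_simps real_sqrt_mult)
    thus ?thesis
      by (simp add: g_def mult.assoc[symmetric] ennreal_mult[symmetric])
  qed
  have I: "(\<integral>\<^sup>+y. \<integral>\<^sup>+x. h x y \<partial>normal1 \<partial>normal1) = (\<integral>\<^sup>+y. \<integral>\<^sup>+x. g x y * h x y \<partial>lborel \<partial>lborel)"
    if [measurable]: "case_prod h \<in> borel_measurable (borel \<Otimes>\<^sub>M borel)" for h
    by (simp add: nn_integral_density nn_integral_cmult[symmetric] dens)
  have 1: "(\<integral>\<^sup>+x. g x y * f (c * x - s * y) (s * x + c * y) \<partial>lborel) =
     ennreal (1 / \<bar>c\<bar>) * (\<integral>\<^sup>+x. g ((x + s * y) / c) y * f x ((s * x + y) / c) \<partial>lborel)" for y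
  proof -
    have e1: "c * ((x + s * y) / c) - s * y = x" for x
      using c by (simp add: field_simps)
    have e2: "s * y / c + x / c = (x + s * y) / c" for x
      by (simp add: add_divide_distrib)
    have e3: "s * ((x + s * y) / c) + c * y = (s * x + y) / c" for x
    proof -
      have "s * ((x + s * y) / c) + c * y = (s * x + (c\<^sup>2 + s\<^sup>2) * y) / c"
        using c by (simp add: field_simps power2_eq_square)
      thus ?thesis using cs by simp
    qed
    show ?thesis
      by (subst nn_integral_real_affine[where c="1/c" and t="s*y/c"])
        (use c in \<open>simp_all only: mult_1_left times_divide_eq_left e2 e1 e3 abs_divide abs_one, simp_all\<close>)
  qed
  have 2: "ennreal (1 / \<bar>c\<bar>) * (\<integral>\<^sup>+y. g ((x + s * y) / c) y * f x ((s * x + y) / c) \<partial>lborel) =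
     (\<integral>\<^sup>+y. g x y * f x y \<partial>lborel)" for x
  proof -
    have e1: "(x + s * (c * y - s * x)) / c = c * x + s * y" for y
    proof -
      have "(x + s * (c * y - s * x)) / c = (x * (1 - s\<^sup>2) + c * s * y) / c"
        by (simp add: field_simps power2_eq_square)
      also have "1 - s\<^sup>2 = c\<^sup>2" using cs by simp
      finally show ?thesis using c by (simp add: field_simps power2_eq_square)
    qed
    have e2: "g (c * x + s * y) (c * y - s * x) = g x y" for y
    proof -
      have "(c * x + s * y)\<^sup>2 + (c * y - s * x)\<^sup>2 = (c\<^sup>2 + s\<^sup>2) * (x\<^sup>2 + y\<^sup>2)"
        by (simp add: power2_eq_square algebra_simps)
      thus ?thesis using cs by (simp add: g_def)
    qed
    have "(\<integral>\<^sup>+y. g ((x + s * y) / c) y * f x ((s * x + y) / c) \<partial>lborel) =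
       ennreal \<bar>c\<bar> * (\<integral>\<^sup>+y. g x y * f x y \<partial>lborel)"
      by (subst nn_integral_real_affine[where c="c" and t="-(s*x)"])
        (use c in \<open>auto simp: e1 e2 intro!: arg_cong2[where f="(*)"] nn_integral_cong\<close>)
    thus ?thesis using c
      by (simp add: mult.assoc[symmetric] ennreal_mult[symmetric])
  qed
  have "(\<integral>\<^sup>+y. \<integral>\<^sup>+x. f (c * x - s * y) (s * x + c * y) \<partial>normal1 \<partial>normal1)
     = (\<integral>\<^sup>+y. ennreal (1 / \<bar>c\<bar>) * (\<integral>\<^sup>+x. g ((x + s * y) / c) y * f x ((s * x + y) / c) \<partial>lborel) \<partial>lborel)"
    by (subst I) (simp_all add: 1)
  also have "\<dots> = (\<integral>\<^sup>+y. (\<integral>\<^sup>+x. ennreal (1 / \<bar>c\<bar>) * (g ((x + s * y) / c) y * f x ((s * x + y) / c)) \<partial>lborel) \<partial>lborel)"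
    by (simp add: nn_integral_cmult)
  also have "\<dots> = (\<integral>\<^sup>+x. (\<integral>\<^sup>+y. ennreal (1 / \<bar>c\<bar>) * (g ((x + s * y) / c) y * f x ((s * x + y) / c)) \<partial>lborel) \<partial>lborel)"
    by (rule lborel_pair.Fubini') measurable
  also have "\<dots> = (\<integral>\<^sup>+x. (\<integral>\<^sup>+y. g x y * f x y \<partial>lborel) \<partial>lborel)"
    by (simp add: nn_integral_cmult 2)
  also have "\<dots> = (\<integral>\<^sup>+y. (\<integral>\<^sup>+x. g x y * f x y \<partial>lborel) \<partial>lborel)"
    by (rule lborel_pair.Fubini') measurable
  also have "\<dots> = (\<integral>\<^sup>+y. \<integral>\<^sup>+x. f x y \<partial>normal1 \<partial>normal1)"
    by (subst I) simp_all
  finally show ?thesis .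
qed

lemma nn_integral_rotate:
  fixes f :: "real \<Rightarrow> real \<Rightarrow> ennreal"
  assumes [measurable]: "case_prod f \<in> borel_measurable (borel \<Otimes>\<^sub>M borel)"
    and cs: "c\<^sup>2 + s\<^sup>2 = 1"
  shows "(\<integral>\<^sup>+y. \<integral>\<^sup>+x. f (c * x - s * y) (s * x + c * y) \<partial>normal1 \<partial>normal1) =
         (\<integral>\<^sup>+y. \<integral>\<^sup>+x. f x y \<partial>normal1 \<partial>normal1)"
proof (cases "c = 0")
  case False
  then show ?thesis by (intro nn_integral_rotate_nz assms)
next
  case True
  \<comment> \<open>a quarter turn is the square of an eighth turn\<close>
  define r where "r = 1 / sqrt (2::real)"
  have r2: "r * r = 1/2" by (simp add: r_def)
  have s2: "s * s = 1" using True cs by (simp add: power2_eq_square)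
  have h: "r\<^sup>2 + (s * r)\<^sup>2 = 1" "r \<noteq> 0"
    by (simp_all add: r2 s2 power2_eq_square algebra_simps) (auto simp: r_def)
  have [measurable]: "case_prod (\<lambda>x y. f (r * x - s * r * y) (s * r * x + r * y)) \<in> borel_measurable (borel \<Otimes>\<^sub>M borel)"
    by measurable
  have e1: "r * (r * x - s * r * y) - s * r * (s * r * x + r * y) = c * x - s * y" for x y
  proof -
    have "r * (r * x - s * r * y) - s * r * (s * r * x + r * y)
       = (r * r) * x - (r * r) * s * y - (s * s) * (r * r) * x - s * (r * r) * y"
      by (simp add: algebra_simps)
    thus ?thesis using True by (simp add: r2 s2)
  qed
  have e2: "s * r * (r * x - s * r * y) + r * (s * r * x + r * y) = s * x + c * y" for x y
  proof -
    have "s * r * (r * x - s * r * y) + r * (s * r * x + r * y)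
       = s * (r * r) * x - (s * s) * (r * r) * y + s * (r * r) * x + (r * r) * y"
      by (simp add: algebra_simps)
    thus ?thesis using True by (simp add: r2 s2)
  qed
  show ?thesis
    using nn_integral_rotate_nz[of "\<lambda>x y. f (r * x - s * r * y) (s * r * x + r * y)" r "s * r"]
      nn_integral_rotate_nz[of f r "s * r"] h
    by (simp add: e1 e2)
qed

definition givens :: "nat \<Rightarrow> nat \<Rightarrow> real \<Rightarrow> real \<Rightarrow> vec \<Rightarrow> vec" where
  "givens i j c s x = x(i := c * x i - s * x j, j := s * x i + c * x j)"

lemma measurable_givens[measurable]:
  assumes "i < d" "j < d"
  shows "givens i j c s \<in> vec_space d \<rightarrow>\<^sub>M vec_space d"
  unfolding vec_space_def
proof (rule measurable_PiM_single')
  show "(\<lambda>x. givens i j c s x k) \<in> borel_measurable (PiM {..<d} (\<lambda>_. borel))" if "k \<in> {..<d}" for k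
    using assms that by (cases "k = i"; cases "k = j") (simp_all add: givens_def)
  show "givens i j c s \<in> space (PiM {..<d} (\<lambda>_. borel)) \<rightarrow> (\<Pi>\<^sub>E i\<in>{..<d}. space borel)"
    using assms by (auto simp: space_PiM givens_def PiE_def extensional_def)
qed

text \<open>Integrating out all coordinates except i and j leaves a function \<open>F\<close> of two
  independent normal variables, to which the planar statement applies. The Fubini swaps before and
  after are due to \<open>split\<close> and \<open>nn_integral_rotate\<close> nesting the two
  integrals in opposite orders.\<close>

lemma distr_givens:
  assumes ij: "i < d" "j < d" "i \<noteq> j" and cs: "c\<^sup>2 + s\<^sup>2 = 1"
  shows "distr (gaussian d) (gaussian d) (givens i j c s) = gaussian d"
proof (rule measure_eqI)
  have m[measurable]: "givens i j c s \<in> gaussian d \<rightarrow>\<^sub>M gaussian d"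
    using measurable_givens[OF ij(1,2)] by (simp cong: measurable_cong_sets add: sets_gaussian)
  fix A assume "A \<in> sets (distr (gaussian d) (gaussian d) (givens i j c s))"
  hence A[measurable]: "A \<in> sets (gaussian d)" by simp
  define J where "J = {..<d} - {i, j}"
  have J: "finite J" "j \<notin> J" "i \<notin> insert j J" "finite (insert j J)"
    and un: "{..<d} = insert i (insert j J)"
    using ij by (auto simp: J_def)
  define P where "P K = PiM K (\<lambda>_::nat. normal1)" for K
  have g: "gaussian d = P (insert i (insert j J))"
    by (simp add: gaussian_def P_def un)
  define f :: "vec \<Rightarrow> ennreal" where "f = indicator A"
  have f[measurable]: "f \<in> borel_measurable (P (insert i (insert j J)))"
    unfolding f_def using A g by simp
  have split: "(\<integral>\<^sup>+x. h x \<partial>gaussian d) = (\<integral>\<^sup>+y. \<integral>\<^sup>+z. \<integral>\<^sup>+x. h (x(j := z, i := y)) \<partial>P J \<partial>normal1 \<partial>normal1)"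
    if h: "h \<in> borel_measurable (P (insert i (insert j J)))" for h :: "vec \<Rightarrow> ennreal"
  proof -
    have "(\<integral>\<^sup>+x. h x \<partial>gaussian d) = (\<integral>\<^sup>+y. \<integral>\<^sup>+x. h (x(i := y)) \<partial>P (insert j J) \<partial>normal1)"
      using normal_product.product_nn_integral_insert_rev[OF J(4,3) h[unfolded P_def]]
      by (simp add: g P_def)
    also have "\<dots> = (\<integral>\<^sup>+y. \<integral>\<^sup>+z. \<integral>\<^sup>+x. h (x(j := z, i := y)) \<partial>P J \<partial>normal1 \<partial>normal1)"
    proof (intro nn_integral_cong)
      fix y
      have "(\<lambda>x. h (x(i := y))) \<in> borel_measurable (P (insert j J))"
        using h J(3) unfolding P_def by measurable
      thus "(\<integral>\<^sup>+x. h (x(i := y)) \<partial>P (insert j J)) = (\<integral>\<^sup>+z. \<integral>\<^sup>+x. h (x(j := z, i := y)) \<partial>P J \<partial>normal1)"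
        using normal_product.product_nn_integral_insert_rev[OF J(1,2), of "\<lambda>x. h (x(i := y))"]
        by (simp add: P_def)
    qed
    finally show ?thesis .
  qed
  define F where "F y z = (\<integral>\<^sup>+x. f (x(j := z, i := y)) \<partial>P J)" for y z
  interpret PJ: prob_space "P J"
    unfolding P_def by (rule prob_space_PiM) (rule prob_space_normal1)
  have up: "(\<lambda>(p, x). x(j := snd p, i := fst p)) \<in> ((borel \<Otimes>\<^sub>M borel) \<Otimes>\<^sub>M P J) \<rightarrow>\<^sub>M P (insert i (insert j J))"
    unfolding P_def by measurable
  have "(\<lambda>p. \<integral>\<^sup>+x. f (x(j := snd p, i := fst p)) \<partial>P J) \<in> borel_measurable (borel \<Otimes>\<^sub>M borel)"
    using measurable_compose[OF up f]
    by (intro PJ.borel_measurable_nn_integral) (simp add: case_prod_unfold)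
  hence Fm: "case_prod F \<in> borel_measurable (borel \<Otimes>\<^sub>M borel)"
    by (simp add: F_def case_prod_unfold)
  have Fm': "case_prod (\<lambda>z y. F y z) \<in> borel_measurable (borel \<Otimes>\<^sub>M borel)"
    using measurable_compose[OF measurable_pair_swap' Fm] by (simp add: case_prod_unfold)
  have fg: "(\<lambda>x. f (givens i j c s x)) \<in> borel_measurable (P (insert i (insert j J)))"
    using m f unfolding g[symmetric] by measurable
  have "emeasure (distr (gaussian d) (gaussian d) (givens i j c s)) A
      = (\<integral>\<^sup>+x. f (givens i j c s x) \<partial>gaussian d)"
    unfolding nn_integral_indicator[OF \<open>A \<in> sets (distr _ _ _)\<close>, symmetric]
    by (subst nn_integral_distr) (auto simp: f_def)
  also have "\<dots> = (\<integral>\<^sup>+y. \<integral>\<^sup>+z. F (c * y - s * z) (s * y + c * z) \<partial>normal1 \<partial>normal1)"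
    unfolding split[OF fg] using ij(3)
    by (simp add: F_def givens_def fun_upd_twist[of i j])
  also have "\<dots> = (\<integral>\<^sup>+z. \<integral>\<^sup>+y. F (c * y - s * z) (s * y + c * z) \<partial>normal1 \<partial>normal1)"
    using Fm by (intro pair_sigma_finite.Fubini' ) (auto simp: pair_sigma_finite_def intro: normal1.sigma_finite_measure_axioms)
  also have "\<dots> = (\<integral>\<^sup>+z. \<integral>\<^sup>+y. F y z \<partial>normal1 \<partial>normal1)"
    by (rule nn_integral_rotate[OF Fm cs])
  also have "\<dots> = (\<integral>\<^sup>+y. \<integral>\<^sup>+z. F y z \<partial>normal1 \<partial>normal1)"
    using Fm' by (intro pair_sigma_finite.Fubini' ) (auto simp: pair_sigma_finite_def intro: normal1.sigma_finite_measure_axioms)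
  also have "\<dots> = (\<integral>\<^sup>+x. f x \<partial>gaussian d)"
    unfolding split[OF f] F_def ..
  also have "\<dots> = emeasure (gaussian d) A"
    using A by (simp add: f_def)
  finally show "emeasure (distr (gaussian d) (gaussian d) (givens i j c s)) A = emeasure (gaussian d) A" .
qed simp

section \<open>Inner products, and isometries composed of plane rotations\<close>

lemma dotp_commute: "dotp d x y = dotp d y x"
  by (simp add: dotp_def mult.commute)

lemma dotp_cong: "(\<And>i. i < d \<Longrightarrow> x i = x' i) \<Longrightarrow> (\<And>i. i < d \<Longrightarrow> y i = y' i) \<Longrightarrow> dotp d x y = dotp d x' y'"
  by (simp add: dotp_def)

lemma dotp_self_nonneg: "0 \<le> dotp d x x"
  by (simp add: dotp_def sum_nonneg)

lemma measurable_dotp[measurable]: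
  assumes [measurable]: "f \<in> M \<rightarrow>\<^sub>M vec_space d" "g \<in> M \<rightarrow>\<^sub>M vec_space d"
  shows "(\<lambda>x. dotp d (f x) (g x)) \<in> borel_measurable M"
proof -
  have *: "(\<lambda>x. h x i) \<in> borel_measurable M" if "h \<in> M \<rightarrow>\<^sub>M vec_space d" "i < d" for h i
    using measurable_compose[OF that(1)[unfolded vec_space_def] measurable_component_singleton] that(2) by simp
  show ?thesis unfolding dotp_def
    by (intro borel_measurable_sum borel_measurable_times) (auto intro: * assms)
qed

lemma measurable_dotp_left[measurable]:
  assumes [measurable]: "g \<in> M \<rightarrow>\<^sub>M vec_space d"
  shows "(\<lambda>x. dotp d w (g x)) \<in> borel_measurable M"
proof -
  have "(\<lambda>x. dotp d (restrict w {..<d}) (g x)) \<in> borel_measurable M"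
    by (intro measurable_dotp assms measurable_const) (simp add: space_vec_space)
  thus ?thesis by (simp add: dotp_def)
qed

text \<open>S is the adjoint of T.\<close>

definition orthogonal_map :: "nat \<Rightarrow> (vec \<Rightarrow> vec) \<Rightarrow> (vec \<Rightarrow> vec) \<Rightarrow> bool" where
  "orthogonal_map d T S \<longleftrightarrow>
     T \<in> gaussian d \<rightarrow>\<^sub>M gaussian d \<and> distr (gaussian d) (gaussian d) T = gaussian d \<and>
     (\<forall>v x. dotp d v (T x) = dotp d (S v) x) \<and>
     (\<forall>v w. dotp d (S v) (S w) = dotp d v w) \<and>
     (\<forall>x. dotp d (T x) (T x) = dotp d x x)"

lemma orthogonal_mapD:
  assumes "orthogonal_map d T S"
  shows "T \<in> gaussian d \<rightarrow>\<^sub>M gaussian d" "distr (gaussian d) (gaussian d) T = gaussian d"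
    "dotp d v (T x) = dotp d (S v) x" "dotp d (S v) (S w) = dotp d v w"
    "dotp d (T x) (T x) = dotp d x x"
  using assms unfolding orthogonal_map_def by blast+

lemma orthogonal_map_id: "orthogonal_map d (\<lambda>x. x) (\<lambda>x. x)"
  by (simp add: orthogonal_map_def distr_id2)

lemma orthogonal_map_compose:
  assumes "orthogonal_map d T S" "orthogonal_map d T' S'"
  shows "orthogonal_map d (\<lambda>x. T (T' x)) (\<lambda>v. S' (S v))"
proof -
  have [measurable]: "T \<in> gaussian d \<rightarrow>\<^sub>M gaussian d" "T' \<in> gaussian d \<rightarrow>\<^sub>M gaussian d"
    using assms by (auto simp: orthogonal_map_def)
  have "distr (gaussian d) (gaussian d) (\<lambda>x. T (T' x)) = distr (distr (gaussian d) (gaussian d) T') (gaussian d) T"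
    by (subst distr_distr) (auto simp: comp_def)
  hence "distr (gaussian d) (gaussian d) (\<lambda>x. T (T' x)) = gaussian d"
    by (simp only: orthogonal_mapD(2)[OF assms(1)] orthogonal_mapD(2)[OF assms(2)])
  moreover have "dotp d (T (T' x)) (T (T' x)) = dotp d x x" for x
    by (simp only: orthogonal_mapD(5)[OF assms(1)] orthogonal_mapD(5)[OF assms(2)])
  ultimately show ?thesis
    by (simp add: orthogonal_map_def orthogonal_mapD(3,4)[OF assms(1)] orthogonal_mapD(3,4)[OF assms(2)]
        del: orthogonal_mapD(5))
qed

lemma dotp_split2:
  assumes "i < d" "j < d" "i \<noteq> j"
  shows "dotp d x y = x i * y i + x j * y j + (\<Sum>k\<in>{..<d} - {i,j}. x k * y k)"
proof -
  have "{..<d} = insert i (insert j ({..<d} - {i,j}))" using assms by auto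
  hence "dotp d x y = (\<Sum>k\<in>insert i (insert j ({..<d} - {i,j})). x k * y k)"
    by (simp add: dotp_def)
  also have "\<dots> = x i * y i + (x j * y j + (\<Sum>k\<in>{..<d} - {i,j}. x k * y k))"
    using assms by (subst sum.insert, simp, simp, subst sum.insert) auto
  finally show ?thesis by simp
qed

lemma orthogonal_map_givens:
  assumes ij: "i < d" "j < d" "i \<noteq> j" and cs: "c\<^sup>2 + s\<^sup>2 = 1"
  shows "orthogonal_map d (givens i j c s) (givens i j c (- s))"
proof -
  have *: "(\<Sum>k\<in>{..<d} - {i,j}. givens i j c s x k * y k) = (\<Sum>k\<in>{..<d} - {i,j}. x k * y k)"
    "(\<Sum>k\<in>{..<d} - {i,j}. y k * givens i j c s x k) = (\<Sum>k\<in>{..<d} - {i,j}. y k * x k)"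
    for x y s by (auto simp: givens_def intro!: sum.cong)
  have iso: "dotp d (givens i j c s' x) (givens i j c s' y) = dotp d x y" if "c\<^sup>2 + s'\<^sup>2 = 1" for s' x y
  proof -
    have "(c * x i - s' * x j) * (c * y i - s' * y j) + (s' * x i + c * x j) * (s' * y i + c * y j)
       = (c\<^sup>2 + s'\<^sup>2) * (x i * y i + x j * y j)"
      by (simp add: power2_eq_square algebra_simps)
    thus ?thesis unfolding dotp_split2[OF ij] *
      using ij(3) that by (simp add: givens_def)
  qed
  have adj: "dotp d v (givens i j c s x) = dotp d (givens i j c (- s) v) x" for v x
    unfolding dotp_split2[OF ij] * using ij(3) by (simp add: givens_def algebra_simps)
  show ?thesis
    using measurable_givens[OF ij(1,2)] distr_givens[OF ij cs] iso[OF cs] iso[of "-s"] adj cs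
    by (simp add: orthogonal_map_def cong: measurable_cong_sets[OF sets_gaussian sets_gaussian])
qed

text \<open>Each induction step rotates the plane of the coordinates a and a + n so that the later
  entry vanishes and entry a becomes the nonnegative length of the pair. With n = 0 no rotation is
  left to correct a sign, hence the last hypothesis. The final conjunct, that vectors supported
  below a stay fixed, allows a second vector to be aligned without disturbing the first.\<close>

lemma orthogonal_map_align:
  assumes "a + n < d" "\<And>i. i < a \<Longrightarrow> v i = 0" "\<And>i. a + n < i \<Longrightarrow> i < d \<Longrightarrow> v i = 0"
    "n = 0 \<Longrightarrow> 0 \<le> v a"
  shows "\<exists>T S. orthogonal_map d T S \<and>
     (\<forall>i<d. S v i = (if i = a then sqrt (dotp d v v) else 0)) \<and>
     (\<forall>z. (\<forall>i<d. a \<le> i \<longrightarrow> z i = 0) \<longrightarrow> (\<forall>i<d. S z i = z i))"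
  using assms
proof (induction n arbitrary: v)
  case 0
  have v0: "v i = 0" if "i < d" "i \<noteq> a" for i
    using 0(2)[of i] 0(3)[of i] that by (cases "i < a") auto
  have "dotp d v v = (\<Sum>i<d. if i = a then v a * v a else 0)"
    unfolding dotp_def by (intro sum.cong) (auto simp: v0)
  hence "sqrt (dotp d v v) = v a" using 0 by simp
  then show ?case
    by (intro exI[of _ "\<lambda>x. x"]) (auto simp: orthogonal_map_id v0)
next
  case (Suc n)
  define j where "j = a + Suc n"
  define r where "r = sqrt ((v a)\<^sup>2 + (v j)\<^sup>2)"
  define c where "c = (if r = 0 then 1 else v a / r)"
  define s where "s = (if r = 0 then 0 else v j / r)"
  have ij: "a < d" "j < d" "a \<noteq> j" using Suc by (auto simp: j_def)
  have r2: "r\<^sup>2 = (v a)\<^sup>2 + (v j)\<^sup>2" by (simp add: r_def)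
  have r0: "0 \<le> r" by (simp add: r_def)
  have cs: "c\<^sup>2 + s\<^sup>2 = 1"
    using r2 by (auto simp: c_def s_def power_divide add_divide_distrib[symmetric])
  have z: "v a = 0 \<and> v j = 0" if "r = 0"
    using r2 that by (simp add: sum_power2_eq_zero_iff)
  define v' where "v' = givens a j c (- s) v"
  have v'a: "v' a = r"
  proof (cases "r = 0")
    case False
    have "v' a = ((v a)\<^sup>2 + (v j)\<^sup>2) / r"
      using ij False by (simp add: v'_def givens_def c_def s_def power2_eq_square add_divide_distrib)
    also have "\<dots> = r * r / r" using r2 by (simp add: power2_eq_square)
    finally show ?thesis using False by simp
  qed (use ij z in \<open>simp add: v'_def givens_def\<close>)
  have v'j: "v' j = 0"
    using z by (cases "r = 0") (auto simp: v'_def givens_def c_def s_def)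
  have v'k: "v' k = v k" if "k \<noteq> a" "k \<noteq> j" for k
    using that by (simp add: v'_def givens_def)
  have "\<exists>T S. orthogonal_map d T S \<and>
     (\<forall>i<d. S v' i = (if i = a then sqrt (dotp d v' v') else 0)) \<and>
     (\<forall>z. (\<forall>i<d. a \<le> i \<longrightarrow> z i = 0) \<longrightarrow> (\<forall>i<d. S z i = z i))"
  proof (rule Suc.IH)
    show "a + n < d" using Suc.prems by simp
    show "v' i = 0" if "i < a" for i using Suc.prems(2)[OF that] that by (subst v'k) (auto simp: j_def)
    show "v' i = 0" if "a + n < i" "i < d" for i
      using v'j v'k[of i] Suc.prems(3)[of i] that by (cases "i = j") (auto simp: j_def)
    show "0 \<le> v' a" using v'a r0 by simp
  qed
  then obtain T S where TS: "orthogonal_map d T S"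
     "\<And>i. i < d \<Longrightarrow> S v' i = (if i = a then sqrt (dotp d v' v') else 0)"
     "\<And>z i. (\<forall>i<d. a \<le> i \<longrightarrow> z i = 0) \<Longrightarrow> i < d \<Longrightarrow> S z i = z i" by blast
  have G: "orthogonal_map d (givens a j c s) (givens a j c (- s))"
    by (rule orthogonal_map_givens[OF ij cs])
  have n: "dotp d v' v' = dotp d v v"
    using G by (simp add: v'_def orthogonal_map_def)
  have fixed: "S (givens a j c (- s) z) i = z i" if z: "\<forall>i<d. a \<le> i \<longrightarrow> z i = 0" and "i < d" for z i
  proof -
    have "givens a j c (- s) z = z"
      using z ij by (auto simp: givens_def j_def fun_eq_iff)
    thus ?thesis using TS(3)[OF z] \<open>i < d\<close> by simp
  qed
  show ?case
    using orthogonal_map_compose[OF G TS(1)] TS(2) fixed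
    by (intro exI[of _ "\<lambda>x. givens a j c s (T x)"] exI[of _ "\<lambda>v. S (givens a j c (- s) v)"])
       (auto simp: v'_def[symmetric] n)
qed

text \<open>After w has been turned into the first unit vector, orthogonality makes entry 0 of the
  image of v vanish, so v can be aligned with coordinate 1 by rotations that fix coordinate 0. The
  condition 3 <= d leaves at least one such rotation, which is what fixes the sign of the remaining
  entry.\<close>

lemma orthogonal_map_align_pair:
  assumes d: "3 \<le> d" and w: "dotp d w w = 1" and v: "dotp d v v = 1" and wv: "dotp d w v = 0"
  obtains T S where "orthogonal_map d T S" "\<And>i. i < d \<Longrightarrow> S w i = (if i = 0 then 1 else 0)"
    "\<And>i. i < d \<Longrightarrow> S v i = (if i = 1 then 1 else 0)"
proof -
  obtain T1 S1 where 1: "orthogonal_map d T1 S1" "\<And>i. i < d \<Longrightarrow> S1 w i = (if i = 0 then 1 else 0)"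
    using orthogonal_map_align[of 0 "d - 1" d w] d w by (force simp: not_less)
  have iso: "dotp d (S1 x) (S1 y) = dotp d x y" for x y
    using 1(1) by (simp add: orthogonal_map_def)
  have "dotp d (S1 w) (S1 v) = (\<Sum>i<d. if i = 0 then S1 v 0 else 0)"
    unfolding dotp_def by (intro sum.cong) (auto simp: 1(2))
  hence "S1 v 0 = 0" using d by (simp add: iso wv)
  moreover have "dotp d (S1 v) (S1 v) = 1" using iso v by simp
  moreover have "1 + (d - 2) < d" using d by simp
  moreover have "S1 v i = 0" if "1 + (d - 2) < i" "i < d" for i using that by simp
  moreover have "d - 2 \<noteq> 0" using d by simp
  ultimately have "\<exists>T S. orthogonal_map d T S \<and>
     (\<forall>i<d. S (S1 v) i = (if i = 1 then sqrt (dotp d (S1 v) (S1 v)) else 0)) \<and>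
     (\<forall>z. (\<forall>i<d. 1 \<le> i \<longrightarrow> z i = 0) \<longrightarrow> (\<forall>i<d. S z i = z i))"
    by (intro orthogonal_map_align[of 1 "d - 2" d "S1 v"]) (auto simp: less_Suc0)
  with \<open>dotp d (S1 v) (S1 v) = 1\<close> obtain T2 S2 where 2: "orthogonal_map d T2 S2"
     "\<And>i. i < d \<Longrightarrow> S2 (S1 v) i = (if i = 1 then 1 else 0)"
     "\<And>z i. (\<forall>i<d. 1 \<le> i \<longrightarrow> z i = 0) \<Longrightarrow> i < d \<Longrightarrow> S2 z i = z i"
    by (metis real_sqrt_one)
  show ?thesis
  proof (rule that[OF orthogonal_map_compose[OF 1(1) 2(1)]])
    show "S2 (S1 w) i = (if i = 0 then 1 else 0)" if "i < d" for i
      using 2(3)[of "S1 w" i] that 1(2) by simp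
  qed (use 2 in auto)
qed

text \<open>The squared norm is carried as a third component because the isometry preserves it;
  normalising afterwards then transfers the identity to the sphere.\<close>

lemma distr_gaussian_orthonormal:
  assumes d: "3 \<le> d" and w: "dotp d w w = 1" and v: "dotp d v v = 1" and wv: "dotp d w v = 0"
  shows "distr (gaussian d) (borel \<Otimes>\<^sub>M borel \<Otimes>\<^sub>M borel) (\<lambda>g. (dotp d w g, dotp d v g, dotp d g g)) =
         distr (gaussian d) (borel \<Otimes>\<^sub>M borel \<Otimes>\<^sub>M borel) (\<lambda>g. (g 0, g 1, dotp d g g))"
proof -
  obtain T S where TS: "orthogonal_map d T S" "\<And>i. i < d \<Longrightarrow> S w i = (if i = 0 then 1 else 0)"
    "\<And>i. i < d \<Longrightarrow> S v i = (if i = 1 then 1 else 0)"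
    using orthogonal_map_align_pair[OF assms] by metis
  have [measurable]: "T \<in> gaussian d \<rightarrow>\<^sub>M gaussian d" and dT: "distr (gaussian d) (gaussian d) T = gaussian d"
    using TS(1) by (auto simp: orthogonal_map_def)
  have "dotp d w (T g) = g 0" for g
  proof -
    have "dotp d w (T g) = dotp d (S w) g" using TS(1) by (simp add: orthogonal_map_def)
    also have "\<dots> = (\<Sum>i<d. if i = 0 then g 0 else 0)" unfolding dotp_def by (intro sum.cong) (auto simp: TS(2))
    finally show ?thesis using d by simp
  qed
  moreover have "dotp d v (T g) = g 1" for g
  proof -
    have "dotp d v (T g) = dotp d (S v) g" using TS(1) by (simp add: orthogonal_map_def)
    also have "\<dots> = (\<Sum>i<d. if i = 1 then g 1 else 0)" unfolding dotp_def by (intro sum.cong) (auto simp: TS(3))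
    finally show ?thesis using d by simp
  qed
  moreover have "dotp d (T g) (T g) = dotp d g g" for g
    by (rule orthogonal_mapD(5)[OF TS(1)])
  moreover have [measurable]: "(\<lambda>g. (dotp d w g, dotp d v g, dotp d g g)) \<in> gaussian d \<rightarrow>\<^sub>M borel \<Otimes>\<^sub>M borel \<Otimes>\<^sub>M borel"
    by measurable
  ultimately have "distr (distr (gaussian d) (gaussian d) T) (borel \<Otimes>\<^sub>M borel \<Otimes>\<^sub>M borel) (\<lambda>g. (dotp d w g, dotp d v g, dotp d g g))
     = distr (gaussian d) (borel \<Otimes>\<^sub>M borel \<Otimes>\<^sub>M borel) (\<lambda>g. (g 0, g 1, dotp d g g))"
    by (subst distr_distr) (auto simp: comp_def)
  thus ?thesis by (simp add: dT)
qed

section \<open>The uniform law on the sphere as a normalised Gaussian\<close>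

definition normalize_vec :: "nat \<Rightarrow> vec \<Rightarrow> vec" where
  "normalize_vec d x = restrict (\<lambda>i. x i / sqrt (dotp d x x)) {..<d}"

lemma measurable_normalize_vec[measurable]: "normalize_vec d \<in> vec_space d \<rightarrow>\<^sub>M vec_space d"
proof -
  have [measurable]: "(\<lambda>x. x i) \<in> borel_measurable (vec_space d)" if "i \<in> {..<d}" for i
    using that unfolding vec_space_def by simp
  have "(\<lambda>x. restrict (\<lambda>i. x i / sqrt (dotp d x x)) {..<d}) \<in> vec_space d \<rightarrow>\<^sub>M PiM {..<d} (\<lambda>_. borel)"
    by (rule measurable_restrict) measurable
  thus ?thesis by (simp add: normalize_vec_def[abs_def] vec_space_def)
qed

lemma measurable_normalize_vec_gaussian[measurable]: "normalize_vec d \<in> gaussian d \<rightarrow>\<^sub>M vec_space d"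
  using measurable_normalize_vec by (simp cong: measurable_cong_sets[OF sets_gaussian refl])

lemma sphere_measure_eq: "sphere_measure d = distr (gaussian d) (vec_space d) (normalize_vec d)"
  by (simp add: sphere_measure_def gaussian_def normalize_vec_def[abs_def])

lemma sets_sphere_measure[measurable_cong, simp]: "sets (sphere_measure d) = sets (vec_space d)"
  by (simp add: sphere_measure_def)

lemma space_sphere_measure: "space (sphere_measure d) = extensional {..<d}"
  by (simp add: sphere_measure_def space_vec_space)

lemma prob_space_sphere_measure: "prob_space (sphere_measure d)"
  unfolding sphere_measure_eq
  by (rule prob_space.prob_space_distr[OF prob_space_gaussian]) measurable

lemma dotp_normalize_vec: "dotp d w (normalize_vec d g) = dotp d w g / sqrt (dotp d g g)"
  by (simp add: dotp_def normalize_vec_def sum_divide_distrib)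

lemma dotp_normalize_vec_self:
  "dotp d (normalize_vec d g) (normalize_vec d g) = (if dotp d g g = 0 then 0 else 1)"
  using dotp_self_nonneg[of d g]
  by (simp add: dotp_normalize_vec dotp_commute[of d "normalize_vec d g"])

lemma dotp_eq_0_imp: "dotp d x x = 0 \<Longrightarrow> dotp d w x = 0"
proof -
  assume "dotp d x x = 0"
  hence "\<forall>i\<in>{..<d}. x i * x i = 0"
    unfolding dotp_def by (subst (asm) sum_nonneg_eq_0_iff) auto
  thus ?thesis by (simp add: dotp_def)
qed

text \<open>Division by zero yields 0, so the zero Gaussian vector normalises to the zero vector;
  the second alternative records this case. It disappears inside a band of positive width, where
  \<open>dotp d w x\<close> is positive.\<close>

lemma AE_sphere_measure:
  "AE x in sphere_measure d. x \<in> extensional {..<d} \<and> (x \<in> unit_sphere d \<or> (\<forall>w. dotp d w x = 0))"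
proof (rule AE_mp)
  have *: "{x \<in> space (vec_space d). dotp d x x = 1 \<or> dotp d x x = 0} \<in> sets (vec_space d)"
    by measurable
  show "AE x in sphere_measure d. dotp d x x = 1 \<or> dotp d x x = 0"
    unfolding sphere_measure_eq
    by (subst AE_distr_iff) (use * in \<open>auto simp: dotp_normalize_vec_self\<close>)
  show "AE x in sphere_measure d. dotp d x x = 1 \<or> dotp d x x = 0 \<longrightarrow>
     x \<in> extensional {..<d} \<and> (x \<in> unit_sphere d \<or> (\<forall>w. dotp d w x = 0))"
    by (rule AE_I2) (auto simp: space_sphere_measure unit_sphere_def dotp_eq_0_imp)
qed

lemma distr_sphere_orthonormal:
  assumes d: "3 \<le> d" and w: "dotp d w w = 1" and v: "dotp d v v = 1" and wv: "dotp d w v = 0"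
  shows "distr (sphere_measure d) (borel \<Otimes>\<^sub>M borel) (\<lambda>x. (dotp d w x, dotp d v x)) =
         distr (gaussian d) (borel \<Otimes>\<^sub>M borel) (\<lambda>g. (g 0 / sqrt (dotp d g g), g 1 / sqrt (dotp d g g)))"
proof -
  let ?B3 = "borel \<Otimes>\<^sub>M borel \<Otimes>\<^sub>M borel :: (real \<times> real \<times> real) measure"
  let ?n = "\<lambda>(a, b, n). (a / sqrt n, b / sqrt n)"
  have [measurable]: "(\<lambda>x. x i) \<in> borel_measurable (gaussian d)" if "i < d" for i
    using that unfolding gaussian_def by simp
  have [measurable]: "(\<lambda>x. x 0) \<in> borel_measurable (gaussian d)" "(\<lambda>x. x (Suc 0)) \<in> borel_measurable (gaussian d)"
    using d by auto
  have "distr (sphere_measure d) (borel \<Otimes>\<^sub>M borel) (\<lambda>x. (dotp d w x, dotp d v x))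
     = distr (gaussian d) (borel \<Otimes>\<^sub>M borel) (\<lambda>g. ?n (dotp d w g, dotp d v g, dotp d g g))"
    unfolding sphere_measure_eq
    by (subst distr_distr) (auto simp: comp_def dotp_normalize_vec)
  also have "\<dots> = distr (distr (gaussian d) ?B3 (\<lambda>g. (dotp d w g, dotp d v g, dotp d g g))) (borel \<Otimes>\<^sub>M borel) ?n"
    by (subst distr_distr) (auto simp: comp_def)
  also have "\<dots> = distr (gaussian d) (borel \<Otimes>\<^sub>M borel) (\<lambda>g. ?n (g 0, g 1, dotp d g g))"
    unfolding distr_gaussian_orthonormal[OF assms]
    by (subst distr_distr) (auto simp: comp_def)
  finally show ?thesis by simp
qed

section \<open>Probability and first moment of a band\<close>

text \<open>This is tan (arcsin t). If y is one coordinate and R the sum of the squares of the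
  others, it turns the condition y / sqrt (y^2 + R) <= t on the sphere into y <=
  \<open>tanarc t\<close> * sqrt R, an interval condition on y.\<close>

definition tanarc :: "real \<Rightarrow> real" where
  "tanarc t = t / sqrt (1 - t\<^sup>2)"

lemma tanarc_sq: "0 < t \<Longrightarrow> t < 1 \<Longrightarrow> 0 \<le> R \<Longrightarrow> (1 - t\<^sup>2) * (tanarc t * sqrt R)\<^sup>2 = t\<^sup>2 * R"
proof -
  assume t: "0 < t" "t < 1" "0 \<le> R"
  hence "t\<^sup>2 < 1" by (simp add: power_less_one_iff)
  thus ?thesis using t by (simp add: tanarc_def power_mult_distrib power_divide)
qed

lemma tanarc_nonneg: "0 < t \<Longrightarrow> t < 1 \<Longrightarrow> 0 \<le> tanarc t"
  by (simp add: tanarc_def power_le_one)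

lemma tanarc_iff:
  assumes t: "0 < t" "t < 1" and R: "0 \<le> R" and y: "0 \<le> y"
  shows "y \<le> t * sqrt (y\<^sup>2 + R) \<longleftrightarrow> y \<le> tanarc t * sqrt R"
    and "t * sqrt (y\<^sup>2 + R) \<le> y \<longleftrightarrow> tanarc t * sqrt R \<le> y"
proof -
  have t1: "t\<^sup>2 < 1" using t by (simp add: power_less_one_iff)
  have sq: "(t * sqrt (y\<^sup>2 + R))\<^sup>2 = t\<^sup>2 * (y\<^sup>2 + R)"
    using R by (simp add: power_mult_distrib)
  have nn: "0 \<le> t * sqrt (y\<^sup>2 + R)" "0 \<le> tanarc t * sqrt R"
    using t R tanarc_nonneg[OF t] by auto
  have iff: "a \<le> c \<longleftrightarrow> a\<^sup>2 \<le> c\<^sup>2" if "0 \<le> a" "0 \<le> c" for a c :: real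
    using that by (simp add: abs_le_square_iff[symmetric])
  show "y \<le> t * sqrt (y\<^sup>2 + R) \<longleftrightarrow> y \<le> tanarc t * sqrt R"
  proof -
    have "y \<le> tanarc t * sqrt R \<longleftrightarrow> (1 - t\<^sup>2) * y\<^sup>2 \<le> (1 - t\<^sup>2) * (tanarc t * sqrt R)\<^sup>2"
      unfolding iff[OF y nn(2)] using t1 by simp
    also have "\<dots> \<longleftrightarrow> y\<^sup>2 \<le> t\<^sup>2 * (y\<^sup>2 + R)"
      unfolding tanarc_sq[OF t R] by (simp add: algebra_simps)
    also have "\<dots> \<longleftrightarrow> y \<le> t * sqrt (y\<^sup>2 + R)"
      unfolding iff[OF y nn(1)] sq ..
    finally show ?thesis ..
  qed
  show "t * sqrt (y\<^sup>2 + R) \<le> y \<longleftrightarrow> tanarc t * sqrt R \<le> y"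
  proof -
    have "tanarc t * sqrt R \<le> y \<longleftrightarrow> (1 - t\<^sup>2) * (tanarc t * sqrt R)\<^sup>2 \<le> (1 - t\<^sup>2) * y\<^sup>2"
      unfolding iff[OF nn(2) y] using t1 by simp
    also have "\<dots> \<longleftrightarrow> t\<^sup>2 * (y\<^sup>2 + R) \<le> y\<^sup>2"
      unfolding tanarc_sq[OF t R] by (simp add: algebra_simps)
    also have "\<dots> \<longleftrightarrow> t * sqrt (y\<^sup>2 + R) \<le> y"
      unfolding iff[OF nn(1) y] sq ..
    finally show ?thesis ..
  qed
qed

text \<open>\<open>tanarc b\<close> is at least b, while sqrt (1 - b^2 / 4) >= 3/4 gives
  \<open>tanarc (b/2)\<close> <= 2 b / 3.\<close>

lemma tanarc_diff_ge:
  assumes b: "0 < b" "b \<le> 1/2"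
  shows "b / 3 \<le> tanarc b - tanarc (b/2)"
proof -
  have b2: "b\<^sup>2 \<le> 1/4" using b power_mono[of b "1/2" 2] by (simp add: power2_eq_square)
  have "b \<le> tanarc b"
    unfolding tanarc_def using b b2 by (simp add: field_simps)
  moreover have "3/4 \<le> sqrt (1 - (b/2)\<^sup>2)"
    using b2 by (intro real_le_rsqrt) (simp add: power2_eq_square)
  hence "tanarc (b/2) \<le> (b/2) / (3/4)"
    unfolding tanarc_def using b b2 by (intro divide_left_mono) (auto simp: power_divide)
  ultimately show ?thesis by simp
qed

section \<open>One-dimensional Gaussian integrals\<close>

lemma emeasure_normal1_interval:
  assumes "p \<le> q"
  shows "emeasure normal1 {p..q} \<le> ennreal ((q - p) / sqrt (2 * pi))"
    and "0 \<le> p \<Longrightarrow> ennreal ((q - p) * std_normal_density q) \<le> emeasure normal1 {p..q}"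
proof -
  have e: "emeasure normal1 {p..q} = (\<integral>\<^sup>+x. ennreal (std_normal_density x) * indicator {p..q} x \<partial>lborel)"
    by (simp add: emeasure_density)
  have "emeasure normal1 {p..q} \<le> (\<integral>\<^sup>+x. ennreal (1 / sqrt (2 * pi)) * indicator {p..q} x \<partial>lborel)"
    unfolding e by (intro nn_integral_mono mult_right_mono ennreal_leI) (auto simp: std_normal_density_def divide_simps)
  also have "\<dots> = ennreal ((q - p) / sqrt (2 * pi))"
    using assms by (simp add: nn_integral_cmult ennreal_mult[symmetric])
  finally show "emeasure normal1 {p..q} \<le> ennreal ((q - p) / sqrt (2 * pi))" .
  assume p: "0 \<le> p"
  have "ennreal ((q - p) * std_normal_density q) = (\<integral>\<^sup>+x. ennreal (std_normal_density q) * indicator {p..q} x \<partial>lborel)"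
    using assms by (simp add: nn_integral_cmult ennreal_mult[symmetric] mult.commute)
  also have "\<dots> \<le> emeasure normal1 {p..q}"
    unfolding e
  proof (intro nn_integral_mono)
    fix x show "ennreal (std_normal_density q) * indicator {p..q} x \<le> ennreal (std_normal_density x) * indicator {p..q} x"
    proof (cases "x \<in> {p..q}")
      case True
      hence "x\<^sup>2 \<le> q\<^sup>2" using p by (intro power_mono) auto
      hence "std_normal_density q \<le> std_normal_density x"
        by (simp add: std_normal_density_def divide_right_mono)
      thus ?thesis by (intro mult_right_mono ennreal_leI) auto
    qed simp
  qed
  finally show "ennreal ((q - p) * std_normal_density q) \<le> emeasure normal1 {p..q}" .
qed

lemma has_bochner_integral_normal1:
  "has_bochner_integral normal1 f x \<longleftrightarrow> has_bochner_integral lborel (\<lambda>t. std_normal_density t * f t) x"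
  if [measurable]: "f \<in> borel_measurable borel" for f :: "real \<Rightarrow> real"
  by (simp add: has_bochner_integral_iff integrable_density integral_density)

lemma normal1_moments:
  "has_bochner_integral normal1 (\<lambda>t. t\<^sup>2) 1"
  "has_bochner_integral normal1 (\<lambda>t. \<bar>t\<bar>) (sqrt (2 / pi))"
  "has_bochner_integral normal1 (\<lambda>t. \<bar>t\<bar>^3) (2 * sqrt (2 / pi))"
  using std_normal_moment_even[of 1] std_normal_moment_abs_odd[of 0] std_normal_moment_abs_odd[of 1]
  by (simp_all add: has_bochner_integral_normal1 numeral_3_eq_3 mult.commute)

lemma nn_integral_normal1_sq: "(\<integral>\<^sup>+t. ennreal (t\<^sup>2) \<partial>normal1) = 1"
  using normal1_moments(1) by (subst nn_integral_eq_integral) (auto simp: has_bochner_integral_iff)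

lemma sqrt_2_pi_ge: "7/10 \<le> sqrt (2 / pi)"
  using pi_less_4 by (intro real_le_rsqrt) (simp add: power2_eq_square field_simps)

text \<open>Both bounds replace exp (- B t^2 / 2) by its tangent 1 - B t^2 / 2. What remains are the
  moments of t^2, |t| and |t|^3; for the second bound they give sqrt (2 / pi) * (1 - B), which is at
  least 7/10 * 7/8.\<close>

lemma nn_integral_normal1_exp:
  assumes B: "0 \<le> B" "B \<le> 1/8"
  shows "ennreal (1 - B / 2) \<le> (\<integral>\<^sup>+t. ennreal (exp (- B * t\<^sup>2 / 2)) \<partial>normal1)"
    and "ennreal (1/2) \<le> (\<integral>\<^sup>+t. ennreal (\<bar>t\<bar> * exp (- B * t\<^sup>2 / 2)) \<partial>normal1)"
proof -
  have e: "1 - B / 2 * t\<^sup>2 \<le> exp (- B * t\<^sup>2 / 2)" for t :: real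
    using exp_ge_add_one_self[of "- B * t\<^sup>2 / 2"] by simp
  note m = normal1_moments[unfolded has_bochner_integral_iff]
  have prob1: "measure normal1 UNIV = 1"
    using normal1.prob_space unfolding space_density space_lborel space_borel .
  have i1: "integrable normal1 (\<lambda>t. exp (- B * t\<^sup>2 / 2))"
    using B by (intro normal1.integrable_const_bound[of _ 1]) (auto)
  have "1 - B / 2 = (\<integral>t. 1 - B / 2 * t\<^sup>2 \<partial>normal1)"
  proof -
    have "(\<integral>t. 1 - B / 2 * t\<^sup>2 \<partial>normal1) = (\<integral>t. 1 \<partial>normal1) - (\<integral>t. B / 2 * t\<^sup>2 \<partial>normal1)"
      using m(1) by (intro Bochner_Integration.integral_diff integrable_mult_right normal1.integrable_const) blast+
    also have "(\<integral>t. B / 2 * t\<^sup>2 \<partial>normal1) = B / 2 * (\<integral>t. t\<^sup>2 \<partial>normal1)"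
      by (rule integral_mult_right_zero)
    also have "(\<integral>t. t\<^sup>2 \<partial>normal1) = 1" using m(1) by blast
    finally show ?thesis by (simp add: prob1)
  qed
  also have "\<dots> \<le> (\<integral>t. exp (- B * t\<^sup>2 / 2) \<partial>normal1)"
    using m(1) i1 e by (intro integral_mono) auto
  finally show "ennreal (1 - B / 2) \<le> (\<integral>\<^sup>+t. ennreal (exp (- B * t\<^sup>2 / 2)) \<partial>normal1)"
    using i1 by (subst nn_integral_eq_integral) (auto intro!: ennreal_leI)
  have e': "\<bar>t\<bar> - B / 2 * \<bar>t\<bar>^3 \<le> \<bar>t\<bar> * exp (- B * t\<^sup>2 / 2)" for t :: real
    using mult_left_mono[OF e[of t], of "\<bar>t\<bar>"] by (simp add: algebra_simps power2_eq_square power3_eq_cube)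
  have i2: "integrable normal1 (\<lambda>t. \<bar>t\<bar> * exp (- B * t\<^sup>2 / 2))"
  proof (rule Bochner_Integration.integrable_bound[of normal1 "\<lambda>t. \<bar>t\<bar>"])
    have "\<bar>t\<bar> * exp (- B * t\<^sup>2 / 2) \<le> \<bar>t\<bar> * 1" for t :: real
      using B by (intro mult_left_mono) auto
    thus "AE t in normal1. norm (\<bar>t\<bar> * exp (- B * t\<^sup>2 / 2)) \<le> norm \<bar>t\<bar>"
      by (intro AE_I2) (simp add: abs_mult)
  qed (use m(2) in auto)
  have "1/2 \<le> sqrt (2 / pi) * (7/8)" using sqrt_2_pi_ge by simp
  also have "\<dots> \<le> sqrt (2 / pi) * (1 - B)" using B by (intro mult_left_mono) auto
  also have "\<dots> = (\<integral>t. \<bar>t\<bar> - B / 2 * \<bar>t\<bar>^3 \<partial>normal1)"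
  proof -
    have "(\<integral>t. \<bar>t\<bar> - B / 2 * \<bar>t\<bar>^3 \<partial>normal1) = (\<integral>t. \<bar>t\<bar> \<partial>normal1) - (\<integral>t. B / 2 * \<bar>t\<bar>^3 \<partial>normal1)"
      using m(2,3) by (intro Bochner_Integration.integral_diff integrable_mult_right) blast+
    also have "(\<integral>t. B / 2 * \<bar>t\<bar>^3 \<partial>normal1) = B / 2 * (\<integral>t. \<bar>t\<bar>^3 \<partial>normal1)"
      by (rule integral_mult_right_zero)
    also have "(\<integral>t. \<bar>t\<bar> \<partial>normal1) = sqrt (2 / pi)" using m(2) by blast
    also have "(\<integral>t. \<bar>t\<bar>^3 \<partial>normal1) = 2 * sqrt (2 / pi)" using m(3) by blast
    finally show ?thesis by (simp add: algebra_simps)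
  qed
  also have "\<dots> \<le> (\<integral>t. \<bar>t\<bar> * exp (- B * t\<^sup>2 / 2) \<partial>normal1)"
    using m(2,3) i2 e' by (intro integral_mono) auto
  finally have "ennreal (1/2) \<le> ennreal (\<integral>t. \<bar>t\<bar> * exp (- B * t\<^sup>2 / 2) \<partial>normal1)"
    by (rule ennreal_leI)
  also have "\<dots> = (\<integral>\<^sup>+t. ennreal (\<bar>t\<bar> * exp (- B * t\<^sup>2 / 2)) \<partial>normal1)"
    using i2 by (subst nn_integral_eq_integral) auto
  finally show "ennreal (1/2) \<le> (\<integral>\<^sup>+t. ennreal (\<bar>t\<bar> * exp (- B * t\<^sup>2 / 2)) \<partial>normal1)" .
qed

text \<open>The exponential is the Gaussian weight of coordinate 0 at height sqrt (B * R), the outer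
  edge of a band, with R the sum of the squares of the other coordinates. The integrand factorises
  over coordinates; Bernoulli and B * d <= 1 keep the product of the d - 2 factors 1 - B / 2 above
  1/2, so no constant degrades with d.\<close>

lemma nn_integral_prod_exp:
  assumes B: "0 \<le> B" "B \<le> 1/8" "B * real d \<le> 1" and j: "j \<in> {1..<d}"
  shows "ennreal (1/4) \<le> (\<integral>\<^sup>+x. ennreal (\<bar>x j\<bar> * exp (- B * (\<Sum>i\<in>{1..<d}. (x i)\<^sup>2) / 2)) \<partial>PiM {1..<d} (\<lambda>_. normal1))"
proof -
  define h :: "nat \<Rightarrow> real \<Rightarrow> real" where
    "h i t = (if i = j then \<bar>t\<bar> else 1) * exp (- B * t\<^sup>2 / 2)" for i t
  have h0: "0 \<le> h i t" for i t by (simp add: h_def)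
  have prod: "\<bar>x j\<bar> * exp (- B * (\<Sum>i\<in>{1..<d}. (x i)\<^sup>2) / 2) = (\<Prod>i\<in>{1..<d}. h i (x i))" for x
  proof -
    have "(\<Prod>i\<in>{1..<d}. h i (x i)) = (\<Prod>i\<in>{1..<d}. if i = j then \<bar>x j\<bar> else 1) * (\<Prod>i\<in>{1..<d}. exp (- B * (x i)\<^sup>2 / 2))"
      unfolding prod.distrib[symmetric] by (intro prod.cong) (auto simp: h_def)
    also have "(\<Prod>i\<in>{1..<d}. if i = j then \<bar>x j\<bar> else 1) = \<bar>x j\<bar>"
      using j by simp
    also have "(\<Prod>i\<in>{1..<d}. exp (- B * (x i)\<^sup>2 / 2)) = exp (\<Sum>i\<in>{1..<d}. - B * (x i)\<^sup>2 / 2)"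
      by (simp add: exp_sum)
    also have "(\<Sum>i\<in>{1..<d}. - B * (x i)\<^sup>2 / 2) = - B * (\<Sum>i\<in>{1..<d}. (x i)\<^sup>2) / 2"
      unfolding sum_distrib_left sum_divide_distrib ..
    finally show ?thesis by simp
  qed
  have "1 + real (d - 2) * (- (B / 2)) \<le> (1 + (- (B / 2))) ^ (d - 2)"
    using B by (intro Bernoulli_inequality) auto
  moreover have "real (d - 2) * B \<le> real d * B" using B by (intro mult_right_mono) auto
  ultimately have bern: "1/2 \<le> (1 - B / 2) ^ (d - 2)" using B by (simp add: mult.commute)
  have cd: "card ({1..<d} - {j}) = d - 2" using j by simp
  have "ennreal (1/4) \<le> ennreal (1/2) * ennreal (1 - B / 2) ^ (d - 2)"
  proof -
    have "ennreal (1/4) \<le> ennreal (1/2 * (1 - B / 2) ^ (d - 2))"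
      using bern by (intro ennreal_leI) simp
    also have "\<dots> = ennreal (1/2) * ennreal ((1 - B / 2) ^ (d - 2))"
      using B by (intro ennreal_mult) auto
    finally show ?thesis using B by (simp only: ennreal_power)
  qed
  also have "\<dots> = ennreal (1/2) * (\<Prod>i\<in>{1..<d} - {j}. ennreal (1 - B / 2))"
    by (simp only: prod_constant cd)
  also have "\<dots> \<le> (\<integral>\<^sup>+t. ennreal (h j t) \<partial>normal1) * (\<Prod>i\<in>{1..<d} - {j}. \<integral>\<^sup>+t. ennreal (h i t) \<partial>normal1)"
  proof (intro mult_mono prod_mono_ennreal)
    show "ennreal (1/2) \<le> (\<integral>\<^sup>+t. ennreal (h j t) \<partial>normal1)"
      using nn_integral_normal1_exp(2)[OF B(1,2)] by (simp add: h_def)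
    show "ennreal (1 - B / 2) \<le> (\<integral>\<^sup>+t. ennreal (h i t) \<partial>normal1)" if "i \<in> {1..<d} - {j}" for i
      using nn_integral_normal1_exp(1)[OF B(1,2)] that by (simp add: h_def)
  qed simp_all
  also have "\<dots> = (\<Prod>i\<in>{1..<d}. \<integral>\<^sup>+t. ennreal (h i t) \<partial>normal1)"
    using j by (intro prod.remove[symmetric]) auto
  also have "\<dots> = (\<integral>\<^sup>+x. (\<Prod>i\<in>{1..<d}. ennreal (h i (x i))) \<partial>PiM {1..<d} (\<lambda>_. normal1))"
    by (rule normal_product.product_nn_integral_prod[symmetric]) (auto simp: h_def[abs_def])
  also have "\<dots> = (\<integral>\<^sup>+x. ennreal (\<bar>x j\<bar> * exp (- B * (\<Sum>i\<in>{1..<d}. (x i)\<^sup>2) / 2)) \<partial>PiM {1..<d} (\<lambda>_. normal1))"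
    by (simp only: prod prod_ennreal h0)
  finally show ?thesis .
qed

text \<open>The set of \<open>inband\<close> pulled back to an unnormalised Gaussian vector, with w
  turned into the first unit vector.\<close>

definition gband :: "nat \<Rightarrow> real \<Rightarrow> vec set" where
  "gband d b = {g. b / 2 \<le> g 0 / sqrt (dotp d g g) \<and> g 0 / sqrt (dotp d g g) \<le> b}"

lemma dotp_upd0:
  assumes "0 < d"
  shows "dotp d (x(0 := y)) (x(0 := y)) = y\<^sup>2 + (\<Sum>i\<in>{1..<d}. (x i)\<^sup>2)"
proof -
  have "{..<d} = insert 0 {1..<d}" using assms by auto
  thus ?thesis by (simp add: dotp_def power2_eq_square)
qed

text \<open>With the other coordinates fixed, the band is an interval in y whose ends scale with
  sqrt R. The converse needs R x > 0: for R x = 0 and y = 0 the quotient 0 / 0 is 0 by convention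
  and lies below b / 2.\<close>

lemma band_upd_iff:
  assumes d: "0 < d" and b: "0 < b" "b < 1"
  defines "R \<equiv> \<lambda>x. \<Sum>i\<in>{1..<d}. (x i)\<^sup>2"
  shows "x(0 := y) \<in> gband d b \<Longrightarrow> tanarc (b/2) * sqrt (R x) \<le> y \<and> y \<le> tanarc b * sqrt (R x)"
    and "0 < R x \<Longrightarrow> tanarc (b/2) * sqrt (R x) \<le> y \<Longrightarrow> y \<le> tanarc b * sqrt (R x) \<Longrightarrow> x(0 := y) \<in> gband d b"
proof -
  have R0: "0 \<le> R x" by (simp add: R_def sum_nonneg)
  have N: "dotp d (x(0 := y)) (x(0 := y)) = y\<^sup>2 + R x"
    using dotp_upd0[OF d, of x y] by (simp only: R_def)
  have bb: "0 < b / 2" "b / 2 < 1" using b by auto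
  show "tanarc (b/2) * sqrt (R x) \<le> y \<and> y \<le> tanarc b * sqrt (R x)" if h: "x(0 := y) \<in> gband d b"
  proof -
    have h1: "b / 2 \<le> y / sqrt (y\<^sup>2 + R x)" "y / sqrt (y\<^sup>2 + R x) \<le> b"
      using h N by (simp_all add: gband_def)
    have "y / sqrt (y\<^sup>2 + R x) > 0" using h1(1) b by linarith
    hence s: "0 < sqrt (y\<^sup>2 + R x)" "0 < y"
    proof -
      have s0: "0 \<le> sqrt (y\<^sup>2 + R x)" using R0 by simp
      assume p: "0 < y / sqrt (y\<^sup>2 + R x)"
      show "0 < y" using p s0 divide_nonpos_nonneg[of y "sqrt (y\<^sup>2 + R x)"] by linarith
      show "0 < sqrt (y\<^sup>2 + R x)" using p s0 by (cases "sqrt (y\<^sup>2 + R x) = 0") auto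
    qed
    have "b / 2 * sqrt (y\<^sup>2 + R x) \<le> y" "y \<le> b * sqrt (y\<^sup>2 + R x)"
      using h1 s(1) by (simp_all only: pos_le_divide_eq pos_divide_le_eq)
    thus ?thesis
      using tanarc_iff(2)[OF bb R0, of y] tanarc_iff(1)[OF b R0, of y] s(2) by simp
  qed
  show "x(0 := y) \<in> gband d b" if R: "0 < R x" and h: "tanarc (b/2) * sqrt (R x) \<le> y" "y \<le> tanarc b * sqrt (R x)"
  proof -
    have "0 \<le> tanarc (b/2) * sqrt (R x)" using R tanarc_nonneg[OF bb] by simp
    hence y: "0 \<le> y" using h by linarith
    have s: "0 < sqrt (y\<^sup>2 + R x)" using R by (simp add: add_nonneg_pos)
    have "b / 2 * sqrt (y\<^sup>2 + R x) \<le> y" "y \<le> b * sqrt (y\<^sup>2 + R x)"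
      using tanarc_iff(2)[OF bb R0 y] tanarc_iff(1)[OF b R0 y] h by simp_all
    hence "b / 2 \<le> y / sqrt (y\<^sup>2 + R x)" "y / sqrt (y\<^sup>2 + R x) \<le> b"
      using s by (simp_all only: pos_le_divide_eq pos_divide_le_eq)
    thus ?thesis using N by (simp add: gband_def)
  qed
qed

lemma measurable_component_normal:
  assumes "i \<in> I"
  shows "(\<lambda>x. x i) \<in> borel_measurable (PiM I (\<lambda>_. normal1))"
  using measurable_component_singleton[OF assms, of "\<lambda>_. normal1"]
  by (simp cong: measurable_cong_sets)

lemma measurable_sumsq_normal:
  "(\<lambda>x. \<Sum>i\<in>I. (x i)\<^sup>2) \<in> borel_measurable (PiM I (\<lambda>_. normal1))"
  by (intro borel_measurable_sum borel_measurable_power measurable_component_normal)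

lemma measurable_component_gaussian:
  "i < d \<Longrightarrow> (\<lambda>x. x i) \<in> borel_measurable (gaussian d)"
  unfolding gaussian_def by simp

lemma nn_integral_gaussian_insert0:
  assumes d: "0 < d" and f: "f \<in> borel_measurable (gaussian d)"
  shows "(\<integral>\<^sup>+g. f g \<partial>gaussian d) = (\<integral>\<^sup>+x. \<integral>\<^sup>+y. f (x(0 := y)) \<partial>normal1 \<partial>PiM {1..<d} (\<lambda>_. normal1))"
proof -
  have "{..<d} = insert 0 {1..<d}" using d by auto
  thus ?thesis
    using f unfolding gaussian_def
    by (simp add: normal_product.product_nn_integral_insert)
qed

lemma tanarc_le:
  assumes d: "3 \<le> d" and b: "0 < b" "b\<^sup>2 * real d \<le> 1/4"
  shows "b \<le> 1/2" "(tanarc b)\<^sup>2 \<le> 1/8" "(tanarc b)\<^sup>2 * real d \<le> 1"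
proof -
  have "b\<^sup>2 * 3 \<le> b\<^sup>2 * real d" using d by (intro mult_left_mono) auto
  hence b2: "b\<^sup>2 \<le> 1/12" using b by linarith
  have "b\<^sup>2 \<le> (1/2)\<^sup>2" using b2 by (simp add: power2_eq_square)
  thus b12: "b \<le> 1/2" using power2_le_imp_le[of b "1/2"] by simp
  have e: "(tanarc b)\<^sup>2 = b\<^sup>2 / (1 - b\<^sup>2)" using b2 by (simp add: tanarc_def power_divide)
  show "(tanarc b)\<^sup>2 \<le> 1/8" unfolding e using b2 by (simp add: field_simps)
  have "b\<^sup>2 * real d / (1 - b\<^sup>2) \<le> 1" using b2 b by (simp add: field_simps)
  thus "(tanarc b)\<^sup>2 * real d \<le> 1" by (simp add: e)
qed

lemma gband_measurable[measurable]:
  assumes d: "0 < d"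
  shows "Measurable.pred (gaussian d) (\<lambda>g. g \<in> gband d b)"
proof -
  note measurable_component_gaussian[OF d, measurable]
  show ?thesis unfolding gband_def by simp
qed

text \<open>For fixed other coordinates, y runs through an interval of length (\<beta> - \<alpha>) *
  sqrt R on which the norm is at most sqrt (2 R). The factors sqrt R cancel, leaving |x j| times the
  density at the outer end, which \<open>nn_integral_prod_exp\<close> integrates. Keeping \<beta> -
  \<alpha> as a factor makes the result comparable with the upper bound on the band
  probability.\<close>

lemma gaussian_band_abs_ge:
  assumes d: "3 \<le> d" and b: "0 < b" "b\<^sup>2 * real d \<le> 1/4" and j: "j \<in> {1..<d}"
  shows "ennreal ((tanarc b - tanarc (b/2)) / 15) \<le>
     (\<integral>\<^sup>+g. indicator (gband d b) g * ennreal (\<bar>g j\<bar> / sqrt (dotp d g g)) \<partial>gaussian d)"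
proof -
  define \<alpha> where "\<alpha> = tanarc (b/2)"
  define \<beta> where "\<beta> = tanarc b"
  define R where "R = (\<lambda>x::vec. \<Sum>i\<in>{1..<d}. (x i)\<^sup>2)"
  have d0: "0 < d" using d by simp
  note bd = tanarc_le[OF d b]
  have b1: "b < 1" "0 < b / 2" "b / 2 < 1" using b bd by auto
  have a0: "0 \<le> \<alpha>" using tanarc_nonneg[OF b1(2,3)] by (simp add: \<alpha>_def)
  have ab: "\<alpha> \<le> \<beta>" using tanarc_diff_ge[OF b(1) bd(1)] b by (simp add: \<alpha>_def \<beta>_def)
  define C where "C = (\<beta> - \<alpha>) / (sqrt 2 * sqrt (2 * pi))"
  have C0: "0 \<le> C" using ab by (simp add: C_def)
  have jj: "j < d" using j by simp
  have meas[measurable]: "(\<lambda>g. indicator (gband d b) g * ennreal (\<bar>g j\<bar> / sqrt (dotp d g g))) \<in> borel_measurable (gaussian d)"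
    using gband_measurable[OF d0] measurable_component_gaussian[OF jj] by measurable
  have ker: "ennreal C * ennreal (\<bar>x j\<bar> * exp (- \<beta>\<^sup>2 * R x / 2)) \<le>
     (\<integral>\<^sup>+y. indicator (gband d b) (x(0 := y)) * ennreal (\<bar>(x(0 := y)) j\<bar> / sqrt (dotp d (x(0 := y)) (x(0 := y)))) \<partial>normal1)"
    (is "_ \<le> (\<integral>\<^sup>+y. ?F y \<partial>normal1)") for x
  proof (cases "x j = 0")
    case False
    have "(x j)\<^sup>2 \<le> R x" unfolding R_def using j by (intro member_le_sum) auto
    moreover have "0 < (x j)\<^sup>2" using False by simp
    ultimately have R: "0 < R x" by linarith
    define I where "I = {\<alpha> * sqrt (R x)..\<beta> * sqrt (R x)}"
    have N: "dotp d (x(0 := y)) (x(0 := y)) = y\<^sup>2 + R x" for y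
      using dotp_upd0[OF d0, of x y] by (simp only: R_def)
    have low: "ennreal (\<bar>x j\<bar> / sqrt (2 * R x)) * indicator I y \<le> ?F y" for y
    proof (cases "y \<in> I")
      case True
      hence y: "\<alpha> * sqrt (R x) \<le> y" "y \<le> \<beta> * sqrt (R x)" by (auto simp: I_def)
      have "0 \<le> \<alpha> * sqrt (R x)" using a0 R by simp
      hence "y\<^sup>2 \<le> (\<beta> * sqrt (R x))\<^sup>2" using y by (intro power_mono) auto
      also have "\<dots> = \<beta>\<^sup>2 * R x" using R by (simp add: power_mult_distrib)
      also have "\<dots> \<le> 1 * R x" using R bd(2) by (intro mult_right_mono) (auto simp: \<beta>_def)
      finally have "y\<^sup>2 + R x \<le> 2 * R x" by simp
      hence "\<bar>x j\<bar> / sqrt (2 * R x) \<le> \<bar>x j\<bar> / sqrt (y\<^sup>2 + R x)"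
        using R by (intro divide_left_mono mult_pos_pos real_sqrt_le_mono) (auto simp: add_nonneg_pos)
      moreover have "x(0 := y) \<in> gband d b"
        using band_upd_iff(2)[OF d0 b(1) b1(1), of x y] R y by (simp add: R_def \<alpha>_def \<beta>_def)
      ultimately show ?thesis
        using True j N by (simp add: ennreal_leI)
    qed simp
    have "C * (\<bar>x j\<bar> * exp (- \<beta>\<^sup>2 * R x / 2)) =
       \<bar>x j\<bar> / sqrt (2 * R x) * ((\<beta> * sqrt (R x) - \<alpha> * sqrt (R x)) * std_normal_density (\<beta> * sqrt (R x)))"
      using R by (simp add: C_def std_normal_density_def power_mult_distrib real_sqrt_mult field_simps)
    hence "ennreal C * ennreal (\<bar>x j\<bar> * exp (- \<beta>\<^sup>2 * R x / 2)) =
       ennreal (\<bar>x j\<bar> / sqrt (2 * R x)) * ennreal ((\<beta> * sqrt (R x) - \<alpha> * sqrt (R x)) * std_normal_density (\<beta> * sqrt (R x)))"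
      using C0 R ab by (simp add: ennreal_mult[symmetric] mult_right_mono)
    also have "\<dots> \<le> ennreal (\<bar>x j\<bar> / sqrt (2 * R x)) * emeasure normal1 I"
      unfolding I_def using a0 ab R
      by (intro mult_left_mono emeasure_normal1_interval(2)) (auto intro: mult_right_mono)
    also have "\<dots> = (\<integral>\<^sup>+y. ennreal (\<bar>x j\<bar> / sqrt (2 * R x)) * indicator I y \<partial>normal1)"
      by (simp add: nn_integral_cmult_indicator I_def)
    also have "\<dots> \<le> (\<integral>\<^sup>+y. ?F y \<partial>normal1)"
      by (intro nn_integral_mono low)
    finally show ?thesis .
  qed simp
  \<comment> \<open>C / 4 equals (\<beta> - \<alpha>) / (8 * sqrt pi), and 8 * sqrt pi is below
    15.\<close>
  have "(\<beta> - \<alpha>) / 15 \<le> C * (1/4)"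
  proof -
    have "sqrt 2 * sqrt (2 * pi) = 2 * sqrt pi" by (simp add: real_sqrt_mult)
    moreover have "sqrt pi \<le> 15/8" using pi_approx by (intro real_le_lsqrt) (auto simp: power2_eq_square)
    ultimately show ?thesis using ab divide_left_mono[of "8 * sqrt pi" 15 "\<beta> - \<alpha>"]
      unfolding C_def by (simp add: mult.assoc)
  qed
  hence "ennreal ((\<beta> - \<alpha>) / 15) \<le> ennreal C * ennreal (1/4)"
    using C0 by (subst ennreal_mult[symmetric]) (auto intro!: ennreal_leI)
  also have "\<dots> \<le> ennreal C * (\<integral>\<^sup>+x. ennreal (\<bar>x j\<bar> * exp (- \<beta>\<^sup>2 * R x / 2)) \<partial>PiM {1..<d} (\<lambda>_. normal1))"
    unfolding R_def using bd j
    by (intro mult_left_mono nn_integral_prod_exp) (auto simp: \<beta>_def)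
  also have "\<dots> = (\<integral>\<^sup>+x. ennreal C * ennreal (\<bar>x j\<bar> * exp (- \<beta>\<^sup>2 * R x / 2)) \<partial>PiM {1..<d} (\<lambda>_. normal1))"
  proof -
    note measurable_sumsq_normal[measurable] measurable_component_normal[OF j, measurable]
    show ?thesis unfolding R_def by (intro nn_integral_cmult[symmetric]) measurable
  qed
  also have "\<dots> \<le> (\<integral>\<^sup>+g. indicator (gband d b) g * ennreal (\<bar>g j\<bar> / sqrt (dotp d g g)) \<partial>gaussian d)"
    unfolding nn_integral_gaussian_insert0[OF d0 meas]
    by (intro nn_integral_mono ker)
  finally show ?thesis by (simp add: \<alpha>_def \<beta>_def)
qed

text \<open>The slice of the band has length (\<beta> - \<alpha>) * sqrt R and the density is at
  most 1 / sqrt (2 pi). It remains to bound the mean of sqrt R by a multiple of sqrt d, where R has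
  mean d - 1.\<close>

lemma gaussian_band_le:
  assumes d: "3 \<le> d" and b: "0 < b" "b\<^sup>2 * real d \<le> 1/4"
  shows "(\<integral>\<^sup>+g. indicator (gband d b) g \<partial>gaussian d) \<le> ennreal ((tanarc b - tanarc (b/2)) * sqrt (real d) / 2)"
proof -
  define \<alpha> where "\<alpha> = tanarc (b/2)"
  define \<beta> where "\<beta> = tanarc b"
  define R where "R = (\<lambda>x::vec. \<Sum>i\<in>{1..<d}. (x i)\<^sup>2)"
  have d0: "0 < d" using d by simp
  note bd = tanarc_le[OF d b]
  have b1: "b < 1" "0 < b / 2" "b / 2 < 1" using b bd by auto
  have a0: "0 \<le> \<alpha>" using tanarc_nonneg[OF b1(2,3)] by (simp add: \<alpha>_def)
  have ab: "\<alpha> \<le> \<beta>" using tanarc_diff_ge[OF b(1) bd(1)] b by (simp add: \<alpha>_def \<beta>_def)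
  have [measurable]: "(\<lambda>g. indicator (gband d b) g :: ennreal) \<in> borel_measurable (gaussian d)"
    using gband_measurable[OF d0] by measurable
  define C where "C = (\<beta> - \<alpha>) / (2 * sqrt (2 * pi))"
  have C0: "0 \<le> C" using ab by (simp add: C_def)
  have R0: "0 \<le> R x" for x by (simp add: R_def sum_nonneg)
  have ker: "(\<integral>\<^sup>+y. indicator (gband d b) (x(0 := y)) \<partial>normal1) \<le> ennreal (C * sqrt d) + ennreal (C / sqrt d) * ennreal (R x)" for x
  proof -
    have "(\<integral>\<^sup>+y. indicator (gband d b) (x(0 := y)) \<partial>normal1) \<le>
       (\<integral>\<^sup>+y. indicator {\<alpha> * sqrt (R x)..\<beta> * sqrt (R x)} y \<partial>normal1)"
      using band_upd_iff(1)[OF d0 b(1) b1(1), of x]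
      by (intro nn_integral_mono) (simp add: indicator_def R_def \<alpha>_def \<beta>_def)
    also have "\<dots> = emeasure normal1 {\<alpha> * sqrt (R x)..\<beta> * sqrt (R x)}" by simp
    also have "\<dots> \<le> ennreal ((\<beta> * sqrt (R x) - \<alpha> * sqrt (R x)) / sqrt (2 * pi))"
      using a0 ab R0[of x] by (intro emeasure_normal1_interval(1)) (auto intro: mult_right_mono)
    also have "\<dots> \<le> ennreal (C * sqrt d + C / sqrt d * R x)"
    proof (rule ennreal_leI)
      \<comment> \<open>The inequality of arithmetic and geometric means, balanced at R = d, makes
        the bound linear in R, so that only the mean of R is needed.\<close>
      have am: "2 * sqrt (R x) \<le> sqrt d + R x / sqrt d"
      proof -
        have "0 \<le> (sqrt (R x) - sqrt d)\<^sup>2" by simp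
        hence "2 * sqrt (R x) * sqrt d \<le> sqrt d * sqrt d + R x"
          using R0[of x] by (simp add: power2_diff)
        thus ?thesis using d by (simp add: field_simps)
      qed
      have "(\<beta> * sqrt (R x) - \<alpha> * sqrt (R x)) / sqrt (2 * pi) = C * (2 * sqrt (R x))"
        by (simp add: C_def field_simps)
      also have "\<dots> \<le> C * (sqrt d + R x / sqrt d)" using am C0 by (rule mult_left_mono)
      finally show "(\<beta> * sqrt (R x) - \<alpha> * sqrt (R x)) / sqrt (2 * pi) \<le> C * sqrt d + C / sqrt d * R x"
        by (simp add: algebra_simps)
    qed
    also have "\<dots> = ennreal (C * sqrt d) + ennreal (C / sqrt d) * ennreal (R x)"
      using C0 R0[of x] by (simp add: ennreal_plus ennreal_mult[symmetric])
    finally show ?thesis .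
  qed
  interpret P: prob_space "PiM {1..<d} (\<lambda>_. normal1)"
    by (rule prob_space_PiM) (rule prob_space_normal1)
  have mom: "(\<integral>\<^sup>+x. ennreal ((x i)\<^sup>2) \<partial>PiM {1..<d} (\<lambda>_. normal1)) = 1" if i: "i \<in> {1..<d}" for i
  proof -
    have "(\<integral>\<^sup>+x. ennreal ((x i)\<^sup>2) \<partial>PiM {1..<d} (\<lambda>_. normal1)) =
        (\<integral>\<^sup>+t. ennreal (t\<^sup>2) \<partial>distr (PiM {1..<d} (\<lambda>_. normal1)) normal1 (\<lambda>x. x i))"
      by (subst nn_integral_distr[OF measurable_component_singleton[OF i]]) auto
    also have "distr (PiM {1..<d} (\<lambda>_. normal1)) normal1 (\<lambda>x. x i) = normal1"
      using i by (intro distr_PiM_component prob_space_normal1)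
    finally show ?thesis by (simp add: nn_integral_normal1_sq)
  qed
  have "(\<integral>\<^sup>+x. ennreal (R x) \<partial>PiM {1..<d} (\<lambda>_. normal1)) =
      (\<integral>\<^sup>+x. (\<Sum>i\<in>{1..<d}. ennreal ((x i)\<^sup>2)) \<partial>PiM {1..<d} (\<lambda>_. normal1))"
    by (simp add: R_def sum_ennreal)
  also have "\<dots> = (\<Sum>i\<in>{1..<d}. \<integral>\<^sup>+x. ennreal ((x i)\<^sup>2) \<partial>PiM {1..<d} (\<lambda>_. normal1))"
  proof (rule nn_integral_sum)
    fix i assume i: "i \<in> {1..<d}"
    note measurable_component_normal[OF i, measurable]
    show "(\<lambda>x. ennreal ((x i)\<^sup>2)) \<in> borel_measurable (PiM {1..<d} (\<lambda>_. normal1))"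
      by measurable
  qed
  also have "\<dots> = (\<Sum>i\<in>{1..<d}. 1)" by (intro sum.cong refl mom)
  also have "\<dots> = ennreal (real (d - 1))" by (simp add: ennreal_of_nat_eq_real_of_nat)
  finally have ER: "(\<integral>\<^sup>+x. ennreal (R x) \<partial>PiM {1..<d} (\<lambda>_. normal1)) = ennreal (real (d - 1))" .
  have Rm[measurable]: "(\<lambda>x. ennreal (R x)) \<in> borel_measurable (PiM {1..<d} (\<lambda>_. normal1))"
    unfolding R_def using measurable_sumsq_normal by measurable
  have "(\<integral>\<^sup>+g. indicator (gband d b) g \<partial>gaussian d) \<le>
     (\<integral>\<^sup>+x. ennreal (C * sqrt d) + ennreal (C / sqrt d) * ennreal (R x) \<partial>PiM {1..<d} (\<lambda>_. normal1))"
    by (subst nn_integral_gaussian_insert0[OF d0]) (auto intro!: nn_integral_mono ker)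
  also have "\<dots> = ennreal (C * sqrt d) + ennreal (C / sqrt d) * ennreal (real (d - 1))"
  proof -
    have "(\<integral>\<^sup>+x. ennreal (C * sqrt d) + ennreal (C / sqrt d) * ennreal (R x) \<partial>PiM {1..<d} (\<lambda>_. normal1)) =
      (\<integral>\<^sup>+x. ennreal (C * sqrt d) \<partial>PiM {1..<d} (\<lambda>_. normal1)) +
      ennreal (C / sqrt d) * (\<integral>\<^sup>+x. ennreal (R x) \<partial>PiM {1..<d} (\<lambda>_. normal1))"
      unfolding nn_integral_cmult[OF Rm, symmetric]
      by (intro nn_integral_add borel_measurable_times_ennreal borel_measurable_const Rm)
    thus ?thesis unfolding ER nn_integral_const P.emeasure_space_1 by simp
  qed
  also have "\<dots> = ennreal (C * sqrt d + C / sqrt d * real (d - 1))"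
    using C0 by (simp add: ennreal_plus ennreal_mult[symmetric])
  also have "\<dots> \<le> ennreal ((\<beta> - \<alpha>) * sqrt (real d) / 2)"
  proof (rule ennreal_leI)
    have "C / sqrt d * real (d - 1) \<le> C / sqrt d * real d"
      using C0 by (intro mult_left_mono) auto
    also have "\<dots> = C * sqrt d" using d by (simp add: field_simps)
    finally have "C * sqrt d + C / sqrt d * real (d - 1) \<le> 2 * C * sqrt d" by simp
    also have "\<dots> \<le> (\<beta> - \<alpha>) / 2 * sqrt d"
    proof (rule mult_right_mono)
      have "2 \<le> sqrt (2 * pi)" using pi_gt3 by (intro real_le_rsqrt) simp
      hence "(\<beta> - \<alpha>) / sqrt (2 * pi) \<le> (\<beta> - \<alpha>) / 2" using ab by (intro divide_left_mono) auto
      moreover have "2 * C = (\<beta> - \<alpha>) / sqrt (2 * pi)"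
      proof -
        have "2 * (x / (2 * s)) = x / s" for x s :: real by simp
        thus ?thesis unfolding C_def .
      qed
      ultimately show "2 * C \<le> (\<beta> - \<alpha>) / 2" by simp
    qed simp
    finally show "C * sqrt d + C / sqrt d * real (d - 1) \<le> (\<beta> - \<alpha>) * sqrt (real d) / 2" by simp
  qed
  finally show ?thesis by (simp add: \<alpha>_def \<beta>_def)
qed

text \<open>Obtained from the first moments: their sum over j is at least (d - 1) * D / 15, while
  Cauchy-Schwarz bounds the sum of |g j| / |g| by sqrt (d - 1) pointwise. This avoids any estimate
  of the lower tail of R.\<close>

lemma gaussian_band_ge:
  assumes d: "3 \<le> d" and b: "0 < b" "b\<^sup>2 * real d \<le> 1/4"
  shows "ennreal (b * sqrt d / 64) \<le> (\<integral>\<^sup>+g. indicator (gband d b) g \<partial>gaussian d)"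
proof -
  define D where "D = tanarc b - tanarc (b/2)"
  have d0: "0 < d" using d by simp
  have Db: "b / 3 \<le> D" using tanarc_diff_ge[OF b(1) tanarc_le(1)[OF d b]] by (simp add: D_def)
  hence D0: "0 \<le> D" using b by simp
  have [measurable]: "(\<lambda>g. indicator (gband d b) g :: ennreal) \<in> borel_measurable (gaussian d)"
    using gband_measurable[OF d0] by measurable
  let ?n = "real (d - 1)"
  have "ennreal (?n * (D / 15)) = (\<Sum>j\<in>{1..<d}. ennreal (D / 15))"
    using ennreal_mult[of ?n "D / 15"] D0 by (simp add: ennreal_of_nat_eq_real_of_nat)
  also have "\<dots> \<le> (\<Sum>j\<in>{1..<d}. \<integral>\<^sup>+g. indicator (gband d b) g * ennreal (\<bar>g j\<bar> / sqrt (dotp d g g)) \<partial>gaussian d)"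
    unfolding D_def by (intro sum_mono gaussian_band_abs_ge[OF d b])
  also have "\<dots> = (\<integral>\<^sup>+g. (\<Sum>j\<in>{1..<d}. indicator (gband d b) g * ennreal (\<bar>g j\<bar> / sqrt (dotp d g g))) \<partial>gaussian d)"
  proof (intro nn_integral_sum[symmetric])
    fix j assume "j \<in> {1..<d}"
    hence "j < d" by simp
    note measurable_component_gaussian[OF this, measurable]
    show "(\<lambda>g. indicator (gband d b) g * ennreal (\<bar>g j\<bar> / sqrt (dotp d g g))) \<in> borel_measurable (gaussian d)"
      by measurable
  qed
  also have "\<dots> \<le> (\<integral>\<^sup>+g. ennreal (sqrt ?n) * indicator (gband d b) g \<partial>gaussian d)"
  proof (intro nn_integral_mono)
    fix g :: vec
    have "(\<Sum>j\<in>{1..<d}. \<bar>g j\<bar>)\<^sup>2 \<le> (\<Sum>j\<in>{1..<d}. \<bar>g j\<bar>\<^sup>2) * card {1..<d}"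
      by (rule sum_squared_le_sum_of_squares)
    also have "\<dots> \<le> dotp d g g * ?n"
    proof -
      have "(\<Sum>j\<in>{1..<d}. \<bar>g j\<bar>\<^sup>2) \<le> (\<Sum>j\<in>{..<d}. \<bar>g j\<bar>\<^sup>2)"
        by (intro sum_mono2) auto
      also have "\<dots> = dotp d g g" by (simp add: dotp_def power2_eq_square)
      finally show ?thesis by (intro mult_mono) (auto simp: dotp_self_nonneg)
    qed
    finally have "(\<Sum>j\<in>{1..<d}. \<bar>g j\<bar>) \<le> sqrt (dotp d g g * ?n)" by (rule real_le_rsqrt)
    hence *: "(\<Sum>j\<in>{1..<d}. \<bar>g j\<bar> / sqrt (dotp d g g)) \<le> sqrt ?n"
      using dotp_self_nonneg[of d g]
      by (cases "dotp d g g = 0") (auto simp: sum_divide_distrib[symmetric] real_sqrt_mult field_simps)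
    have "(\<Sum>j\<in>{1..<d}. indicator (gband d b) g * ennreal (\<bar>g j\<bar> / sqrt (dotp d g g))) =
       indicator (gband d b) g * ennreal (\<Sum>j\<in>{1..<d}. \<bar>g j\<bar> / sqrt (dotp d g g))"
      unfolding sum_distrib_left[symmetric] by (subst sum_ennreal) (auto simp: dotp_self_nonneg)
    also have "\<dots> \<le> indicator (gband d b) g * ennreal (sqrt ?n)"
      using * by (intro mult_left_mono ennreal_leI) auto
    finally show "(\<Sum>j\<in>{1..<d}. indicator (gband d b) g * ennreal (\<bar>g j\<bar> / sqrt (dotp d g g))) \<le>
       ennreal (sqrt ?n) * indicator (gband d b) g" by (simp add: mult.commute)
  qed
  also have "\<dots> = ennreal (sqrt ?n) * (\<integral>\<^sup>+g. indicator (gband d b) g \<partial>gaussian d)"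
    by (rule nn_integral_cmult) simp
  finally have main: "ennreal (?n * (D / 15)) \<le> ennreal (sqrt ?n) * (\<integral>\<^sup>+g. indicator (gband d b) g \<partial>gaussian d)" .
  have n: "2 \<le> ?n" "2 / 3 * real d \<le> ?n" using d by auto
  have "ennreal (sqrt ?n * (D / 15)) = ennreal (1 / sqrt ?n) * ennreal (?n * (D / 15))"
  proof -
    have "1 / sqrt m * (m * (D / 15)) = m / sqrt m * (D / 15)" for m by simp
    hence "sqrt ?n * (D / 15) = 1 / sqrt ?n * (?n * (D / 15))"
      using n by (simp only: real_div_sqrt)
    thus ?thesis using n D0 by (simp only: ennreal_mult[symmetric]) (simp add: ennreal_mult[symmetric])
  qed
  also have "\<dots> \<le> ennreal (1 / sqrt ?n) * (ennreal (sqrt ?n) * (\<integral>\<^sup>+g. indicator (gband d b) g \<partial>gaussian d))"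
    by (intro mult_left_mono main) auto
  also have "\<dots> = (\<integral>\<^sup>+g. indicator (gband d b) g \<partial>gaussian d)"
    using n by (simp add: mult.assoc[symmetric] ennreal_mult[symmetric])
  finally have "ennreal (sqrt ?n * (D / 15)) \<le> (\<integral>\<^sup>+g. indicator (gband d b) g \<partial>gaussian d)" .
  moreover have "b * sqrt d / 64 \<le> sqrt ?n * (D / 15)"
  proof -
    \<comment> \<open>From d - 1 >= 2 d / 3 and 2/3 >= 16/25. With D >= b / 3 the final factor is
      4/5 / 45, which exceeds 1/64.\<close>
    have "4/5 * sqrt d \<le> sqrt (2 / 3 * real d)"
    proof (rule real_le_rsqrt)
      have "(4/5 * sqrt d)\<^sup>2 = 16/25 * real d" by (simp add: power_mult_distrib power_divide)
      also have "\<dots> \<le> 2/3 * real d" by (intro mult_right_mono) auto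
      finally show "(4/5 * sqrt d)\<^sup>2 \<le> 2/3 * real d" .
    qed
    also have "\<dots> \<le> sqrt ?n" using n by simp
    finally have "4/5 * sqrt d * (b / 3 / 15) \<le> sqrt ?n * (D / 15)"
      using Db b by (intro mult_mono) auto
    moreover have "b * sqrt d / 64 \<le> 4/5 * sqrt d * (b / 3 / 15)"
      using b by (simp add: field_simps)
    ultimately show ?thesis by linarith
  qed
  ultimately show ?thesis by (meson ennreal_leI order_trans)
qed

section \<open>Uniform points on the sphere\<close>

lemma dotp_Cauchy_Schwarz: "(dotp d x y)\<^sup>2 \<le> dotp d x x * dotp d y y"
  using Cauchy_Schwarz_ineq_sum[of x y "{..<d}"] by (simp add: dotp_def power2_eq_square)

lemma dotp_abs_le_1:
  assumes "dotp d x x = 1" "dotp d y y = 1"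
  shows "\<bar>dotp d x y\<bar> \<le> 1"
  using dotp_Cauchy_Schwarz[of d x y] assms by (simp add: abs_square_le_1)

lemma dotp_unit_sphere: "x \<in> unit_sphere d \<Longrightarrow> dotp d x x = 1"
  by (simp add: unit_sphere_def)

lemma dotp_linear: "dotp d (\<lambda>i. a * x i + b * y i) z = a * dotp d x z + b * dotp d y z"
  by (simp add: dotp_def sum.distrib sum_distrib_left algebra_simps)

lemma dotp_uminus: "dotp d (\<lambda>i. - x i) z = - dotp d x z"
  by (simp add: dotp_def sum_negf)

text \<open>Gram-Schmidt: v is u minus its component along w, divided by the sine of the angle. The
  disagreement and drift estimates use this splitting to depend on x only through w.x and
  v.x.\<close>

lemma orthonormal_complement:
  assumes w: "dotp d w w = 1" and u: "dotp d u u = 1" and c: "\<bar>dotp d w u\<bar> < 1"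
  obtains v where "dotp d v v = 1" "dotp d w v = 0"
    "\<And>x. dotp d u x = dotp d w u * dotp d w x + sqrt (1 - (dotp d w u)\<^sup>2) * dotp d v x"
proof -
  define c where "c = dotp d w u"
  define s where "s = sqrt (1 - c\<^sup>2)"
  have c2: "c\<^sup>2 < 1" using c by (simp add: c_def abs_square_less_1)
  have s: "0 < s" "s\<^sup>2 = 1 - c\<^sup>2" using c2 by (auto simp: s_def)
  define v where "v = (\<lambda>i. (1/s) * u i + (- c / s) * w i)"
  have vx: "dotp d v x = (dotp d u x - c * dotp d w x) / s" for x
    unfolding v_def dotp_linear by (simp add: diff_divide_distrib)
  have wv: "dotp d v w = 0" using w by (simp add: vx dotp_commute[of d u w] c_def)
  have "dotp d v u = (1 - c\<^sup>2) / s" using u by (simp add: vx c_def power2_eq_square)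
  hence "dotp d v u = s\<^sup>2 / s" by (simp only: s(2))
  hence vu: "dotp d v u = s" by (simp add: power2_eq_square)
  have "dotp d v v = (dotp d v u - c * dotp d v w) / s"
    using vx[of v] by (simp add: dotp_commute)
  hence "dotp d v v = 1" using wv vu s by simp
  moreover have "dotp d w v = 0" using wv by (simp add: dotp_commute)
  moreover have "dotp d u x = c * dotp d w x + s * dotp d v x" for x
    using s by (simp add: vx)
  ultimately show ?thesis using that unfolding s_def c_def by blast
qed

text \<open>Entries 0 and 1 of the unit vector w cannot both have square 1, so some standard basis
  vector is not parallel to w and can be orthogonalised against it.\<close>

lemma exists_orthonormal:
  assumes d: "2 \<le> d" and w: "dotp d w w = 1"
  obtains v where "dotp d v v = 1" "dotp d w v = 0"
proof -
  have "(\<Sum>i\<in>{0,1}. w i * w i) \<le> (\<Sum>i<d. w i * w i)"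
    using d by (intro sum_mono2) auto
  hence le: "(w 0)\<^sup>2 + (w 1)\<^sup>2 \<le> 1" using w by (simp add: dotp_def power2_eq_square)
  have "\<exists>i<d. (w i)\<^sup>2 < 1"
  proof (rule ccontr)
    assume "\<not> ?thesis"
    hence "\<And>i. i < d \<Longrightarrow> 1 \<le> (w i)\<^sup>2" by (meson not_less)
    hence "1 \<le> (w 0)\<^sup>2" "1 \<le> (w 1)\<^sup>2" using d by auto
    thus False using le by simp
  qed
  then obtain i where i: "i < d" "(w i)\<^sup>2 < 1" by blast
  define e where "e = (\<lambda>j. if j = i then 1 else 0 :: real)"
  have ex: "dotp d x e = x i" for x
  proof -
    have "dotp d x e = (\<Sum>j<d. if j = i then x i else 0)"
      unfolding dotp_def e_def by (intro sum.cong) auto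
    thus ?thesis using i by simp
  qed
  have "dotp d e e = 1" by (simp add: ex) (simp add: e_def)
  moreover have "\<bar>dotp d w e\<bar> < 1" using i by (simp add: ex abs_square_less_1)
  ultimately show ?thesis using orthonormal_complement[OF w] that by metis
qed

lemma nn_integral_sphere_orthonormal:
  fixes f :: "real \<times> real \<Rightarrow> ennreal"
  assumes d: "3 \<le> d" and w: "dotp d w w = 1" and v: "dotp d v v = 1" and wv: "dotp d w v = 0"
    and f[measurable]: "f \<in> borel_measurable (borel \<Otimes>\<^sub>M borel)"
  shows "(\<integral>\<^sup>+x. f (dotp d w x, dotp d v x) \<partial>sphere_measure d) =
         (\<integral>\<^sup>+g. f (g 0 / sqrt (dotp d g g), g 1 / sqrt (dotp d g g)) \<partial>gaussian d)"
proof -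
  have "0 < d" "1 < d" using d by auto
  note [measurable] = this[THEN measurable_component_gaussian]
  have "(\<integral>\<^sup>+x. f (dotp d w x, dotp d v x) \<partial>sphere_measure d) =
    (\<integral>\<^sup>+z. f z \<partial>distr (sphere_measure d) (borel \<Otimes>\<^sub>M borel) (\<lambda>x. (dotp d w x, dotp d v x)))"
    by (subst nn_integral_distr) auto
  also have "\<dots> = (\<integral>\<^sup>+g. f (g 0 / sqrt (dotp d g g), g 1 / sqrt (dotp d g g)) \<partial>gaussian d)"
    unfolding distr_sphere_orthonormal[OF d w v wv]
    by (subst nn_integral_distr) (simp_all del: One_nat_def)
  finally show ?thesis .
qed

text \<open>The pair (w, -v) is orthonormal too, and the joint law of the two coordinates is the
  same for every orthonormal pair. This is the symmetry on which the drift estimate rests.\<close>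

lemma integral_sphere_flip:
  fixes f :: "real \<times> real \<Rightarrow> real"
  assumes d: "3 \<le> d" and w: "dotp d w w = 1" and v: "dotp d v v = 1" and wv: "dotp d w v = 0"
    and f[measurable]: "f \<in> borel_measurable (borel \<Otimes>\<^sub>M borel)"
  shows "(\<integral>x. f (dotp d w x, dotp d v x) \<partial>sphere_measure d) = (\<integral>x. f (dotp d w x, - dotp d v x) \<partial>sphere_measure d)"
proof -
  let ?v = "\<lambda>i. - v i"
  let ?D = "\<lambda>v. distr (sphere_measure d) (borel \<Otimes>\<^sub>M borel) (\<lambda>x. (dotp d w x, dotp d v x))"
  have "dotp d ?v ?v = 1" "dotp d w ?v = 0"
    using v wv by (simp_all add: dotp_def sum_negf)
  hence D: "?D ?v = ?D v"
    using distr_sphere_orthonormal[OF d w] v wv by simp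
  have I: "(\<integral>x. f (dotp d w x, dotp d v x) \<partial>sphere_measure d) = (\<integral>z. f z \<partial>?D v)" for v
    by (subst integral_distr) auto
  show ?thesis using I[of v] I[of ?v] D by (simp add: dotp_uminus)
qed

section \<open>Band probabilities and integrals on the sphere\<close>

definition band_prob :: "nat \<Rightarrow> vec \<Rightarrow> real \<Rightarrow> real" where
  "band_prob d w b = measure (sphere_measure d) {x \<in> space (sphere_measure d). inband d w b x}"

lemma pred_inband[measurable]:
  assumes [measurable]: "f \<in> M \<rightarrow>\<^sub>M vec_space d" "g \<in> M \<rightarrow>\<^sub>M vec_space d"
  shows "Measurable.pred M (\<lambda>x. inband d (f x) b (g x))"
  unfolding inband_def by measurable

lemma pred_inband_left[measurable]:
  assumes [measurable]: "g \<in> M \<rightarrow>\<^sub>M vec_space d"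
  shows "Measurable.pred M (\<lambda>x. inband d w b (g x))"
  unfolding inband_def by measurable

lemma nn_integral_inband:
  "(\<integral>\<^sup>+x. indicator {x. inband d w b x} x \<partial>sphere_measure d) = ennreal (band_prob d w b)"
proof -
  interpret S: prob_space "sphere_measure d" by (rule prob_space_sphere_measure)
  have "(\<integral>\<^sup>+x. indicator {x. inband d w b x} x \<partial>sphere_measure d) =
     (\<integral>\<^sup>+x. indicator {x \<in> space (sphere_measure d). inband d w b x} x \<partial>sphere_measure d)"
    by (intro nn_integral_cong) (simp add: indicator_def)
  also have "\<dots> = emeasure (sphere_measure d) {x \<in> space (sphere_measure d). inband d w b x}"
    by (rule nn_integral_indicator) measurable
  finally show ?thesis by (simp add: band_prob_def S.emeasure_eq_measure)
qed

lemma nn_integral_inband_eq_gband: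
  assumes d: "3 \<le> d" and w: "dotp d w w = 1" and v: "dotp d v v = 1" and wv: "dotp d w v = 0"
    and h[measurable]: "h \<in> borel_measurable borel"
  shows "(\<integral>\<^sup>+x. indicator {x. inband d w b x} x * ennreal (h (dotp d v x)) \<partial>sphere_measure d) =
    (\<integral>\<^sup>+g. indicator (gband d b) g * ennreal (h (g 1 / sqrt (dotp d g g))) \<partial>gaussian d)"
  using nn_integral_sphere_orthonormal[OF d w v wv, of "\<lambda>(a, z). indicator {b/2..b} a * ennreal (h z)"]
  by (simp add: indicator_def inband_def gband_def)

lemma band_prob_ge:
  assumes d: "3 \<le> d" and b: "0 < b" "b\<^sup>2 * real d \<le> 1/4" and w: "dotp d w w = 1"
  shows "b * sqrt d / 64 \<le> band_prob d w b"
proof -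
  obtain v where v: "dotp d v v = 1" "dotp d w v = 0" using exists_orthonormal[OF _ w] d by auto
  have "ennreal (b * sqrt d / 64) \<le> ennreal (band_prob d w b)"
    using gaussian_band_ge[OF d b] nn_integral_inband_eq_gband[OF d w v, of "\<lambda>_. 1" b]
    by (simp add: nn_integral_inband)
  thus ?thesis by (simp add: band_prob_def ennreal_le_iff)
qed

lemma band_prob_le:
  assumes d: "3 \<le> d" and b: "0 < b" "b\<^sup>2 * real d \<le> 1/4" and w: "dotp d w w = 1"
  shows "band_prob d w b \<le> (tanarc b - tanarc (b/2)) * sqrt (real d) / 2"
proof -
  obtain v where v: "dotp d v v = 1" "dotp d w v = 0" using exists_orthonormal[OF _ w] d by auto
  have "ennreal (band_prob d w b) \<le> ennreal ((tanarc b - tanarc (b/2)) * sqrt (real d) / 2)"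
    using gaussian_band_le[OF d b] nn_integral_inband_eq_gband[OF d w v, of "\<lambda>_. 1" b]
    by (simp add: nn_integral_inband)
  moreover have "0 \<le> tanarc b - tanarc (b/2)"
    using tanarc_diff_ge[OF b(1) tanarc_le(1)[OF d b]] b by linarith
  ultimately show ?thesis by (subst (asm) ennreal_le_iff) auto
qed

lemma integrable_sphere_bounded:
  fixes f :: "vec \<Rightarrow> real"
  assumes "f \<in> borel_measurable (vec_space d)"
    and "\<And>x. x \<in> extensional {..<d} \<Longrightarrow> x \<in> unit_sphere d \<or> (\<forall>w. dotp d w x = 0) \<Longrightarrow> \<bar>f x\<bar> \<le> B"
  shows "integrable (sphere_measure d) f"
proof -
  interpret S: prob_space "sphere_measure d" by (rule prob_space_sphere_measure)
  show ?thesis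
  proof (rule S.integrable_const_bound)
    show "AE x in sphere_measure d. norm (f x) \<le> B"
      using AE_sphere_measure[of d] assms(2) by (auto elim!: AE_mp)
  qed (use assms(1) in \<open>simp cong: measurable_cong_sets\<close>)
qed

lemma integral_sphere_mono:
  fixes f g :: "vec \<Rightarrow> real"
  assumes "integrable (sphere_measure d) f" "integrable (sphere_measure d) g"
    and "\<And>x. x \<in> extensional {..<d} \<Longrightarrow> x \<in> unit_sphere d \<or> (\<forall>w. dotp d w x = 0) \<Longrightarrow> f x \<le> g x"
  shows "(\<integral>x. f x \<partial>sphere_measure d) \<le> (\<integral>x. g x \<partial>sphere_measure d)"
proof (rule integral_mono_AE[OF assms(1,2)])
  show "AE x in sphere_measure d. f x \<le> g x"
    using AE_sphere_measure[of d] assms(3) by (auto elim!: AE_mp)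
qed

lemma abs_dotp_sphere:
  assumes "dotp d w w = 1" "x \<in> unit_sphere d \<or> (\<forall>w. dotp d w x = 0)"
  shows "\<bar>dotp d w x\<bar> \<le> 1"
  using assms dotp_abs_le_1[of d w x] by (auto simp: dotp_unit_sphere)

lemma integral_inband:
  "(\<integral>x. indicator {x. inband d w b x} x \<partial>sphere_measure d) = band_prob d w b"
proof -
  interpret S: prob_space "sphere_measure d" by (rule prob_space_sphere_measure)
  have "(\<integral>x. indicator {x. inband d w b x} x \<partial>sphere_measure d) =
     (\<integral>x. indicator {x \<in> space (sphere_measure d). inband d w b x} x \<partial>sphere_measure d)"
    by (intro Bochner_Integration.integral_cong) (auto simp: indicator_def)
  also have "\<dots> = measure (sphere_measure d) {x \<in> space (sphere_measure d). inband d w b x}"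
  proof -
    have [measurable]: "{x \<in> space (sphere_measure d). inband d w b x} \<in> sets (sphere_measure d)"
      by measurable
    have "{x \<in> space (sphere_measure d). inband d w b x} \<inter> space (sphere_measure d)
      = {x \<in> space (sphere_measure d). inband d w b x}" by blast
    thus ?thesis by simp
  qed
  finally show ?thesis by (simp add: band_prob_def)
qed

text \<open>Given the band, a direction orthogonal to w still sees a component of mean size at least
  1 / (8 sqrt d). The moment is at least D / 15 and the band probability at most D * sqrt d / 2,
  with the same D, so D cancels and the width b does not enter.\<close>

lemma integral_inband_abs_ge:
  assumes d: "3 \<le> d" and b: "0 < b" "b\<^sup>2 * real d \<le> 1/4"
    and w: "dotp d w w = 1" and v: "dotp d v v = 1" and wv: "dotp d w v = 0"
  shows "band_prob d w b / (8 * sqrt d) \<le> (\<integral>x. indicator {x. inband d w b x} x * \<bar>dotp d v x\<bar> \<partial>sphere_measure d)"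
proof -
  define D where "D = tanarc b - tanarc (b/2)"
  have i: "integrable (sphere_measure d) (\<lambda>x. indicator {x. inband d w b x} x * \<bar>dotp d v x\<bar>)"
  proof (rule integrable_sphere_bounded[where B=1])
    have [measurable]: "{x \<in> space (vec_space d). inband d w b x} \<in> sets (vec_space d)" by measurable
    show "(\<lambda>x. indicator {x. inband d w b x} x * \<bar>dotp d v x\<bar>) \<in> borel_measurable (vec_space d)"
      unfolding indicator_def by measurable
  qed (use v in \<open>auto simp: indicator_def intro: abs_dotp_sphere\<close>)
  have "ennreal (D / 15) \<le> (\<integral>\<^sup>+g. indicator (gband d b) g * ennreal (\<bar>g 1\<bar> / sqrt (dotp d g g)) \<partial>gaussian d)"
    unfolding D_def using d by (intro gaussian_band_abs_ge[OF d b]) auto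
  also have "\<dots> = (\<integral>\<^sup>+x. indicator {x. inband d w b x} x * ennreal \<bar>dotp d v x\<bar> \<partial>sphere_measure d)"
    using nn_integral_inband_eq_gband[OF d w v wv, of "\<lambda>z. \<bar>z\<bar>" b] by (simp add: dotp_self_nonneg)
  also have "\<dots> = (\<integral>\<^sup>+x. ennreal (indicator {x. inband d w b x} x * \<bar>dotp d v x\<bar>) \<partial>sphere_measure d)"
    by (intro nn_integral_cong) (simp add: indicator_def)
  also have "\<dots> = ennreal (\<integral>x. indicator {x. inband d w b x} x * \<bar>dotp d v x\<bar> \<partial>sphere_measure d)"
    by (rule nn_integral_eq_integral[OF i]) (simp add: indicator_def)
  finally have "D / 15 \<le> (\<integral>x. indicator {x. inband d w b x} x * \<bar>dotp d v x\<bar> \<partial>sphere_measure d)"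
    by (subst (asm) ennreal_le_iff) (auto intro!: Bochner_Integration.integral_nonneg simp: indicator_def)
  moreover have "band_prob d w b / (8 * sqrt d) \<le> D / 15"
  proof -
    have D0: "0 \<le> D" using tanarc_diff_ge[OF b(1) tanarc_le(1)[OF d b]] b by (simp add: D_def)
    have "band_prob d w b / (8 * sqrt d) \<le> (D * sqrt d / 2) / (8 * sqrt d)"
      using band_prob_le[OF d b w] d by (intro divide_right_mono) (auto simp: D_def)
    also have "\<dots> = D / 16" using d by simp
    also have "\<dots> \<le> D / 15" using D0 by simp
    finally show ?thesis .
  qed
  ultimately show ?thesis by linarith
qed

lemma sphere_sgn_disagree_le:
  assumes d: "3 \<le> d" and w: "dotp d w w = 1" and u: "dotp d u u = 1" and c: "1/2 \<le> dotp d w u"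
  shows "measure (sphere_measure d) {x \<in> space (sphere_measure d). sgn1 (dotp d w x) \<noteq> sgn1 (dotp d u x)}
     \<le> 2 * sqrt (1 - (dotp d w u)\<^sup>2)"
proof -
  interpret S: prob_space "sphere_measure d" by (rule prob_space_sphere_measure)
  define s where "s = sqrt (1 - (dotp d w u)\<^sup>2)"
  define E where "E = {x \<in> space (sphere_measure d). sgn1 (dotp d w x) \<noteq> sgn1 (dotp d u x)}"
  have c1: "dotp d w u \<le> 1" using dotp_abs_le_1[OF w u] by simp
  show ?thesis
  proof (cases "dotp d w u = 1")
    case True
    \<comment> \<open>For w.u = 1 the difference w - u has norm zero, so the signs always agree;
      this degenerate case has no orthogonal direction to work with.\<close>
    have "dotp d (\<lambda>i. 1 * w i + (-1) * u i) (\<lambda>i. 1 * w i + (-1) * u i) = 0"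
      using w u True unfolding dotp_linear dotp_commute[of d _ "\<lambda>i. 1 * w i + (-1) * u i"]
      by (simp add: dotp_commute)
    hence "dotp d x (\<lambda>i. 1 * w i + (-1) * u i) = 0" for x by (rule dotp_eq_0_imp)
    hence "dotp d w x = dotp d u x" for x
      using dotp_linear[of d 1 w "-1" u x] by (simp add: dotp_commute)
    hence "E = {}" by (simp add: E_def)
    thus ?thesis using True unfolding E_def[symmetric] by simp
  next
    case False
    hence "\<bar>dotp d w u\<bar> < 1" using c c1 by auto
    then obtain v where v: "dotp d v v = 1" "dotp d w v = 0"
      and uv: "\<And>x. dotp d u x = dotp d w u * dotp d w x + s * dotp d v x"
      using orthonormal_complement[OF w u] unfolding s_def by metis
    have s0: "0 \<le> s" using dotp_abs_le_1[OF w u] by (simp add: s_def abs_square_le_1)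
    define A where "A = {z :: real \<times> real. \<bar>fst z\<bar> \<le> 2 * s * \<bar>snd z\<bar>}"
    have [measurable]: "A \<in> sets (borel \<Otimes>\<^sub>M borel)"
    proof -
      have "{z \<in> space (borel \<Otimes>\<^sub>M borel). \<bar>fst z\<bar> \<le> 2 * s * \<bar>snd z :: real\<bar>} \<in> sets (borel \<Otimes>\<^sub>M borel)"
        by measurable
      thus ?thesis by (simp add: A_def space_pair_measure)
    qed
    have sub: "(dotp d w x, dotp d v x) \<in> A" if "sgn1 (dotp d w x) \<noteq> sgn1 (dotp d u x)" for x
    proof -
      define a z where "a = dotp d w x" and "z = dotp d v x"
      define c where "c = dotp d w u"
      have c: "1/2 \<le> c" using assms by (simp add: c_def)
      have "\<bar>c * a\<bar> \<le> \<bar>s * z\<bar>"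
      proof (cases "0 \<le> a")
        case True
        hence "c * a + s * z < 0" using that uv[of x] by (auto simp: sgn1_def a_def z_def c_def split: if_splits)
        moreover have "0 \<le> c * a" using c True by simp
        ultimately show ?thesis by linarith
      next
        case False
        hence "0 \<le> c * a + s * z" using that uv[of x] by (auto simp: sgn1_def a_def z_def c_def split: if_splits)
        moreover have "c * a \<le> 0" using c False by (simp add: mult_le_0_iff)
        ultimately show ?thesis by linarith
      qed
      moreover have "1/2 * \<bar>a\<bar> \<le> c * \<bar>a\<bar>" using c by (intro mult_right_mono) auto
      ultimately show ?thesis using c s0 by (simp add: A_def abs_mult a_def z_def)
    qed
    define P where "P = PiM {1..<d} (\<lambda>_::nat. normal1)"
    interpret P: prob_space P
      unfolding P_def by (rule prob_space_PiM) (rule prob_space_normal1)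
    have d0: "0 < d" "1 < d" "1 \<in> {1..<d}" using d by auto
    note [measurable] = d0(1,2)[THEN measurable_component_gaussian]
    have "emeasure (sphere_measure d) E = (\<integral>\<^sup>+x. indicator E x \<partial>sphere_measure d)"
      unfolding E_def sgn1_def by (intro nn_integral_indicator[symmetric]) measurable
    also have "\<dots> \<le> (\<integral>\<^sup>+x. indicator A (dotp d w x, dotp d v x) \<partial>sphere_measure d)"
      using sub by (intro nn_integral_mono) (auto simp: indicator_def E_def)
    also have "\<dots> = (\<integral>\<^sup>+g. indicator A (g 0 / sqrt (dotp d g g), g 1 / sqrt (dotp d g g)) \<partial>gaussian d)"
      by (rule nn_integral_sphere_orthonormal[OF d w v]) measurable
    also have "\<dots> \<le> (\<integral>\<^sup>+g. indicator A (g 0, g 1) \<partial>gaussian d)"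
    proof (intro nn_integral_mono)
      fix g show "indicator A (g 0 / sqrt (dotp d g g), g 1 / sqrt (dotp d g g)) \<le> (indicator A (g 0, g 1) :: ennreal)"
      proof (cases "dotp d g g = 0")
        case True
        have "g i = 0" if "i < d" for i
        proof -
          have "dotp d (\<lambda>j. if j = i then 1 else 0) g = 0" by (rule dotp_eq_0_imp[OF True])
          moreover have "dotp d (\<lambda>j. if j = i then 1 else 0) g = (\<Sum>j<d. if j = i then g i else 0)"
            unfolding dotp_def by (intro sum.cong) auto
          ultimately show ?thesis using that by simp
        qed
        hence "g 0 = 0" "g 1 = 0" using d0 by auto
        thus ?thesis by simp
      next
        case False
        hence "0 < sqrt (dotp d g g)" using dotp_self_nonneg[of d g] by simp
        thus ?thesis by (simp add: A_def indicator_def abs_divide divide_le_cancel)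
      qed
    qed
    also have "\<dots> = (\<integral>\<^sup>+x. \<integral>\<^sup>+y. indicator A ((x(0 := y)) 0, (x(0 := y)) 1) \<partial>normal1 \<partial>P)"
      unfolding P_def by (rule nn_integral_gaussian_insert0[OF d0(1)]) measurable
    also have "\<dots> \<le> (\<integral>\<^sup>+x. ennreal (2 * s) * ennreal \<bar>x 1\<bar> \<partial>P)"
    proof (intro nn_integral_mono)
      fix x :: vec
      have "(\<integral>\<^sup>+y. indicator A ((x(0 := y)) 0, (x(0 := y)) 1) \<partial>normal1) =
         (\<integral>\<^sup>+y. indicator {- (2 * s * \<bar>x 1\<bar>) .. 2 * s * \<bar>x 1\<bar>} y \<partial>normal1)"
        by (intro nn_integral_cong) (auto simp: A_def indicator_def)
      also have "\<dots> = emeasure normal1 {- (2 * s * \<bar>x 1\<bar>) .. 2 * s * \<bar>x 1\<bar>}" by simp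
      also have "\<dots> \<le> ennreal ((2 * s * \<bar>x 1\<bar> - - (2 * s * \<bar>x 1\<bar>)) / sqrt (2 * pi))"
        using s0 by (intro emeasure_normal1_interval(1)) simp
      also have "\<dots> \<le> ennreal (2 * s * \<bar>x 1\<bar>)"
      proof (rule ennreal_leI)
        have "2 \<le> sqrt (2 * pi)" using pi_gt3 by (intro real_le_rsqrt) simp
        hence "(4 * s * \<bar>x 1\<bar>) / sqrt (2 * pi) \<le> (4 * s * \<bar>x 1\<bar>) / 2"
          using s0 by (intro divide_left_mono) auto
        thus "(2 * s * \<bar>x 1\<bar> - - (2 * s * \<bar>x 1\<bar>)) / sqrt (2 * pi) \<le> 2 * s * \<bar>x 1\<bar>" by simp
      qed
      also have "\<dots> = ennreal (2 * s) * ennreal \<bar>x 1\<bar>" using s0 by (simp add: ennreal_mult)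
      finally show "(\<integral>\<^sup>+y. indicator A ((x(0 := y)) 0, (x(0 := y)) 1) \<partial>normal1) \<le> ennreal (2 * s) * ennreal \<bar>x 1\<bar>" .
    qed
    also have "\<dots> = ennreal (2 * s) * (\<integral>\<^sup>+x. ennreal \<bar>x 1\<bar> \<partial>P)"
      unfolding P_def
      by (intro nn_integral_cmult measurable_compose[OF measurable_component_normal[OF d0(3)]]) simp
    also have "(\<integral>\<^sup>+x. ennreal \<bar>x 1\<bar> \<partial>P) = (\<integral>\<^sup>+t. ennreal \<bar>t\<bar> \<partial>distr P normal1 (\<lambda>x. x 1))"
      unfolding P_def by (subst nn_integral_distr[OF measurable_component_singleton[OF d0(3)]]) auto
    also have "distr P normal1 (\<lambda>x. x 1) = normal1"
      unfolding P_def using d0(3) by (intro distr_PiM_component prob_space_normal1)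
    also have "(\<integral>\<^sup>+t. ennreal \<bar>t\<bar> \<partial>normal1) = ennreal (sqrt (2 / pi))"
      using normal1_moments(2) by (subst nn_integral_eq_integral) (auto simp: has_bochner_integral_iff)
    also have "ennreal (2 * s) * ennreal (sqrt (2 / pi)) \<le> ennreal (2 * s)"
    proof -
      have "2 / pi \<le> 1" using pi_gt3 by (simp add: field_simps)
      hence "2 * s * sqrt (2 / pi) \<le> 2 * s" using s0 by (intro mult_left_le) auto
      hence "ennreal (2 * s * sqrt (2 / pi)) \<le> ennreal (2 * s)" by (rule ennreal_leI)
      moreover have "ennreal (2 * s * sqrt (2 / pi)) = ennreal (2 * s) * ennreal (sqrt (2 / pi))"
        using s0 by (intro ennreal_mult) auto
      ultimately show ?thesis by simp
    qed
    finally have "emeasure (sphere_measure d) E \<le> ennreal (2 * s)" .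
    thus ?thesis using s0 unfolding E_def[symmetric] s_def[symmetric]
      by (simp add: S.emeasure_eq_measure ennreal_le_iff)
  qed
qed

section \<open>One perceptron step\<close>

text \<open>The change of the iterate in \<open>mp_step\<close>, separated from the search for the
  accepted draw. For a unit vector x, w - 2 (w.x) x is the reflection of w in the hyperplane
  orthogonal to x, so the norm is preserved without renormalising.\<close>

definition update :: "nat \<Rightarrow> (vec \<Rightarrow> real) \<Rightarrow> vec \<Rightarrow> vec \<times> real \<Rightarrow> vec" where
  "update d p w z =
     (if label p (fst z) (snd z) * dotp d w (fst z) < 0
      then restrict (\<lambda>k. w k - 2 * dotp d w (fst z) * fst z k) {..<d} else w)"

definition unif01 :: "real measure" where
  "unif01 = uniform_measure lborel {0..1}"

definition draw :: "nat \<Rightarrow> (vec \<times> real) measure" where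
  "draw d = sphere_measure d \<Otimes>\<^sub>M unif01"

lemma prob_space_unif01: "prob_space unif01"
  unfolding unif01_def by (rule prob_space_uniform_measure) simp_all

lemma sets_unif01[measurable_cong]: "sets unif01 = sets borel"
  by (simp add: unif01_def)

lemma prob_space_draw: "prob_space (draw d)"
proof -
  interpret S: prob_space "sphere_measure d" by (rule prob_space_sphere_measure)
  interpret U: prob_space unif01 by (rule prob_space_unif01)
  interpret P: pair_prob_space "sphere_measure d" unif01 ..
  show ?thesis unfolding draw_def by (rule P.prob_space_axioms)
qed

lemma sets_draw[measurable_cong]: "sets (draw d) = sets (vec_space d \<Otimes>\<^sub>M borel)"
  unfolding draw_def by (intro sets_pair_measure_cong) (simp_all add: sets_unif01)

lemma nn_integral_draw:
  assumes [measurable]: "f \<in> borel_measurable (vec_space d \<Otimes>\<^sub>M borel)"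
  shows "(\<integral>\<^sup>+z. f z \<partial>draw d) = (\<integral>\<^sup>+x. \<integral>\<^sup>+r. f (x, r) \<partial>unif01 \<partial>sphere_measure d)"
proof -
  interpret U: prob_space unif01 by (rule prob_space_unif01)
  show ?thesis unfolding draw_def by (rule U.nn_integral_fst[symmetric]) measurable
qed

lemma AE_draw:
  "AE z in draw d. fst z \<in> extensional {..<d} \<and> (fst z \<in> unit_sphere d \<or> (\<forall>w. dotp d w (fst z) = 0))"
proof -
  interpret U: prob_space unif01 by (rule prob_space_unif01)
  have "distr (draw d) (sphere_measure d) fst = sphere_measure d"
    unfolding draw_def by (rule U.distr_pair_fst)
  hence "AE x in distr (draw d) (sphere_measure d) fst. x \<in> extensional {..<d} \<and> (x \<in> unit_sphere d \<or> (\<forall>w. dotp d w x = 0))"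
    using AE_sphere_measure by (simp only:)
  thus ?thesis by (rule AE_distrD[rotated]) (simp add: draw_def)
qed

lemma nn_integral_unif01_threshold:
  assumes q: "0 \<le> q" "q \<le> 1" and AB: "0 \<le> A" "0 \<le> B"
  shows "(\<integral>\<^sup>+r. ennreal (if r \<le> q then A else B) \<partial>unif01) = ennreal (q * A + (1 - q) * B)"
proof -
  have "(\<integral>\<^sup>+r. ennreal (if r \<le> q then A else B) \<partial>unif01) =
     (\<integral>\<^sup>+r. ennreal (if r \<le> q then A else B) * indicator {0..1} r \<partial>lborel)"
    unfolding unif01_def by (subst nn_integral_uniform_measure) (simp_all add: divide_ennreal_def)
  also have "\<dots> = (\<integral>\<^sup>+r. ennreal A * indicator {0..q} r + ennreal B * indicator {q<..1} r \<partial>lborel)"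
    using q by (intro nn_integral_cong) (auto simp: indicator_def)
  also have "\<dots> = ennreal A * ennreal q + ennreal B * ennreal (1 - q)"
    using q by (subst nn_integral_add) (simp_all add: nn_integral_cmult)
  also have "\<dots> = ennreal (q * A + (1 - q) * B)"
    using q AB by (simp add: ennreal_mult[symmetric] ennreal_plus[symmetric] mult.commute del: ennreal_plus)
  finally show ?thesis .
qed

lemma measurable_component_vec_space: "i < d \<Longrightarrow> (\<lambda>x. x i) \<in> borel_measurable (vec_space d)"
  unfolding vec_space_def by simp

lemma measurable_update[measurable]:
  assumes p[measurable]: "p \<in> borel_measurable (vec_space d)"
    and f[measurable]: "f \<in> M \<rightarrow>\<^sub>M vec_space d" and g[measurable]: "g \<in> M \<rightarrow>\<^sub>M vec_space d \<Otimes>\<^sub>M borel"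
  shows "(\<lambda>y. update d p (f y) (g y)) \<in> M \<rightarrow>\<^sub>M vec_space d"
proof -
  have c: "(\<lambda>y. f y k - 2 * dotp d (f y) (fst (g y)) * fst (g y) k) \<in> borel_measurable M" if "k \<in> {..<d}" for k
  proof -
    note k = measurable_component_vec_space[of k d]
    have [measurable]: "(\<lambda>y. f y k) \<in> borel_measurable M" "(\<lambda>y. fst (g y) k) \<in> borel_measurable M"
      using measurable_compose[OF f k] measurable_compose[OF _ k, of "\<lambda>y. fst (g y)" M] that by auto
    show ?thesis by measurable
  qed
  have [measurable]: "(\<lambda>y. restrict (\<lambda>k. f y k - 2 * dotp d (f y) (fst (g y)) * fst (g y) k) {..<d}) \<in> M \<rightarrow>\<^sub>M vec_space d"
    using measurable_restrict[OF c] unfolding vec_space_def .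
  have [measurable]: "(\<lambda>y. label p (fst (g y)) (snd (g y))) \<in> borel_measurable M"
    unfolding label_def by measurable
  show ?thesis unfolding update_def by measurable
qed

lemma dotp_update:
  "dotp d (update d p w z) u = dotp d w u -
     (if label p (fst z) (snd z) * dotp d w (fst z) < 0 then 2 * dotp d w (fst z) * dotp d u (fst z) else 0)"
proof -
  let ?c = "dotp d w (fst z)"
  have "dotp d (restrict (\<lambda>k. w k - 2 * ?c * fst z k) {..<d}) u
     = dotp d (\<lambda>k. 1 * w k + (- 2 * ?c) * fst z k) u"
    by (rule dotp_cong) simp_all
  also have "\<dots> = dotp d w u - 2 * ?c * dotp d u (fst z)"
    unfolding dotp_linear by (simp add: dotp_commute)
  finally show ?thesis by (simp add: update_def)
qed

lemma update_unit_sphere: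
  assumes w: "w \<in> unit_sphere d" and x: "fst z \<in> unit_sphere d"
  shows "update d p w z \<in> unit_sphere d"
proof -
  let ?x = "fst z" and ?c = "dotp d w (fst z)"
  have "dotp d (\<lambda>k. w k - 2 * ?c * ?x k) (\<lambda>k. w k - 2 * ?c * ?x k)
     = dotp d w w - 4 * ?c * dotp d w ?x + 4 * ?c\<^sup>2 * dotp d ?x ?x"
  proof -
    have "(\<lambda>k. w k - 2 * ?c * ?x k) = (\<lambda>k. 1 * w k + (- 2 * ?c) * ?x k)" by (simp add: fun_eq_iff)
    hence "dotp d (\<lambda>k. w k - 2 * ?c * ?x k) y = 1 * dotp d w y + (- 2 * ?c) * dotp d ?x y" for y
      by (simp only: dotp_linear)
    note e = this
    show ?thesis
      unfolding e dotp_commute[of d _ "\<lambda>k. w k - 2 * ?c * ?x k"] e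
      by (simp add: e dotp_commute[of d ?x w] algebra_simps power2_eq_square)
  qed
  hence "dotp d (\<lambda>k. w k - 2 * ?c * ?x k) (\<lambda>k. w k - 2 * ?c * ?x k) = 1"
    using w x by (simp add: dotp_unit_sphere power2_eq_square)
  moreover have "dotp d (restrict f {..<d}) (restrict f {..<d}) = dotp d f f" for f
    by (simp add: dotp_def)
  ultimately show ?thesis using w by (simp add: update_def unit_sphere_def)
qed

lemma inband_unit_sphere:
  assumes "0 < b" "inband d w b x" "x \<in> unit_sphere d \<or> (\<forall>w. dotp d w x = 0)"
  shows "x \<in> unit_sphere d"
  using assms by (auto simp: inband_def)

text \<open>Inside a band w.x is positive, so an update happens exactly when the label is -1, with
  probability 1 - p x. Both noise cases are merged into one expression: a linear term, which nearly
  cancels after symmetrisation, and the negative part of u.x, which supplies the drift.\<close>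

lemma noisy_loss_le:
  assumes noise: "bounded_noise d u \<eta> p" and x: "x \<in> unit_sphere d" and e: "0 \<le> \<eta>" "\<eta> < 1/2"
    and p: "0 \<le> p x" "p x \<le> 1"
  shows "(1 - p x) * dotp d u x \<le> \<eta> * dotp d u x - (1 - 2 * \<eta>) * max 0 (- dotp d u x)"
proof (cases "0 \<le> dotp d u x")
  case True
  hence "1 - p x \<le> \<eta>" using noise x by (auto simp: bounded_noise_def sgn1_def)
  thus ?thesis using True by (simp add: mult_right_mono)
next
  case False
  hence "p x \<le> \<eta>" using noise x by (force simp: bounded_noise_def sgn1_def)
  hence "(1 - p x) * dotp d u x \<le> (1 - \<eta>) * dotp d u x"
    using False by (intro mult_right_mono_neg) auto
  thus ?thesis using False by (simp add: algebra_simps)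
qed

text \<open>The integral is half the expected increase of the potential on the band. After
  \<open>noisy_loss_le\<close> the integrand depends only on a = w.x and z = v.x, and averaging over
  z and -z leaves a gain of b (1 - 2 \<eta>) s |z| / 4 against a bias of b^2 / 2 caused by the
  component of u along w.\<close>

lemma band_drift:
  assumes d: "3 \<le> d" and b: "0 < b" "b\<^sup>2 * real d \<le> 1/4"
    and w: "dotp d w w = 1" and u: "dotp d u u = 1"
    and e: "0 \<le> \<eta>" "\<eta> < 1/2" and noise: "bounded_noise d u \<eta> p"
    and pm[measurable]: "p \<in> borel_measurable (vec_space d)" and p: "\<And>x. 0 \<le> p x \<and> p x \<le> 1"
    and c: "\<bar>dotp d w u\<bar> < 1"
  defines "s \<equiv> sqrt (1 - (dotp d w u)\<^sup>2)"
  assumes bs: "b \<le> (1 - 2 * \<eta>) * s / (32 * sqrt d)"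
  shows "(\<integral>x. indicator {x. inband d w b x} x * ((1 - p x) * (dotp d w x * dotp d u x)) \<partial>sphere_measure d)
     \<le> - (band_prob d w b * (b * (1 - 2 * \<eta>) * s / (64 * sqrt d)))"
proof -
  interpret S: prob_space "sphere_measure d" by (rule prob_space_sphere_measure)
  define N where "N = 1 - 2 * \<eta>"
  define C where "C = dotp d w u"
  have N: "0 < N" "N \<le> 1" using e by (auto simp: N_def)
  have s0: "0 \<le> s" using c by (simp add: s_def abs_square_le_1)
  have s1: "s \<le> 1" by (simp add: s_def)
  have b1: "b \<le> 1/2" by (rule tanarc_le(1)[OF d b])
  obtain v where v: "dotp d v v = 1" "dotp d w v = 0"
    and uv: "\<And>x. dotp d u x = C * dotp d w x + s * dotp d v x"
    using orthonormal_complement[OF w u c] unfolding s_def C_def by metis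
  let ?S = "sphere_measure d" and ?I = "\<lambda>x. indicator {x. inband d w b x} x :: real"
  define G :: "real \<times> real \<Rightarrow> real" where
    "G = (\<lambda>(a, z). indicator {b/2..b} a * (a * (N * max 0 (- (C * a + s * z)) - \<eta> * (C * a + s * z))))"
  have Gm[measurable]: "G \<in> borel_measurable (borel \<Otimes>\<^sub>M borel)"
    unfolding G_def by measurable
  have ind: "?I x = indicator {b/2..b} (dotp d w x)" for x
    by (simp add: indicator_def inband_def)
  have Im[measurable]: "?I \<in> borel_measurable (vec_space d)"
    unfolding ind by measurable
  have C1: "\<bar>C\<bar> \<le> 1" using c by (simp add: C_def)
  have Gb: "\<bar>G (a, z)\<bar> \<le> 6" if "\<bar>z\<bar> \<le> 1" for a z
  proof (cases "a \<in> {b/2..b}")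
    case True
    hence a: "0 \<le> a" "a \<le> 1" using b b1 by auto
    define y where "y = C * a + s * z"
    have y: "\<bar>y\<bar> \<le> 2"
    proof -
      have "\<bar>C * a\<bar> \<le> 1 * 1" unfolding abs_mult using C1 a by (intro mult_mono) auto
      moreover have "\<bar>s * z\<bar> \<le> 1 * 1" unfolding abs_mult using s0 s1 that by (intro mult_mono) auto
      ultimately show ?thesis unfolding y_def by linarith
    qed
    have "\<bar>N * max 0 (- y) - \<eta> * y\<bar> \<le> \<bar>N * max 0 (- y)\<bar> + \<bar>\<eta> * y\<bar>" by linarith
    moreover have "\<bar>N * max 0 (- y)\<bar> \<le> 1 * 2" unfolding abs_mult using N y by (intro mult_mono) auto
    moreover have "\<bar>\<eta> * y\<bar> \<le> 1 * 2" unfolding abs_mult using e y by (intro mult_mono) auto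
    ultimately have "\<bar>a\<bar> * \<bar>N * max 0 (- y) - \<eta> * y\<bar> \<le> 1 * 4" using a by (intro mult_mono) auto
    thus ?thesis using True a unfolding G_def split y_def[symmetric] by (simp add: abs_mult)
  qed (simp add: G_def)
  have iG: "integrable ?S (\<lambda>x. G (dotp d w x, dotp d v x))"
    by (rule integrable_sphere_bounded[where B=6]) (auto intro!: Gb abs_dotp_sphere v)
  have iG': "integrable ?S (\<lambda>x. G (dotp d w x, - dotp d v x))"
    by (rule integrable_sphere_bounded[where B=6]) (auto intro!: Gb simp: abs_dotp_sphere v)
  have iA: "integrable ?S (\<lambda>x. ?I x * \<bar>dotp d v x\<bar>)"
    by (rule integrable_sphere_bounded[where B=1]) (auto simp: indicator_def abs_dotp_sphere v)
  have iI: "integrable ?S ?I"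
    by (rule integrable_sphere_bounded[where B=1]) (auto simp: indicator_def)
  have iL: "integrable ?S (\<lambda>x. ?I x * ((1 - p x) * (dotp d w x * dotp d u x)))"
  proof (rule integrable_sphere_bounded[where B=1])
    fix x assume x: "x \<in> unit_sphere d \<or> (\<forall>w. dotp d w x = 0)"
    have "\<bar>dotp d w x\<bar> \<le> 1" "\<bar>dotp d u x\<bar> \<le> 1" by (intro abs_dotp_sphere w u x)+
    hence "\<bar>?I x\<bar> * (\<bar>1 - p x\<bar> * (\<bar>dotp d w x\<bar> * \<bar>dotp d u x\<bar>)) \<le> 1 * (1 * (1 * 1))"
      using p[of x] by (intro mult_mono) (auto simp: indicator_def)
    thus "\<bar>?I x * ((1 - p x) * (dotp d w x * dotp d u x))\<bar> \<le> 1" by (simp add: abs_mult)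
  qed measurable
  have "(\<integral>x. ?I x * ((1 - p x) * (dotp d w x * dotp d u x)) \<partial>?S) \<le> (\<integral>x. - G (dotp d w x, dotp d v x) \<partial>?S)"
  proof (rule integral_sphere_mono[OF iL])
    fix x assume x: "x \<in> unit_sphere d \<or> (\<forall>w. dotp d w x = 0)"
    show "?I x * ((1 - p x) * (dotp d w x * dotp d u x)) \<le> - G (dotp d w x, dotp d v x)"
    proof (cases "inband d w b x")
      case True
      hence xu: "x \<in> unit_sphere d" using inband_unit_sphere[OF b(1) _ x] by simp
      have a: "0 \<le> dotp d w x" using True b by (simp add: inband_def)
      have "dotp d w x * ((1 - p x) * dotp d u x) \<le>
         dotp d w x * (\<eta> * dotp d u x - N * max 0 (- dotp d u x))"
        using noisy_loss_le[OF noise xu e] p[of x] a unfolding N_def by (intro mult_left_mono) auto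
      thus ?thesis using True unfolding G_def uv[symmetric] split
        by (simp add: ind[symmetric] algebra_simps)
    qed (simp add: G_def ind[symmetric])
  qed (use iG in simp)
  also have "\<dots> = - (\<integral>x. G (dotp d w x, dotp d v x) \<partial>?S)" by simp
  also have "(\<integral>x. G (dotp d w x, dotp d v x) \<partial>?S) =
      (\<integral>x. (G (dotp d w x, dotp d v x) + G (dotp d w x, - dotp d v x)) / 2 \<partial>?S)"
    using integral_sphere_flip[OF d w v Gm] iG iG' by simp
  also have "- \<dots> \<le> - (\<integral>x. b * N * s / 4 * (?I x * \<bar>dotp d v x\<bar>) - b\<^sup>2 / 2 * ?I x \<partial>?S)"
  proof (subst neg_le_iff_le, rule integral_sphere_mono)
    fix x
    define a z where "a = dotp d w x" and "z = dotp d v x"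
    show "b * N * s / 4 * (?I x * \<bar>dotp d v x\<bar>) - b\<^sup>2 / 2 * ?I x \<le>
       (G (dotp d w x, dotp d v x) + G (dotp d w x, - dotp d v x)) / 2"
    proof (cases "a \<in> {b/2..b}")
      case True
      hence a: "b/2 \<le> a" "a \<le> b" "0 \<le> a" using b by auto
      \<comment> \<open>symmetrising in z cancels the sign of z and leaves |z| minus the small bias C a\<close>
      have "s * \<bar>z\<bar> - C * a \<le> max 0 (- (C * a + s * z)) + max 0 (- (C * a - s * z))"
        using s0 by (cases "0 \<le> z") auto
      hence "N * (s * \<bar>z\<bar> - C * a) \<le> N * (max 0 (- (C * a + s * z)) + max 0 (- (C * a - s * z)))"
        using N by (intro mult_left_mono) auto
      hence "N * s * \<bar>z\<bar> - C * a \<le> (N * max 0 (- (C * a + s * z)) - \<eta> * (C * a + s * z)) +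
         (N * max 0 (- (C * a - s * z)) - \<eta> * (C * a - s * z))"
        by (simp add: N_def algebra_simps)
      hence "a * (N * s * \<bar>z\<bar> - C * a) \<le> G (a, z) + G (a, - z)"
        using True mult_left_mono[OF _ a(3)] by (simp add: G_def distrib_left[symmetric])
      moreover have "b / 2 * (N * s * \<bar>z\<bar>) \<le> a * (N * s * \<bar>z\<bar>)"
        using a N s0 by (intro mult_right_mono) auto
      moreover have "C * (a * a) \<le> 1 * (b * b)"
        using a C1 by (intro mult_mono) auto
      ultimately have "b / 2 * (N * s * \<bar>z\<bar>) - b * b \<le> G (a, z) + G (a, - z)"
        by (simp add: algebra_simps)
      thus ?thesis using True unfolding ind a_def[symmetric] z_def[symmetric]
        by (simp add: power2_eq_square field_simps)
    qed (simp add: G_def ind a_def)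
  qed (use iG iG' iA iI in auto)
  also have "(\<integral>x. b * N * s / 4 * (?I x * \<bar>dotp d v x\<bar>) - b\<^sup>2 / 2 * ?I x \<partial>?S) =
      b * N * s / 4 * (\<integral>x. ?I x * \<bar>dotp d v x\<bar> \<partial>?S) - b\<^sup>2 / 2 * band_prob d w b"
  proof -
    have "(\<integral>x. b * N * s / 4 * (?I x * \<bar>dotp d v x\<bar>) - b\<^sup>2 / 2 * ?I x \<partial>?S) =
      (\<integral>x. b * N * s / 4 * (?I x * \<bar>dotp d v x\<bar>) \<partial>?S) - (\<integral>x. b\<^sup>2 / 2 * ?I x \<partial>?S)"
      by (rule Bochner_Integration.integral_diff) (use iA iI in auto)
    thus ?thesis unfolding integral_mult_right_zero integral_inband .
  qed
  also have "- (b * N * s / 4 * (\<integral>x. ?I x * \<bar>dotp d v x\<bar> \<partial>?S) - b\<^sup>2 / 2 * band_prob d w b) \<le>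
     - (b * N * s / 4 * (band_prob d w b / (8 * sqrt d)) - b\<^sup>2 / 2 * band_prob d w b)"
    using integral_inband_abs_ge[OF d b w v] b N s0
    by (intro le_imp_neg_le diff_right_mono mult_left_mono) auto
  \<comment> \<open>With q the band probability, the main term is q b N s / (32 sqrt d); the
    hypothesis \<open>bs\<close> bounds the bias q b^2 / 2 by half of it.\<close>
  also have "\<dots> \<le> - (band_prob d w b * (b * (1 - 2 * \<eta>) * s / (64 * sqrt d)))"
  proof -
    have "b * b \<le> b * (N * s / (32 * sqrt d))"
      using bs b by (intro mult_left_mono) (auto simp: N_def)
    hence "b\<^sup>2 / 2 \<le> b * (N * s / (32 * sqrt d)) / 2"
      unfolding power2_eq_square by (rule divide_right_mono) simp
    hence "band_prob d w b * (b\<^sup>2 / 2) \<le> band_prob d w b * (b * (N * s / (32 * sqrt d)) / 2)"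
      by (rule mult_left_mono) (simp add: band_prob_def)
    moreover have "b * N * s / 4 * (band_prob d w b / (8 * sqrt d)) = band_prob d w b * (b * (N * s / (32 * sqrt d)))"
      by (simp add: field_simps)
    moreover have "band_prob d w b * (b * (1 - 2 * \<eta>) * s / (64 * sqrt d)) =
       band_prob d w b * (b * (N * s / (32 * sqrt d)) / 2)"
      by (simp add: N_def field_simps)
    moreover have "band_prob d w b * (b * (N * s / (32 * sqrt d)) / 2) = band_prob d w b * (b * (N * s / (32 * sqrt d))) / 2" by simp
    moreover have "- (X - Y) \<le> - (X / 2)" if "Y \<le> X / 2" for X Y :: real
      using that by linarith
    ultimately show ?thesis by (simp only: mult.commute[of "b\<^sup>2 / 2"])
  qed
  finally show ?thesis .
qed

text \<open>For z = -t < 0 the claim follows by multiplying exp t >= 1 + t + t^2 / 2 with 1 - t +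
  t^2, since the product of the two polynomials is at least 1.\<close>

lemma exp_le_quadratic:
  assumes "\<bar>z\<bar> \<le> 1"
  shows "exp z \<le> 1 + z + (z::real)\<^sup>2"
proof (cases "0 \<le> z")
  case True
  thus ?thesis using assms exp_bound by simp
next
  case False
  define t where "t = - z"
  have t: "0 \<le> t" using False by (simp add: t_def)
  have "(1 - t + t\<^sup>2) * (1 + t + t\<^sup>2 / 2) = 1 + (t\<^sup>2 + t^3 + t^4) / 2"
    by (simp add: field_simps power2_eq_square power3_eq_cube power4_eq_xxxx)
  hence ge1: "1 \<le> (1 - t + t\<^sup>2) * (1 + t + t\<^sup>2 / 2)" using t by simp
  have pos: "0 \<le> 1 - t + t\<^sup>2"
    using sum_squares_ge_zero[of "t - 1/2" 0] by (simp add: power2_eq_square field_simps)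
  have "1 \<le> (1 - t + t\<^sup>2) * exp t"
    using ge1 mult_left_mono[OF exp_lower_Taylor_quadratic[OF t] pos] by linarith
  hence "exp (- t) \<le> (1 - t + t\<^sup>2) * exp t * exp (- t)" by simp
  also have "\<dots> = 1 - t + t\<^sup>2" by (simp add: exp_minus)
  finally show ?thesis by (simp add: t_def)
qed

text \<open>u splits into (w.u) w and a remainder of norm equal to the sine; the first part
  contributes at most b, the second is bounded by Cauchy-Schwarz. The remainder is left
  unnormalised, so w = u and w = -u are allowed.\<close>

lemma abs_dotp_le_band:
  assumes w: "dotp d w w = 1" and u: "dotp d u u = 1" and x: "x \<in> unit_sphere d" and b: "0 < b"
    and i: "inband d w b x"
  shows "\<bar>dotp d u x\<bar> \<le> b + sqrt (1 - (dotp d w u)\<^sup>2)"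
proof -
  define c where "c = dotp d w u"
  have c1: "\<bar>c\<bar> \<le> 1" unfolding c_def by (rule dotp_abs_le_1[OF w u])
  define y where "y = (\<lambda>k. 1 * u k + (- c) * w k)"
  have y: "dotp d y z = dotp d u z - c * dotp d w z" for z
    unfolding y_def dotp_linear by simp
  have yy: "dotp d y y = 1 - c\<^sup>2"
  proof -
    have "dotp d y y = dotp d y u - c * dotp d y w"
      using y[of y] dotp_commute[of d u y] dotp_commute[of d w y] by simp
    also have "dotp d y w = 0" using w dotp_commute[of d u w] by (simp add: y c_def)
    also have "dotp d y u = 1 - c\<^sup>2" using u by (simp add: y c_def power2_eq_square)
    finally show ?thesis by simp
  qed
  have "(dotp d y x)\<^sup>2 \<le> 1 - c\<^sup>2"
    using dotp_Cauchy_Schwarz[of d y x] x by (simp add: yy dotp_unit_sphere)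
  hence "\<bar>dotp d y x\<bar> \<le> sqrt (1 - c\<^sup>2)" by (metis real_sqrt_abs real_sqrt_le_mono)
  moreover have "\<bar>c * dotp d w x\<bar> \<le> 1 * b"
    unfolding abs_mult using c1 i b by (intro mult_mono) (auto simp: inband_def)
  ultimately show ?thesis unfolding c_def[symmetric] using y[of x] by linarith
qed

text \<open>Given x in the band, averaging over the label multiplies exp (l (1 - w.u)) by
  \<open>L x\<close>: the factor is 1 for label +1 and exp (2 l (w.x)(u.x)) for label -1. That
  exponent is at most K <= 1 in absolute value, so the quadratic bound on exp leaves
  \<open>band_drift\<close> as first-order term and K^2 as error.\<close>

lemma band_exp_drift:
  assumes d: "3 \<le> d" and b: "0 < b" "b\<^sup>2 * real d \<le> 1/4"
    and w: "dotp d w w = 1" and u: "dotp d u u = 1"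
    and e: "0 \<le> \<eta>" "\<eta> < 1/2" and noise: "bounded_noise d u \<eta> p"
    and pm[measurable]: "p \<in> borel_measurable (vec_space d)" and p: "\<And>x. 0 \<le> p x \<and> p x \<le> 1"
    and c: "\<bar>dotp d w u\<bar> < 1"
  defines "s \<equiv> sqrt (1 - (dotp d w u)\<^sup>2)"
  assumes bs: "b \<le> (1 - 2 * \<eta>) * s / (32 * sqrt d)"
    and l: "0 \<le> l" "2 * l * (b * (b + s)) \<le> 1"
  shows "(\<integral>\<^sup>+z. (if inband d w b (fst z) then ennreal (exp (l * (1 - dotp d (update d p w z) u))) else 0) \<partial>draw d)
     \<le> ennreal (band_prob d w b * (exp (l * (1 - dotp d w u)) *
         (1 - 2 * l * (b * (1 - 2 * \<eta>) * s / (64 * sqrt d)) + (2 * l * (b * (b + s)))\<^sup>2)))"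
proof -
  interpret S: prob_space "sphere_measure d" by (rule prob_space_sphere_measure)
  define K where "K = 2 * l * (b * (b + s))"
  define A where "A = exp (l * (1 - dotp d w u))"
  define L where "L x = 1 + (1 - p x) * (exp (2 * l * (dotp d w x * dotp d u x)) - 1)" for x
  define D where "D = b * (1 - 2 * \<eta>) * s / (64 * sqrt d)"
  let ?S = "sphere_measure d" and ?I = "\<lambda>x. indicator {x. inband d w b x} x :: real"
  have s0: "0 \<le> s" using c by (simp add: s_def abs_square_le_1)
  have K0: "0 \<le> K" using l b s0 by (simp add: K_def)
  have ind: "?I x = indicator {b/2..b} (dotp d w x)" for x
    by (simp add: indicator_def inband_def)
  have Im[measurable]: "?I \<in> borel_measurable (vec_space d)"
    unfolding ind by measurable
  have Lm[measurable]: "L \<in> borel_measurable (vec_space d)" unfolding L_def by measurable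
  have Leq: "L x = p x + (1 - p x) * exp (2 * l * (dotp d w x * dotp d u x))" for x
    by (simp add: L_def algebra_simps)
  have L0: "0 \<le> L x" for x unfolding Leq using p[of x] by simp
  have Lle: "L x \<le> 1 + 2 * l * ((1 - p x) * (dotp d w x * dotp d u x)) + K\<^sup>2"
    if i: "inband d w b x" and x: "x \<in> unit_sphere d" for x
  proof -
    define z where "z = 2 * l * (dotp d w x * dotp d u x)"
    have "\<bar>dotp d w x\<bar> * \<bar>dotp d u x\<bar> \<le> b * (b + s)"
      using i b abs_dotp_le_band[OF w u x b(1) i] unfolding s_def[symmetric]
      by (intro mult_mono) (auto simp: inband_def)
    hence "2 * l * (\<bar>dotp d w x\<bar> * \<bar>dotp d u x\<bar>) \<le> 2 * l * (b * (b + s))"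
      using l by (intro mult_left_mono) auto
    hence zK: "\<bar>z\<bar> \<le> K" using l by (simp add: z_def K_def abs_mult)
    hence "\<bar>z\<bar> \<le> 1" using l by (simp add: K_def)
    hence "exp z - 1 \<le> z + z\<^sup>2" using exp_le_quadratic[of z] by linarith
    also have "z\<^sup>2 \<le> K\<^sup>2" using zK by (metis abs_le_square_iff abs_of_nonneg K0)
    finally have "(1 - p x) * (exp z - 1) \<le> (1 - p x) * (z + K\<^sup>2)"
      using p[of x] by (intro mult_left_mono) auto
    also have "\<dots> \<le> (1 - p x) * z + 1 * K\<^sup>2"
      using p[of x] unfolding distrib_left by (intro add_left_mono mult_right_mono) auto
    finally show ?thesis unfolding L_def z_def[symmetric] by (simp add: z_def algebra_simps)
  qed
  have iI: "integrable ?S ?I"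
    by (rule integrable_sphere_bounded[where B=1]) (auto simp: indicator_def)
  have ay: "\<bar>dotp d w x * dotp d u x\<bar> \<le> 1" if x: "x \<in> unit_sphere d \<or> (\<forall>w. dotp d w x = 0)" for x
    unfolding abs_mult using mult_mono[OF abs_dotp_sphere[OF w x] abs_dotp_sphere[OF u x]] by simp
  have iG: "integrable ?S (\<lambda>x. ?I x * ((1 - p x) * (dotp d w x * dotp d u x)))"
  proof (rule integrable_sphere_bounded[where B=1])
    fix x assume x: "x \<in> unit_sphere d \<or> (\<forall>w. dotp d w x = 0)"
    have "\<bar>?I x\<bar> * (\<bar>1 - p x\<bar> * \<bar>dotp d w x * dotp d u x\<bar>) \<le> 1 * (1 * 1)"
      using p[of x] ay[OF x] by (intro mult_mono) (auto simp: indicator_def)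
    thus "\<bar>?I x * ((1 - p x) * (dotp d w x * dotp d u x))\<bar> \<le> 1" by (simp add: abs_mult)
  qed measurable
  have iL: "integrable ?S (\<lambda>x. ?I x * L x)"
  proof (rule integrable_sphere_bounded[where B="1 + exp (2 * l)"])
    fix x assume x: "x \<in> unit_sphere d \<or> (\<forall>w. dotp d w x = 0)"
    have "2 * l * (dotp d w x * dotp d u x) \<le> 2 * l * 1"
      using ay[OF x] l by (intro mult_left_mono) auto
    hence "(1 - p x) * exp (2 * l * (dotp d w x * dotp d u x)) \<le> 1 * exp (2 * l)"
      using p[of x] by (intro mult_mono) auto
    hence "L x \<le> 1 + exp (2 * l)" using p[of x] unfolding Leq by simp
    hence "\<bar>?I x\<bar> * \<bar>L x\<bar> \<le> 1 * (1 + exp (2 * l))"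
      using L0[of x] by (intro mult_mono) (auto simp: indicator_def)
    thus "\<bar>?I x * L x\<bar> \<le> 1 + exp (2 * l)" by (simp add: abs_mult)
  qed measurable
  have "(\<integral>x. ?I x * L x \<partial>?S) \<le>
     (\<integral>x. (1 + K\<^sup>2) * ?I x + 2 * l * (?I x * ((1 - p x) * (dotp d w x * dotp d u x))) \<partial>?S)"
  proof (rule integral_sphere_mono[OF iL])
    fix x assume x: "x \<in> unit_sphere d \<or> (\<forall>w. dotp d w x = 0)"
    show "?I x * L x \<le> (1 + K\<^sup>2) * ?I x + 2 * l * (?I x * ((1 - p x) * (dotp d w x * dotp d u x)))"
      using Lle[of x] inband_unit_sphere[OF b(1) _ x, of w] by (cases "inband d w b x") auto
  qed (use iI iG in auto)
  also have "\<dots> = (1 + K\<^sup>2) * band_prob d w b +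
      2 * l * (\<integral>x. ?I x * ((1 - p x) * (dotp d w x * dotp d u x)) \<partial>?S)"
  proof -
    have "(\<integral>x. (1 + K\<^sup>2) * ?I x + 2 * l * (?I x * ((1 - p x) * (dotp d w x * dotp d u x))) \<partial>?S) =
      (\<integral>x. (1 + K\<^sup>2) * ?I x \<partial>?S) + (\<integral>x. 2 * l * (?I x * ((1 - p x) * (dotp d w x * dotp d u x))) \<partial>?S)"
      by (rule Bochner_Integration.integral_add) (use iI iG in auto)
    thus ?thesis unfolding integral_mult_right_zero integral_inband .
  qed
  also have "\<dots> \<le> (1 + K\<^sup>2) * band_prob d w b + 2 * l * (- (band_prob d w b * D))"
    using band_drift[OF d b w u e noise pm p c] bs l unfolding s_def D_def
    by (intro add_left_mono mult_left_mono) auto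
  also have "\<dots> = band_prob d w b * (1 - 2 * l * D + K\<^sup>2)" by (simp add: algebra_simps)
  finally have main: "(\<integral>x. ?I x * L x \<partial>?S) \<le> band_prob d w b * (1 - 2 * l * D + K\<^sup>2)" .
  define h where "h z = dotp d (update d p w z) u" for z
  have [measurable]: "h \<in> borel_measurable (vec_space d \<Otimes>\<^sub>M borel)"
    unfolding h_def dotp_update label_def by measurable
  have fm: "(\<lambda>z. if inband d w b (fst z) then ennreal (exp (l * (1 - dotp d (update d p w z) u))) else 0)
     \<in> borel_measurable (vec_space d \<Otimes>\<^sub>M borel)"
    unfolding h_def[symmetric] by measurable
  have "(\<integral>\<^sup>+z. (if inband d w b (fst z) then ennreal (exp (l * (1 - dotp d (update d p w z) u))) else 0) \<partial>draw d)
     = (\<integral>\<^sup>+x. \<integral>\<^sup>+r. (if inband d w b x then ennreal (exp (l * (1 - dotp d (update d p w (x, r)) u))) else 0) \<partial>unif01 \<partial>?S)"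
    by (subst nn_integral_draw[OF fm]) simp
  also have "\<dots> = (\<integral>\<^sup>+x. ennreal (A * (?I x * L x)) \<partial>?S)"
  proof (intro nn_integral_cong)
    fix x
    show "(\<integral>\<^sup>+r. (if inband d w b x then ennreal (exp (l * (1 - dotp d (update d p w (x, r)) u))) else 0) \<partial>unif01)
       = ennreal (A * (?I x * L x))"
    proof (cases "inband d w b x")
      case True
      hence a: "0 < dotp d w x" using b by (simp add: inband_def)
      define B where "B = A * exp (2 * l * (dotp d w x * dotp d u x))"
      have "exp (l * (1 - dotp d (update d p w (x, r)) u)) = (if r \<le> p x then A else B)" for r
      proof (cases "r \<le> p x")
        case False
        have "l * (1 - (dotp d w u - 2 * dotp d w x * dotp d u x)) =
          l * (1 - dotp d w u) + 2 * l * (dotp d w x * dotp d u x)" by (simp add: algebra_simps)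
        thus ?thesis using False a by (simp add: dotp_update label_def A_def B_def exp_add)
      qed (use a in \<open>simp add: dotp_update label_def A_def\<close>)
      hence "(\<integral>\<^sup>+r. (if inband d w b x then ennreal (exp (l * (1 - dotp d (update d p w (x, r)) u))) else 0) \<partial>unif01)
         = (\<integral>\<^sup>+r. ennreal (if r \<le> p x then A else B) \<partial>unif01)"
        using True by simp
      also have "\<dots> = ennreal (p x * A + (1 - p x) * B)"
        using p[of x] by (intro nn_integral_unif01_threshold) (auto simp: A_def B_def)
      finally show ?thesis using True by (simp add: B_def Leq algebra_simps)
    qed simp
  qed
  also have "\<dots> = ennreal (\<integral>x. A * (?I x * L x) \<partial>?S)"
    using iL L0 by (intro nn_integral_eq_integral) (auto simp: A_def)
  also have "\<dots> \<le> ennreal (A * (band_prob d w b * (1 - 2 * l * D + K\<^sup>2)))"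
    unfolding integral_mult_right_zero using main by (intro ennreal_leI mult_left_mono) (auto simp: A_def)
  finally show ?thesis by (simp add: A_def D_def K_def mult_ac)
qed

section \<open>Running the algorithm draw by draw\<close>

text \<open>
  Processes the first T raw draws only; the list returned holds the bands of the queries that are
  still to be made after these draws, so it is empty iff the run is complete.
\<close>

fun raw_run :: "nat \<Rightarrow> (vec \<Rightarrow> real) \<Rightarrow> nat \<Rightarrow> real list \<Rightarrow> vec \<Rightarrow> (vec \<times> real) stream \<Rightarrow> real list \<times> vec" where
  "raw_run d p 0 bl w s = (bl, w)"
| "raw_run d p (Suc T) [] w s = ([], w)"
| "raw_run d p (Suc T) (b # bl) w s =
     (if inband d w b (fst (shd s)) then raw_run d p T bl (update d p w (shd s)) (stl s)
      else raw_run d p T (b # bl) w (stl s))"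

text \<open>If draw i is accepted, \<open>next_acc\<close> from i is i; if it is rejected,
  \<open>next_acc\<close> from i and from i + 1 agree. An empty remaining list guarantees that every
  \<open>LEAST\<close> involved is attained among the draws processed, so the algorithm is
  determined there and has drawn at most T examples.\<close>

lemma fold_mp_step_raw_run:
  assumes "fst (raw_run d p T bl w (sdrop i s)) = []"
  shows "fst (fold (\<lambda>b. mp_step d p b s) bl (w, i)) = snd (raw_run d p T bl w (sdrop i s))
    \<and> snd (fold (\<lambda>b. mp_step d p b s) bl (w, i)) \<le> i + T"
  using assms
proof (induction T arbitrary: bl w i)
  case 0
  thus ?case by simp
next
  case (Suc T)
  show ?case
  proof (cases bl)
    case Nil
    thus ?thesis by simp
  next
    case (Cons b bl')
    have sh: "shd (sdrop i s) = s !! i" "stl (sdrop i s) = sdrop (Suc i) s"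
      by (simp_all add: sdrop_simps)
    show ?thesis
    proof (cases "inband d w b (fst (s !! i))")
      case True
      have "next_acc d w b s i = i"
        unfolding next_acc_def using True by (intro Least_equality) auto
      hence "mp_step d p b s (w, i) = (update d p w (s !! i), Suc i)"
        by (simp add: mp_step_def update_def Let_def)
      thus ?thesis
        using Suc.IH[of bl' "update d p w (s !! i)" "Suc i"] Suc.prems True
        by (simp add: Cons sh del: sdrop.simps)
    next
      case False
      have "(i \<le> j \<and> inband d w b (fst (s !! j))) = (Suc i \<le> j \<and> inband d w b (fst (s !! j)))" for j
        using False by (metis Suc_le_eq le_less_Suc_eq not_less_eq order.order_iff_strict less_or_eq_imp_le)
      hence "next_acc d w b s i = next_acc d w b s (Suc i)"
        unfolding next_acc_def by simp
      hence "mp_step d p b s (w, i) = mp_step d p b s (w, Suc i)"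
        by (simp add: mp_step_def Let_def)
      thus ?thesis
        using Suc.IH[of "b # bl'" w "Suc i"] Suc.prems False
        by (simp add: Cons sh del: sdrop.simps)
    qed
  qed
qed

lemma sample_space_eq: "sample_space d = stream_space (draw d)"
  by (simp add: sample_space_def draw_def unif01_def)

lemma prob_space_sample_space: "prob_space (sample_space d)"
  unfolding sample_space_eq by (rule prob_space.prob_space_stream_space[OF prob_space_draw])

lemma measurable_draw_iff: "f \<in> M \<rightarrow>\<^sub>M draw d \<longleftrightarrow> f \<in> M \<rightarrow>\<^sub>M vec_space d \<Otimes>\<^sub>M borel"
  by (rule measurable_cong_sets[THEN eqset_imp_iff, OF refl sets_draw])

text \<open>Stating measurability through predicates Q, with each list fixed, avoids a sigma-algebra
  on lists of bands. The iterate and the stream are general measurable functions so that the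
  induction can pass to the updated iterate and the tail of the stream.\<close>

lemma pred_raw_run:
  assumes p[measurable]: "p \<in> borel_measurable (vec_space d)"
    and Q: "\<And>bl. Measurable.pred (vec_space d) (\<lambda>w. Q (bl, w))"
    and "g \<in> M \<rightarrow>\<^sub>M vec_space d" "f \<in> M \<rightarrow>\<^sub>M stream_space (draw d)"
  shows "Measurable.pred M (\<lambda>y. Q (raw_run d p T bl (g y) (f y)))"
  using assms(3,4)
proof (induction T arbitrary: bl g f)
  case 0
  thus ?case using measurable_compose[OF 0(1) Q] by simp
next
  case (Suc T)
  note [measurable] = Suc.prems
  show ?case
  proof (cases bl)
    case Nil
    thus ?thesis using measurable_compose[OF Suc.prems(1) Q] by simp
  next
    case (Cons b bl')
    have "(\<lambda>y. shd (f y)) \<in> M \<rightarrow>\<^sub>M draw d" by measurable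
    hence sh[measurable]: "(\<lambda>y. shd (f y)) \<in> M \<rightarrow>\<^sub>M vec_space d \<Otimes>\<^sub>M borel"
      by (simp only: measurable_draw_iff)
    have "(\<lambda>y. update d p (g y) (shd (f y))) \<in> M \<rightarrow>\<^sub>M vec_space d" by measurable
    hence [measurable]: "Measurable.pred M (\<lambda>y. Q (raw_run d p T bl' (update d p (g y) (shd (f y))) (stl (f y))))"
      by (rule Suc.IH) measurable
    have [measurable]: "Measurable.pred M (\<lambda>y. Q (raw_run d p T (b # bl') (g y) (stl (f y))))"
      by (rule Suc.IH) measurable
    have "(\<lambda>y. fst (shd (f y))) \<in> M \<rightarrow>\<^sub>M vec_space d" by measurable
    from pred_inband[OF Suc.prems(1) this]
    have [measurable]: "Measurable.pred M (\<lambda>y. inband d (g y) b (fst (shd (f y))))" .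
    have "Measurable.pred M (\<lambda>y. if inband d (g y) b (fst (shd (f y))) then Q (raw_run d p T bl' (update d p (g y) (shd (f y))) (stl (f y)))
      else Q (raw_run d p T (b # bl') (g y) (stl (f y))))"
      by measurable
    thus ?thesis by (simp add: Cons if_distrib[of Q])
  qed
qed

section \<open>Probabilities of events of truncated runs\<close>

definition run_prob :: "nat \<Rightarrow> (vec \<Rightarrow> real) \<Rightarrow> (real list \<times> vec \<Rightarrow> bool) \<Rightarrow> nat \<Rightarrow> real list \<Rightarrow> vec \<Rightarrow> ennreal" where
  "run_prob d p Q T bl w = emeasure (sample_space d) {s \<in> space (sample_space d). Q (raw_run d p T bl w s)}"

lemma run_prob_le_1: "run_prob d p Q T bl w \<le> 1"
  unfolding run_prob_def
  using prob_space.emeasure_le_1[OF prob_space_sample_space] by simp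

lemma unit_sphere_space: "w \<in> unit_sphere d \<Longrightarrow> w \<in> space (vec_space d)"
  by (simp add: unit_sphere_def space_vec_space)

text \<open>The Markov property: the tail of the stream is a fresh sample independent of the first
  draw.\<close>

lemma run_prob_Cons:
  assumes p: "p \<in> borel_measurable (vec_space d)"
    and Q: "\<And>bl. Measurable.pred (vec_space d) (\<lambda>w. Q (bl, w))"
    and w: "w \<in> unit_sphere d"
  shows "run_prob d p Q (Suc T) (b # bl) w =
    (\<integral>\<^sup>+z. (if inband d w b (fst z) then run_prob d p Q T bl (update d p w z) else run_prob d p Q T (b # bl) w) \<partial>draw d)"
proof -
  interpret D: prob_space "draw d" by (rule prob_space_draw)
  let ?X = "{s \<in> space (sample_space d). Q (raw_run d p (Suc T) (b # bl) w s)}"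
  have X: "?X \<in> sets (stream_space (draw d))"
  proof -
    have "Measurable.pred (stream_space (draw d)) (\<lambda>s. Q (raw_run d p (Suc T) (b # bl) w s))"
      using unit_sphere_space[OF w] by (intro pred_raw_run[OF p Q]) auto
    thus ?thesis unfolding sample_space_eq by (simp only: pred_def)
  qed
  have "run_prob d p Q (Suc T) (b # bl) w =
     (\<integral>\<^sup>+z. emeasure (stream_space (draw d)) {s \<in> space (stream_space (draw d)). z ## s \<in> ?X} \<partial>draw d)"
    unfolding run_prob_def using D.emeasure_stream_space[OF X] by (simp add: sample_space_eq)
  also have "\<dots> = (\<integral>\<^sup>+z. (if inband d w b (fst z) then run_prob d p Q T bl (update d p w z) else run_prob d p Q T (b # bl) w) \<partial>draw d)"
  proof (intro nn_integral_cong)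
    fix z assume z: "z \<in> space (draw d)"
    have "{s \<in> space (stream_space (draw d)). z ## s \<in> ?X} =
      {s \<in> space (sample_space d). if inband d w b (fst z) then Q (raw_run d p T bl (update d p w z) s) else Q (raw_run d p T (b # bl) w s)}"
      using z by (auto simp: sample_space_eq space_stream_space)
    thus "emeasure (stream_space (draw d)) {s \<in> space (stream_space (draw d)). z ## s \<in> ?X} =
      (if inband d w b (fst z) then run_prob d p Q T bl (update d p w z) else run_prob d p Q T (b # bl) w)"
      by (simp add: run_prob_def sample_space_eq)
  qed
  finally show ?thesis .
qed

lemma band_prob_nonneg: "0 \<le> band_prob d w b"
  by (simp add: band_prob_def)

lemma band_prob_le_1: "band_prob d w b \<le> 1"
  unfolding band_prob_def by (rule prob_space.prob_le_1[OF prob_space_sphere_measure])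

lemma nn_integral_draw_if_inband:
  assumes A: "0 \<le> A" and B: "0 \<le> B"
  shows "(\<integral>\<^sup>+z. (if inband d w b (fst z) then ennreal A else ennreal B) \<partial>draw d) =
    ennreal (band_prob d w b * A + (1 - band_prob d w b) * B)"
proof -
  interpret S: prob_space "sphere_measure d" by (rule prob_space_sphere_measure)
  interpret U: prob_space unif01 by (rule prob_space_unif01)
  let ?I = "\<lambda>x. indicator {x. inband d w b x} x :: real"
  have ind: "?I x = indicator {b/2..b} (dotp d w x)" for x
    by (simp add: indicator_def inband_def)
  have [measurable]: "?I \<in> borel_measurable (vec_space d)"
    unfolding ind by measurable
  have iI: "integrable (sphere_measure d) ?I"
    by (rule integrable_sphere_bounded[where B=1]) (auto simp: indicator_def)
  have "(\<integral>\<^sup>+z. (if inband d w b (fst z) then ennreal A else ennreal B) \<partial>draw d) =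
    (\<integral>\<^sup>+x. (if inband d w b x then ennreal A else ennreal B) \<partial>sphere_measure d)"
    by (subst nn_integral_draw) (simp_all add: U.emeasure_space_1)
  also have "\<dots> = (\<integral>\<^sup>+x. ennreal ((A - B) * ?I x + B) \<partial>sphere_measure d)"
    by (intro nn_integral_cong) simp
  also have "\<dots> = ennreal (\<integral>x. (A - B) * ?I x + B \<partial>sphere_measure d)"
    using iI A B by (intro nn_integral_eq_integral) (auto simp: indicator_def)
  also have "(\<integral>x. (A - B) * ?I x + B \<partial>sphere_measure d) = (A - B) * band_prob d w b + B"
  proof -
    have "(\<integral>x. (A - B) * ?I x + B \<partial>sphere_measure d) =
       (\<integral>x. (A - B) * ?I x \<partial>sphere_measure d) + (\<integral>x. B \<partial>sphere_measure d)"
      by (rule Bochner_Integration.integral_add) (use iI in auto)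
    thus ?thesis unfolding integral_mult_right_zero integral_inband by (simp add: S.prob_space)
  qed
  finally show ?thesis by (simp add: algebra_simps)
qed

lemma AE_draw_update:
  assumes w: "w \<in> unit_sphere d" and b: "0 < b"
  shows "AE z in draw d. inband d w b (fst z) \<longrightarrow> fst z \<in> unit_sphere d \<and> update d p w z \<in> unit_sphere d"
  using AE_draw[of d]
proof (rule AE_mp, intro AE_I2 impI)
  fix z :: "vec \<times> real" assume z: "fst z \<in> extensional {..<d} \<and> (fst z \<in> unit_sphere d \<or> (\<forall>w. dotp d w (fst z) = 0))"
    and i: "inband d w b (fst z)"
  have "fst z \<in> unit_sphere d" using inband_unit_sphere[OF b i] z by blast
  thus "fst z \<in> unit_sphere d \<and> update d p w z \<in> unit_sphere d"
    using update_unit_sphere[OF w] by simp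
qed

text \<open>Each outstanding query carries a factor e. A draw is accepted with probability q >= 2
  \<sigma> (1/128 is half of the 1/64 in \<open>band_prob_ge\<close>), so one draw multiplies the
  bound by at most q / e + 1 - q <= 1 - q / 2 <= exp (- \<sigma>), whatever the current
  iterate.\<close>

lemma run_unfinished_le:
  assumes d: "3 \<le> d" and p: "p \<in> borel_measurable (vec_space d)"
    and bl: "\<And>b. b \<in> set bl \<Longrightarrow> 0 < b \<and> b\<^sup>2 * real d \<le> 1/4 \<and> \<sigma> \<le> b * sqrt d / 128"
    and s: "0 \<le> \<sigma>" and w: "w \<in> unit_sphere d"
  shows "run_prob d p (\<lambda>r. fst r \<noteq> []) T bl w \<le> ennreal (exp (real (length bl) - \<sigma> * real T))"
  using bl w
proof (induction T arbitrary: bl w)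
  case 0
  show ?case
  proof (cases bl)
    case Nil
    thus ?thesis by (simp add: run_prob_def)
  next
    case (Cons b bl')
    have "run_prob d p (\<lambda>r. fst r \<noteq> []) 0 bl w \<le> ennreal 1" using run_prob_le_1 by simp
    also have "\<dots> \<le> ennreal (exp (real (length bl) - \<sigma> * real 0))"
      using Cons by (intro ennreal_leI) simp
    finally show ?thesis .
  qed
next
  case (Suc T)
  show ?case
  proof (cases bl)
    case Nil
    thus ?thesis by (simp add: run_prob_def)
  next
    case (Cons b bl')
    have b: "0 < b" "b\<^sup>2 * real d \<le> 1/4" "\<sigma> \<le> b * sqrt d / 128"
      using Suc.prems(1)[of b] Cons by auto
    have ww: "dotp d w w = 1" using Suc.prems by (simp add: dotp_unit_sphere)
    define q where "q = band_prob d w b"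
    define n where "n = real (length bl')"
    have q: "2 * \<sigma> \<le> q" "q \<le> 1"
      using band_prob_ge[OF d b(1,2) ww] b(3) band_prob_le_1 by (auto simp: q_def)
    have "run_prob d p (\<lambda>r. fst r \<noteq> []) (Suc T) bl w =
      (\<integral>\<^sup>+z. (if inband d w b (fst z) then run_prob d p (\<lambda>r. fst r \<noteq> []) T bl' (update d p w z)
         else run_prob d p (\<lambda>r. fst r \<noteq> []) T bl w) \<partial>draw d)"
      unfolding Cons using Suc.prems by (intro run_prob_Cons p) auto
    also have "\<dots> \<le> (\<integral>\<^sup>+z. (if inband d w b (fst z) then ennreal (exp (n - \<sigma> * real T))
         else ennreal (exp (n + 1 - \<sigma> * real T))) \<partial>draw d)"
    proof (rule nn_integral_mono_AE, use AE_draw_update[OF Suc.prems(2) b(1)] in \<open>rule AE_mp\<close>, intro AE_I2 impI)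
      fix z :: "vec \<times> real" assume "inband d w b (fst z) \<longrightarrow> fst z \<in> unit_sphere d \<and> update d p w z \<in> unit_sphere d"
      thus "(if inband d w b (fst z) then run_prob d p (\<lambda>r. fst r \<noteq> []) T bl' (update d p w z)
         else run_prob d p (\<lambda>r. fst r \<noteq> []) T bl w) \<le> (if inband d w b (fst z) then ennreal (exp (n - \<sigma> * real T))
         else ennreal (exp (n + 1 - \<sigma> * real T)))"
        using Suc.IH[of bl' "update d p w z"] Suc.IH[of bl w] Suc.prems Cons by (auto simp: n_def add.commute)
    qed
    also have "\<dots> = ennreal (q * exp (n - \<sigma> * real T) + (1 - q) * exp (n + 1 - \<sigma> * real T))"
      unfolding q_def by (rule nn_integral_draw_if_inband) auto
    also have "\<dots> \<le> ennreal (exp (real (length bl) - \<sigma> * real (Suc T)))"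
    proof (rule ennreal_leI)
      let ?E = "exp (n + 1 - \<sigma> * real T)"
      have "2 \<le> exp (1::real)" using exp_ge_add_one_self[of 1] by simp
      hence "exp (n - \<sigma> * real T) * 2 \<le> exp (n - \<sigma> * real T) * exp 1" by (intro mult_left_mono) auto
      also have "\<dots> = ?E" by (simp add: exp_add[symmetric])
      finally have "exp (n - \<sigma> * real T) \<le> ?E / 2" by simp
      hence "q * exp (n - \<sigma> * real T) \<le> q * (?E / 2)"
        by (rule mult_left_mono) (simp add: q_def band_prob_nonneg)
      hence "q * exp (n - \<sigma> * real T) + (1 - q) * ?E \<le> (1 - q / 2) * ?E" by (simp add: algebra_simps)
      also have "\<dots> \<le> exp (- \<sigma>) * ?E"
        using exp_ge_add_one_self[of "- \<sigma>"] q by (intro mult_right_mono) auto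
      also have "\<dots> = exp (real (length bl) - \<sigma> * real (Suc T))"
        by (simp add: exp_add[symmetric] Cons n_def algebra_simps)
      finally show "q * exp (n - \<sigma> * real T) + (1 - q) * ?E \<le> exp (real (length bl) - \<sigma> * real (Suc T))" .
    qed
    finally show ?thesis .
  qed
qed

text \<open>Removes the waiting time. With q the band probability, an accepted draw contributes at
  most q B, and a rejected one returns to the same state, contributing (1 - q) B by induction on T;
  the sum is B. The induction starts at 0 because \<open>nil\<close> makes Q false on an unfinished
  run.\<close>

lemma run_prob_step:
  assumes p: "p \<in> borel_measurable (vec_space d)"
    and Q: "\<And>bl. Measurable.pred (vec_space d) (\<lambda>w. Q (bl, w))"
    and nil: "\<And>bl w. Q (bl, w) \<Longrightarrow> bl = []"
    and w: "w \<in> unit_sphere d" and b: "0 < b" and B: "0 \<le> B"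
    and Fm: "(\<lambda>z. if inband d w b (fst z) then F z else 0) \<in> borel_measurable (draw d)"
    and F: "\<And>T z. inband d w b (fst z) \<Longrightarrow> fst z \<in> unit_sphere d \<Longrightarrow> update d p w z \<in> unit_sphere d \<Longrightarrow>
       run_prob d p Q T bl (update d p w z) \<le> F z"
    and int: "(\<integral>\<^sup>+z. (if inband d w b (fst z) then F z else 0) \<partial>draw d) \<le> ennreal (band_prob d w b * B)"
  shows "run_prob d p Q T (b # bl) w \<le> ennreal B"
proof (induction T)
  case 0
  have "\<not> Q (b # bl, w)" using nil by blast
  thus ?case by (simp add: run_prob_def)
next
  case (Suc T)
  have "run_prob d p Q (Suc T) (b # bl) w =
    (\<integral>\<^sup>+z. (if inband d w b (fst z) then run_prob d p Q T bl (update d p w z) else run_prob d p Q T (b # bl) w) \<partial>draw d)"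
    by (rule run_prob_Cons[OF p Q w])
  also have "\<dots> \<le> (\<integral>\<^sup>+z. (if inband d w b (fst z) then F z else 0) + (if inband d w b (fst z) then ennreal 0 else ennreal B) \<partial>draw d)"
    by (rule nn_integral_mono_AE, use AE_draw_update[OF w b] in \<open>rule AE_mp\<close>, intro AE_I2 impI)
       (use F Suc.IH in auto)
  also have "\<dots> = (\<integral>\<^sup>+z. (if inband d w b (fst z) then F z else 0) \<partial>draw d) + ennreal (band_prob d w b * 0 + (1 - band_prob d w b) * B)"
    using Fm B unfolding nn_integral_draw_if_inband[OF order_refl B, symmetric]
    by (intro nn_integral_add) (simp_all add: draw_def)
  also have "\<dots> \<le> ennreal (band_prob d w b * B) + ennreal ((1 - band_prob d w b) * B)"
    using int by (intro add_mono) auto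
  also have "\<dots> = ennreal (band_prob d w b * B + (1 - band_prob d w b) * B)"
    using B band_prob_nonneg band_prob_le_1 by (subst ennreal_plus[symmetric]) auto
  also have "\<dots> = ennreal B" by (simp add: algebra_simps)
  finally show ?case .
qed

text \<open>The three terms are the exponential potential still to be contracted, a price exp (- l
  \<tau> / 4) for each remaining query that may start close to the target, and the failure
  \<open>D\<close> of \<open>rest\<close>. At n = 0 a potential above \<tau> makes the first term at
  least 1, so \<open>rest\<close> is entered only with its hypothesis satisfied. The condition on
  \<open>cap\<close> is calibrated for n = m and so holds for smaller n.\<close>

lemma epoch_bound:
  fixes l \<rho> \<tau> cap D :: real
  assumes p: "p \<in> borel_measurable (vec_space d)"
    and Q: "\<And>bl. Measurable.pred (vec_space d) (\<lambda>w. Q (bl, w))"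
    and nil: "\<And>bl w. Q (bl, w) \<Longrightarrow> bl = []"
    and b: "0 < b" and l: "0 \<le> l" and \<rho>: "0 \<le> \<rho>" and D: "0 \<le> D"
    and rest: "\<And>w T. w \<in> unit_sphere d \<Longrightarrow> 1 - dotp d w u \<le> \<tau> \<Longrightarrow> run_prob d p Q T rest w \<le> ennreal D"
    and mid: "\<And>w. w \<in> unit_sphere d \<Longrightarrow> \<tau> / 2 < 1 - dotp d w u \<Longrightarrow> 1 - dotp d w u \<le> cap \<Longrightarrow>
       (\<integral>\<^sup>+z. (if inband d w b (fst z) then ennreal (exp (l * (1 - dotp d (update d p w z) u))) else 0) \<partial>draw d)
       \<le> ennreal (band_prob d w b * (exp (l * (1 - dotp d w u)) * exp (- \<rho>)))"
    and low: "\<And>w z. w \<in> unit_sphere d \<Longrightarrow> 1 - dotp d w u \<le> \<tau> / 2 \<Longrightarrow> fst z \<in> unit_sphere d \<Longrightarrow>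
       inband d w b (fst z) \<Longrightarrow> 1 - dotp d (update d p w z) u \<le> 3 / 4 * \<tau>"
    and cap: "\<rho> * real m \<le> l * (cap - \<tau>)"
    and n: "n \<le> m" and w: "w \<in> unit_sphere d"
  shows "run_prob d p Q T (replicate n b @ rest) w \<le>
    ennreal (exp (l * (1 - dotp d w u - \<tau>) - \<rho> * real n) + real n * exp (- (l * \<tau> / 4)) + D)"
  using n w
proof (induction n arbitrary: w T)
  case 0
  show ?case
  proof (cases "1 - dotp d w u \<le> \<tau>")
    case True
    have "run_prob d p Q T rest w \<le> ennreal D" by (rule rest[OF 0(2) True])
    also have "\<dots> \<le> ennreal (exp (l * (1 - dotp d w u - \<tau>)) + D)" by (intro ennreal_leI) simp
    finally show ?thesis by simp
  next
    case False
    have "run_prob d p Q T rest w \<le> ennreal 1" using run_prob_le_1 by simp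
    also have "\<dots> \<le> ennreal (exp (l * (1 - dotp d w u - \<tau>)) + D)"
      using False l D by (intro ennreal_leI) (simp add: add_increasing2)
    finally show ?thesis by simp
  qed
next
  case (Suc n)
  define \<phi> where "\<phi> w = 1 - dotp d w u" for w
  define e0 where "e0 = exp (- (l * \<tau> / 4))"
  define B where "B = exp (l * (\<phi> w - \<tau>) - \<rho> * real (Suc n)) + real (Suc n) * e0 + D"
  have e0: "0 \<le> e0" by (simp add: e0_def)
  have B0: "0 \<le> B" using e0 D by (simp add: B_def add_nonneg_nonneg)
  have IH: "run_prob d p Q T (replicate n b @ rest) w' \<le> ennreal (exp (l * (\<phi> w' - \<tau>) - \<rho> * real n) + real n * e0 + D)"
    if "w' \<in> unit_sphere d" for w' T
    using Suc.IH[OF _ that, of T] Suc.prems by (simp add: \<phi>_def e0_def)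
  have [measurable]: "w \<in> space (vec_space d)" by (rule unit_sphere_space[OF Suc.prems(2)])
  have "run_prob d p Q T (b # (replicate n b @ rest)) w \<le> ennreal B"
  proof -
    consider "cap < \<phi> w" | "\<tau> / 2 < \<phi> w" "\<phi> w \<le> cap" | "\<phi> w \<le> \<tau> / 2" by linarith
    then show ?thesis
    proof cases
      case 1
      have "\<rho> * real (Suc n) \<le> \<rho> * real m" using Suc.prems \<rho> by (intro mult_left_mono) auto
      also have "\<dots> \<le> l * (cap - \<tau>)" by (rule cap)
      also have "\<dots> \<le> l * (\<phi> w - \<tau>)" using 1 l by (intro mult_left_mono) auto
      finally have "1 \<le> exp (l * (\<phi> w - \<tau>) - \<rho> * real (Suc n))" by simp
      moreover have "0 \<le> real (Suc n) * e0" using e0 by simp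
      ultimately have "1 \<le> B" using D unfolding B_def by linarith
      hence "ennreal 1 \<le> ennreal B" by (rule ennreal_leI)
      thus ?thesis using run_prob_le_1[of d p Q T] by (metis ennreal_1 order_trans)
    next
      case 2
      \<comment> \<open>The induction hypothesis is affine in exp (l * \<phi>), with slope c and
        constant g; this lets \<open>mid\<close> be applied under the integral.\<close>
      define c where "c = exp (- (l * \<tau>) - \<rho> * real n)"
      define g where "g = real n * e0 + D"
      have g0: "0 \<le> g" using e0 D by (simp add: g_def)
      define E where "E = (\<lambda>z. (if inband d w b (fst z) then ennreal (exp (l * \<phi> (update d p w z))) else 0))"
      define h where "h z = dotp d (update d p w z) u" for z
      have hm[measurable]: "h \<in> borel_measurable (vec_space d \<Otimes>\<^sub>M borel)"
        using p unfolding h_def dotp_update label_def by measurable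
      have "E \<in> borel_measurable (vec_space d \<Otimes>\<^sub>M borel)"
        unfolding E_def \<phi>_def h_def[symmetric] by measurable
      hence Em[measurable]: "E \<in> borel_measurable (draw d)" by (simp cong: measurable_cong_sets add: sets_draw)
      define F where "F z = ennreal c * E z + ennreal g" for z
      have eqF: "(if inband d w b (fst z) then F z else 0) =
         ennreal c * E z + (if inband d w b (fst z) then ennreal g else ennreal 0)" for z
        by (simp add: F_def E_def)
      have im[measurable]: "(\<lambda>z. if inband d w b (fst z) then ennreal g else ennreal 0) \<in> borel_measurable (draw d)"
        unfolding draw_def by measurable
      have ef: "exp (l * (\<phi> w' - \<tau>) - \<rho> * real n) = c * exp (l * \<phi> w')" for w'
        by (simp add: c_def exp_add[symmetric] algebra_simps)
      show ?thesis
      proof (rule run_prob_step[OF p Q nil Suc.prems(2) b B0, where F=F])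
        show "(\<lambda>z. if inband d w b (fst z) then F z else 0) \<in> borel_measurable (draw d)"
          unfolding eqF by measurable
        show "run_prob d p Q T (replicate n b @ rest) (update d p w z) \<le> F z"
          if "inband d w b (fst z)" "update d p w z \<in> unit_sphere d" for T z
        proof -
          have "ennreal (exp (l * (\<phi> (update d p w z) - \<tau>) - \<rho> * real n) + real n * e0 + D) = F z"
            using that g0 unfolding F_def E_def ef g_def
            by (simp add: ennreal_mult[symmetric] ennreal_plus[symmetric] c_def add.assoc del: ennreal_plus)
          thus ?thesis using IH[OF that(2)] by simp
        qed
        have "(\<integral>\<^sup>+z. (if inband d w b (fst z) then F z else 0) \<partial>draw d) =
           ennreal c * (\<integral>\<^sup>+z. E z \<partial>draw d) + (\<integral>\<^sup>+z. (if inband d w b (fst z) then ennreal g else ennreal 0) \<partial>draw d)"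
          unfolding eqF by (simp add: nn_integral_add nn_integral_cmult)
        also have "\<dots> = ennreal c * (\<integral>\<^sup>+z. E z \<partial>draw d) + ennreal (band_prob d w b * g)"
          by (subst nn_integral_draw_if_inband) (use g0 in auto)
        also have "\<dots> \<le> ennreal c * ennreal (band_prob d w b * (exp (l * \<phi> w) * exp (- \<rho>))) + ennreal (band_prob d w b * g)"
          using mid[OF Suc.prems(2)] 2 unfolding E_def \<phi>_def by (intro add_right_mono mult_left_mono) auto
        also have "\<dots> = ennreal (c * (band_prob d w b * (exp (l * \<phi> w) * exp (- \<rho>))) + band_prob d w b * g)"
          using g0 band_prob_nonneg[of d w b]
          by (simp add: ennreal_mult[symmetric] ennreal_plus[symmetric] c_def del: ennreal_plus)
        also have "\<dots> \<le> ennreal (band_prob d w b * B)"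
        proof (rule ennreal_leI)
          have "c * (exp (l * \<phi> w) * exp (- \<rho>)) = exp (l * (\<phi> w - \<tau>) - \<rho> * real (Suc n))"
            by (simp add: c_def exp_add[symmetric] algebra_simps)
          hence "c * (exp (l * \<phi> w) * exp (- \<rho>)) + g \<le> B"
            using e0 by (simp add: B_def g_def algebra_simps)
          from mult_left_mono[OF this band_prob_nonneg[of d w b]]
          show "c * (band_prob d w b * (exp (l * \<phi> w) * exp (- \<rho>))) + band_prob d w b * g \<le> band_prob d w b * B"
            by (simp add: algebra_simps)
        qed
        finally show "(\<integral>\<^sup>+z. (if inband d w b (fst z) then F z else 0) \<partial>draw d) \<le> ennreal (band_prob d w b * B)" .
      qed
    next
      case 3
      define g where "g = real (Suc n) * e0 + D"
      have g0: "0 \<le> g" using e0 D by (simp add: g_def)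
      show ?thesis
      proof (rule run_prob_step[OF p Q nil Suc.prems(2) b B0, where F="\<lambda>_. ennreal g"])
        show "(\<lambda>z. if inband d w b (fst z) then ennreal g else 0) \<in> borel_measurable (draw d)"
          unfolding draw_def by measurable
        show "run_prob d p Q T (replicate n b @ rest) (update d p w z) \<le> ennreal g"
          if "inband d w b (fst z)" "fst z \<in> unit_sphere d" "update d p w z \<in> unit_sphere d" for T z
        proof -
          have "\<phi> (update d p w z) - \<tau> \<le> - \<tau> / 4"
            using low[OF Suc.prems(2) _ that(2,1)] 3 by (simp add: \<phi>_def)
          hence "l * (\<phi> (update d p w z) - \<tau>) \<le> l * (- \<tau> / 4)" using l by (rule mult_left_mono)
          moreover have "0 \<le> \<rho> * real n" using \<rho> by simp
          ultimately have "exp (l * (\<phi> (update d p w z) - \<tau>) - \<rho> * real n) \<le> e0"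
            unfolding e0_def by simp
          hence "ennreal (exp (l * (\<phi> (update d p w z) - \<tau>) - \<rho> * real n) + real n * e0 + D) \<le> ennreal g"
            by (intro ennreal_leI) (simp add: g_def algebra_simps)
          thus ?thesis using IH[OF that(3), of T] by simp
        qed
        have "(\<integral>\<^sup>+z. (if inband d w b (fst z) then ennreal g else 0) \<partial>draw d) = ennreal (band_prob d w b * g)"
          using nn_integral_draw_if_inband[OF g0 order_refl, of d w b] unfolding ennreal_0 by simp
        also have "\<dots> \<le> ennreal (band_prob d w b * B)"
          by (intro ennreal_leI mult_left_mono band_prob_nonneg) (simp add: B_def g_def)
        finally show "(\<integral>\<^sup>+z. (if inband d w b (fst z) then ennreal g else 0) \<partial>draw d) \<le> ennreal (band_prob d w b * B)" .
      qed
    qed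
  qed
  thus ?case by (simp add: B_def \<phi>_def e0_def)
qed

section \<open>One epoch\<close>

text \<open>In epoch k, h is 2^-k. The entry level 4 h^2 equals 1 for k = 1 and so covers the whole
  hemisphere around u; the exit level h^2 / 16 is (h/2)^2 / 4, well inside the entry level of the
  next epoch.\<close>

lemma epoch_step:
  fixes h L \<eta> D :: real
  assumes d: "3 \<le> d" and e: "0 \<le> \<eta>" "\<eta> < 1/2"
    and p: "p \<in> borel_measurable (vec_space d)" "\<And>x. 0 \<le> p x \<and> p x \<le> 1"
    and noise: "bounded_noise d u \<eta> p" and u: "dotp d u u = 1"
    and Q: "\<And>bl. Measurable.pred (vec_space d) (\<lambda>w. Q (bl, w))"
    and nil: "\<And>bl w. Q (bl, w) \<Longrightarrow> bl = []"
    and h: "0 < h" "h \<le> 1/2" and L: "1 \<le> L" and D: "0 \<le> D"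
    and b: "b = 1 / 2^20 * (h * (1 - 2 * \<eta>)) / (sqrt d * L)"
    and m: "2560 * 2^20 * (d / (1 - 2 * \<eta>)\<^sup>2) * L \<le> real m"
    and rest: "\<And>w T. w \<in> unit_sphere d \<Longrightarrow> 1 - dotp d w u \<le> h\<^sup>2 / 16 \<Longrightarrow> run_prob d p Q T rest w \<le> ennreal D"
    and w: "w \<in> unit_sphere d" "1 - dotp d w u \<le> 4 * h\<^sup>2"
  shows "run_prob d p Q T (replicate m b @ rest) w \<le> ennreal (exp (- (128 * L)) + real m * exp (- (2 * L)) + D)"
proof -
  define N where "N = 1 - 2 * \<eta>"
  have N: "0 < N" "N \<le> 1" using e by (auto simp: N_def)
  define r where "r = sqrt (real d)"
  have "sqrt 1 \<le> sqrt (real d)" using d by (subst real_sqrt_le_iff) simp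
  hence r: "1 \<le> r" "r\<^sup>2 = real d" by (auto simp: r_def)
  \<comment> \<open>With target h^2/16, the rate l makes the loss exp (- l h^2 / 64) per query near the target
    equal to exp (- 2 L). The contraction rho, with rho m = 640 L, beats the initial exponent
    l * 4 h^2 = 512 L but stays below the exponent l (6 h^2 - h^2/16) = 760 L at the cap.\<close>
  define l where "l = 128 * L / h\<^sup>2"
  have l0: "0 < l" using L h by (simp add: l_def)
  define B where "B = 1 / 2^20 * (N / (r * L))"
  have rL: "1 \<le> r * L" using r L by (simp add: mult_ge1_I)
  have bB: "b = B * h" by (simp add: b B_def N_def r_def)
  have "N / (r * L) \<le> 1" using N rL by simp
  hence B: "0 < B" "B \<le> 1 / 2^20" using N rL by (auto simp: B_def zero_less_divide_iff)
  have b0: "0 < b" using B h by (simp add: bB)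
  have bh: "b \<le> h / 2^20" using mult_right_mono[OF B(2), of h] h by (simp add: bB)
  have BrL: "B * r * L = N / 2^20" using r L by (simp add: B_def)
  have lb: "l * b * h = 128 * L * B" using h by (simp add: l_def bB power2_eq_square)
  have m0: "0 < real m"
  proof -
    have "0 < 2560 * 2^20 * (d / (1 - 2 * \<eta>)\<^sup>2) * L" using d L N by (simp add: N_def)
    thus ?thesis using m by linarith
  qed
  define \<rho> where "\<rho> = 640 * L / real m"
  have \<rho>0: "0 \<le> \<rho>" using L m0 by (simp add: \<rho>_def)
  have b2d: "b\<^sup>2 * real d \<le> 1/4"
  proof -
    have "b * r = (N / 2^20) * (h / L)"
      using BrL L by (simp add: bB field_simps)
    also have "\<dots> \<le> 1 / 2^20 * 1" using N h L by (intro mult_mono) auto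
    finally have "b * r \<le> 1/2" by simp
    hence "(b * r)\<^sup>2 \<le> (1/2)\<^sup>2" using b0 r by (intro power_mono) auto
    moreover have "(b * r)\<^sup>2 = b\<^sup>2 * real d" by (simp only: power_mult_distrib r(2))
    moreover have "(1/2)\<^sup>2 = (1/4::real)" by (simp add: power2_eq_square)
    ultimately show ?thesis by linarith
  qed
  have "run_prob d p Q T (replicate m b @ rest) w \<le>
    ennreal (exp (l * (1 - dotp d w u - h\<^sup>2 / 16) - \<rho> * real m) + real m * exp (- (l * (h\<^sup>2 / 16) / 4)) + D)"
  proof (rule epoch_bound[OF p(1) Q nil b0 less_imp_le[OF l0] \<rho>0 D, where \<tau>="h\<^sup>2 / 16" and cap="6 * h\<^sup>2" and m=m and u=u])
    show "\<rho> * real m \<le> l * (6 * h\<^sup>2 - h\<^sup>2 / 16)"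
    proof -
      have "\<rho> * real m = 640 * L" using m0 by (simp add: \<rho>_def)
      moreover have "l * (6 * h\<^sup>2 - h\<^sup>2 / 16) = l * h\<^sup>2 * (95 / 16)" by (simp add: algebra_simps)
      moreover have "l * h\<^sup>2 = 128 * L" using h by (simp add: l_def)
      ultimately show ?thesis using L by simp
    qed
    show "run_prob d p Q T rest w \<le> ennreal D" if "w \<in> unit_sphere d" "1 - dotp d w u \<le> h\<^sup>2 / 16" for w T
      using rest that by blast
    have ssq: "1 - (dotp d w u)\<^sup>2 = (1 - dotp d w u) * (1 + dotp d w u)" for w
      by (simp add: power2_eq_square algebra_simps)
    show "1 - dotp d (update d p w z) u \<le> 3 / 4 * (h\<^sup>2 / 16)"
      if w: "w \<in> unit_sphere d" and f: "1 - dotp d w u \<le> h\<^sup>2 / 16 / 2" and x: "fst z \<in> unit_sphere d"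
        and i: "inband d w b (fst z)" for w z
    proof -
      define s where "s = sqrt (1 - (dotp d w u)\<^sup>2)"
      have ww: "dotp d w w = 1" using w by (rule dotp_unit_sphere)
      have c1: "\<bar>dotp d w u\<bar> \<le> 1" by (rule dotp_abs_le_1[OF ww u])
      have "(1 - dotp d w u) * (1 + dotp d w u) \<le> (h\<^sup>2 / 32) * 2"
        using f c1 by (intro mult_mono) auto
      hence "1 - (dotp d w u)\<^sup>2 \<le> (h / 4)\<^sup>2" unfolding ssq by (simp add: power_divide)
      hence s: "s \<le> h / 4" using h unfolding s_def by (intro real_le_lsqrt) auto
      have ux: "\<bar>dotp d u (fst z)\<bar> \<le> b + s"
        unfolding s_def by (rule abs_dotp_le_band[OF ww u x b0 i])
      have "\<bar>dotp d w (fst z)\<bar> * \<bar>dotp d u (fst z)\<bar> \<le> (h / 2^20) * (h / 2)"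
        using ux s bh i b0 h by (intro mult_mono) (auto simp: inband_def)
      hence "2 * (dotp d w (fst z) * dotp d u (fst z)) \<le> h\<^sup>2 / 2^20"
        unfolding abs_mult[symmetric] by (simp add: power2_eq_square)
      hence "1 - dotp d (update d p w z) u \<le> 1 - dotp d w u + h\<^sup>2 / 2^20"
        by (auto simp: dotp_update)
      also have "h\<^sup>2 / 2^20 \<le> h\<^sup>2 / 64" by simp
      hence "1 - dotp d w u + h\<^sup>2 / 2^20 \<le> 3 / 4 * (h\<^sup>2 / 16)"
        using f by linarith
      finally show ?thesis .
    qed
    show "(\<integral>\<^sup>+z. (if inband d w b (fst z) then ennreal (exp (l * (1 - dotp d (update d p w z) u))) else 0) \<partial>draw d)
       \<le> ennreal (band_prob d w b * (exp (l * (1 - dotp d w u)) * exp (- \<rho>)))"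
      if w: "w \<in> unit_sphere d" and f: "h\<^sup>2 / 16 / 2 < 1 - dotp d w u" "1 - dotp d w u \<le> 6 * h\<^sup>2" for w
    proof -
      define s where "s = sqrt (1 - (dotp d w u)\<^sup>2)"
      have ww: "dotp d w w = 1" using w by (rule dotp_unit_sphere)
      have "h\<^sup>2 \<le> (1/2)\<^sup>2" using h by (intro power_mono) auto
      \<comment> \<open>Below the cap, w.u is at least -1/2, so the iterate stays away from -u,
        where the sine, and with it the drift, would degenerate although the potential is large.
        Hence the sine is comparable to h in the whole middle region.\<close>
      hence h2: "6 * h\<^sup>2 \<le> 3/2" by (simp add: power2_eq_square)
      have "0 < h\<^sup>2" using h by simp
      hence c: "\<bar>dotp d w u\<bar> < 1" using f h2 by linarith
      have "(h\<^sup>2 / 32) * (1/2) \<le> (1 - dotp d w u) * (1 + dotp d w u)"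
        using f h2 by (intro mult_mono) auto
      hence "(h / 8)\<^sup>2 \<le> 1 - (dotp d w u)\<^sup>2" unfolding ssq by (simp add: power_divide)
      hence s1: "h / 8 \<le> s" unfolding s_def by (rule real_le_rsqrt)
      have "(1 - dotp d w u) * (1 + dotp d w u) \<le> (6 * h\<^sup>2) * 2"
        using f c by (intro mult_mono) auto
      moreover have "12 * h\<^sup>2 \<le> 16 * h\<^sup>2" by (rule mult_right_mono) simp_all
      moreover have "(4 * h)\<^sup>2 = 16 * h\<^sup>2" by (simp add: power_mult_distrib)
      ultimately have "1 - (dotp d w u)\<^sup>2 \<le> (4 * h)\<^sup>2" unfolding ssq by linarith
      hence s2: "s \<le> 4 * h" using h unfolding s_def by (intro real_le_lsqrt) auto
      have s0: "0 < s" using s1 h by linarith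
      have hs: "h \<le> 8 * s" using s1 by simp
      have bs: "b \<le> N * s / (32 * r)"
      proof -
        have "b \<le> B * (8 * s)" unfolding bB using B hs by (intro mult_left_mono) auto
        also have "B \<le> N / (r * 2^20)"
        proof -
          have "N / (r * L) \<le> N / (r * 1)" using N r L by (intro divide_left_mono mult_left_mono) auto
          from mult_left_mono[OF this, of "1 / 2^20"]
          show ?thesis unfolding B_def by (simp add: mult.commute)
        qed
        hence "B * (8 * s) \<le> N / (r * 2^20) * (8 * s)" using s0 by (intro mult_right_mono) auto
        also have "\<dots> = N * s / r * (8 / 2^20)" by simp
        also have "\<dots> \<le> N * s / r * (1 / 32)" using N s0 r by (intro mult_left_mono) auto
        finally show ?thesis by simp
      qed
      define K where "K = 2 * l * (b * (b + s))"
      define E where "E = b * N * s / (64 * r)"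
      have bs2: "b \<le> s" using bh hs h by simp
      have lbs: "l * b * s \<le> 512 * L * B"
      proof -
        have "l * b * s \<le> l * b * (4 * h)" using s2 l0 b0 by (intro mult_left_mono) auto
        thus ?thesis using lb by simp
      qed
      have LB: "L * B \<le> N / (2^20 * r)"
        using BrL r L by (simp add: field_simps)
      have LB1: "L * B \<le> 1 / 2^20"
      proof -
        have "N / (2^20 * r) \<le> 1 / 2^20" using N r by (simp add: field_simps)
        thus ?thesis using LB by linarith
      qed
      have K0: "0 \<le> K" using l0 b0 s0 by (simp add: K_def)
      have K4: "K \<le> 4 * (l * b * s)"
      proof -
        have "l * b * (b + s) \<le> l * b * (2 * s)" using bs2 l0 b0 by (intro mult_left_mono) auto
        moreover have "K = 2 * (l * b * (b + s))" "l * b * (2 * s) = 2 * (l * b * s)"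
          by (simp_all add: K_def mult.assoc)
        ultimately show ?thesis by linarith
      qed
      hence K1: "K \<le> 1" using lbs LB1 by simp
      \<comment> \<open>Here the factor 1 / L in the width is spent: l grows with L, but l b s stays
        of order L B, that is N / sqrt d, so the second-order term consumes at most half of the
        drift 2 l E.\<close>
      have Kl: "K\<^sup>2 \<le> l * E"
      proof -
        have "K * K \<le> (4 * (l * b * s)) * (2048 * (L * B))"
          using K4 K0 lbs l0 b0 s0 by (intro mult_mono) auto
        also have "\<dots> \<le> (4 * (l * b * s)) * (2048 * (N / (2^20 * r)))"
          using LB l0 b0 s0 by (intro mult_left_mono) auto
        also have "\<dots> = l * (b * N * s / (128 * r))" by simp
        also have "\<dots> \<le> l * E" unfolding E_def using l0 b0 N s0 r
          by (intro mult_left_mono divide_left_mono) auto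
        finally show ?thesis by (simp add: power2_eq_square)
      qed
      \<comment> \<open>The surviving half l E is at least N^2 / (2^22 d), which does not depend on
        h or L; the lower bound on m is exactly what brings 640 L / m below it.\<close>
      have lE: "\<rho> \<le> l * E"
      proof -
        have X0: "0 \<le> N / (64 * r)" using N r by simp
        have "l * b * (h / 8) = 16 * (L * B)" using lb by simp
        also have "L * B = N / (2^20 * r)" using BrL r L by (simp add: field_simps)
        finally have "16 * (N / (2^20 * r)) * (N / (64 * r)) = l * b * (h / 8) * (N / (64 * r))" by simp
        also have "\<dots> \<le> l * b * s * (N / (64 * r))"
          using s1 l0 b0 by (intro mult_right_mono[OF _ X0] mult_left_mono) auto
        also have "\<dots> = l * E" by (simp add: E_def)
        finally have "16 * (N / (2^20 * r)) * (N / (64 * r)) \<le> l * E" .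
        moreover have "16 * (N / (2^20 * r)) * (N / (64 * r)) = N\<^sup>2 / (2^22 * r\<^sup>2)"
          by (simp add: power2_eq_square)
        ultimately have low: "N\<^sup>2 / (2^22 * real d) \<le> l * E" by (simp only: r(2))
        have "2560 * 2^20 * (d / N\<^sup>2) * L \<le> real m" using m by (simp only: N_def)
        hence "2560 * 2^20 * (d / N\<^sup>2) * L * N\<^sup>2 \<le> real m * N\<^sup>2"
          by (rule mult_right_mono) simp
        hence "640 * L * (2^22 * real d) \<le> N\<^sup>2 * real m" using N by (simp add: mult_ac)
        hence "\<rho> \<le> N\<^sup>2 / (2^22 * real d)"
          unfolding \<rho>_def using m0 d
          by (simp only: pos_divide_le_eq times_divide_eq_left pos_le_divide_eq of_nat_0_less_iff zero_less_mult_iff zero_less_power zero_less_numeral)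
            (simp add: pos_le_divide_eq)
        thus ?thesis using low by linarith
      qed
      have "1 - 2 * l * E + K\<^sup>2 \<le> exp (- \<rho>)"
        using Kl lE exp_ge_add_one_self[of "- \<rho>"] by linarith
      hence "band_prob d w b * (exp (l * (1 - dotp d w u)) * (1 - 2 * l * E + K\<^sup>2)) \<le>
         band_prob d w b * (exp (l * (1 - dotp d w u)) * exp (- \<rho>))"
        by (intro mult_left_mono band_prob_nonneg) auto
      moreover have "(\<integral>\<^sup>+z. (if inband d w b (fst z) then ennreal (exp (l * (1 - dotp d (update d p w z) u))) else 0) \<partial>draw d)
        \<le> ennreal (band_prob d w b * (exp (l * (1 - dotp d w u)) * (1 - 2 * l * E + K\<^sup>2)))"
        unfolding E_def K_def N_def s_def r_def
        by (rule band_exp_drift[OF d b0 b2d ww u e noise p c])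
          (use bs K1 l0 in \<open>simp_all add: N_def s_def r_def K_def\<close>)
      ultimately show ?thesis by (meson ennreal_leI order_trans)
    qed
  qed (use w in auto)
  also have "\<dots> \<le> ennreal (exp (- (128 * L)) + real m * exp (- (2 * L)) + D)"
  proof (rule ennreal_leI)
    have "l * (1 - dotp d w u - h\<^sup>2 / 16) \<le> l * (4 * h\<^sup>2)"
      using w(2) l0 by (intro mult_left_mono) (auto intro: order_trans[OF _ w(2)])
    also have "\<dots> = 512 * L" using h by (simp add: l_def)
    finally have "l * (1 - dotp d w u - h\<^sup>2 / 16) - \<rho> * real m \<le> - (128 * L)"
      using m0 by (simp add: \<rho>_def)
    moreover have "l * (h\<^sup>2 / 16) / 4 = 2 * L" using h by (simp add: l_def)
    ultimately show "exp (l * (1 - dotp d w u - h\<^sup>2 / 16) - \<rho> * real m) + real m * exp (- (l * (h\<^sup>2 / 16) / 4)) + D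
       \<le> exp (- (128 * L)) + real m * exp (- (2 * L)) + D" by simp
  qed
  finally show ?thesis .
qed

section \<open>The schedule as one list of bands, and measurability of the actual run\<close>

definition band_list :: "(nat \<Rightarrow> nat) \<Rightarrow> (nat \<Rightarrow> real) \<Rightarrow> nat \<Rightarrow> nat \<Rightarrow> real list" where
  "band_list ms bs i k = concat (map (\<lambda>k. replicate (ms k) (bs k)) [i..<Suc k])"

lemma ap_state_eq_fold:
  "ap_state d p ms bs s v0 k = fold (\<lambda>b. mp_step d p b s) (band_list ms bs 1 k) (v0, 0)"
  by (induction k) (simp_all add: band_list_def modified_perceptron_def fold_replicate)

lemma measurable_next_acc:
  assumes [measurable]: "g \<in> sample_space d \<rightarrow>\<^sub>M vec_space d" "i \<in> sample_space d \<rightarrow>\<^sub>M count_space UNIV"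
  shows "(\<lambda>s. next_acc d (g s) b s (i s)) \<in> sample_space d \<rightarrow>\<^sub>M count_space UNIV"
  unfolding next_acc_def
proof (rule measurable_Least)
  fix j
  have "(\<lambda>s. s !! j) \<in> sample_space d \<rightarrow>\<^sub>M draw d" unfolding sample_space_eq by measurable
  hence [measurable]: "(\<lambda>s. s !! j) \<in> sample_space d \<rightarrow>\<^sub>M vec_space d \<Otimes>\<^sub>M borel"
    by (simp only: measurable_draw_iff)
  have "(\<lambda>s. fst (s !! j)) \<in> sample_space d \<rightarrow>\<^sub>M vec_space d" by measurable
  from pred_inband[OF assms(1) this]
  have [measurable]: "Measurable.pred (sample_space d) (\<lambda>s. inband d (g s) b (fst (s !! j)))" .
  show "Measurable.pred (sample_space d) (\<lambda>s. i s \<le> j \<and> inband d (g s) b (fst (s !! j)))"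
    by measurable
qed

text \<open>The accepted index is random but takes countably many values, so measurability for each
  fixed index is enough.\<close>

lemma measurable_mp_step:
  assumes p[measurable]: "p \<in> borel_measurable (vec_space d)"
    and g[measurable]: "(\<lambda>s. fst (st s)) \<in> sample_space d \<rightarrow>\<^sub>M vec_space d"
    and i[measurable]: "(\<lambda>s. snd (st s)) \<in> sample_space d \<rightarrow>\<^sub>M count_space UNIV"
  shows "(\<lambda>s. fst (mp_step d p b s (st s))) \<in> sample_space d \<rightarrow>\<^sub>M vec_space d"
    and "(\<lambda>s. snd (mp_step d p b s (st s))) \<in> sample_space d \<rightarrow>\<^sub>M count_space UNIV"
proof -
  let ?j = "\<lambda>s. next_acc d (fst (st s)) b s (snd (st s))"
  have j[measurable]: "?j \<in> sample_space d \<rightarrow>\<^sub>M count_space UNIV"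
    by (rule measurable_next_acc[OF g i])
  have "(\<lambda>s. s !! j) \<in> sample_space d \<rightarrow>\<^sub>M draw d" for j unfolding sample_space_eq by measurable
  hence sj: "(\<lambda>s. s !! j) \<in> sample_space d \<rightarrow>\<^sub>M vec_space d \<Otimes>\<^sub>M borel" for j
    by (simp only: measurable_draw_iff)
  have "(\<lambda>s. update d p (fst (st s)) (s !! ?j s)) \<in> sample_space d \<rightarrow>\<^sub>M vec_space d"
    by (rule measurable_update[OF p g measurable_compose_countable[OF sj j]])
  thus "(\<lambda>s. fst (mp_step d p b s (st s))) \<in> sample_space d \<rightarrow>\<^sub>M vec_space d"
    by (simp add: mp_step_def update_def Let_def)
  show "(\<lambda>s. snd (mp_step d p b s (st s))) \<in> sample_space d \<rightarrow>\<^sub>M count_space UNIV"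
    by (simp add: mp_step_def Let_def)
qed

lemma measurable_fold_mp_step:
  assumes p: "p \<in> borel_measurable (vec_space d)"
    and "(\<lambda>s. fst (st s)) \<in> sample_space d \<rightarrow>\<^sub>M vec_space d"
    and "(\<lambda>s. snd (st s)) \<in> sample_space d \<rightarrow>\<^sub>M count_space UNIV"
  shows "(\<lambda>s. fst (fold (\<lambda>b. mp_step d p b s) bl (st s))) \<in> sample_space d \<rightarrow>\<^sub>M vec_space d \<and>
    (\<lambda>s. snd (fold (\<lambda>b. mp_step d p b s) bl (st s))) \<in> sample_space d \<rightarrow>\<^sub>M count_space UNIV"
  using assms(2,3)
proof (induction bl arbitrary: st)
  case (Cons b bl)
  show ?case
    using Cons.IH[OF measurable_mp_step[OF p Cons.prems], of b] by simp
qed simp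

lemma measurable_disagreement:
  "(\<lambda>w. measure (sphere_measure d) {x \<in> space (sphere_measure d). sgn1 (dotp d w x) \<noteq> sgn1 (dotp d u x)})
     \<in> borel_measurable (vec_space d)"
proof -
  interpret S: prob_space "sphere_measure d" by (rule prob_space_sphere_measure)
  define X where "X = {z \<in> space (vec_space d \<Otimes>\<^sub>M sphere_measure d). sgn1 (dotp d (fst z) (snd z)) \<noteq> sgn1 (dotp d u (snd z))}"
  have X: "X \<in> sets (vec_space d \<Otimes>\<^sub>M sphere_measure d)"
    unfolding X_def sgn1_def by measurable
  have "(\<lambda>w. enn2real (emeasure (sphere_measure d) (Pair w -` X))) \<in> borel_measurable (vec_space d)"
    by (intro measurable_compose[OF S.measurable_emeasure_Pair[OF X]]) simp
  moreover have "enn2real (emeasure (sphere_measure d) (Pair w -` X)) =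
     measure (sphere_measure d) {x \<in> space (sphere_measure d). sgn1 (dotp d w x) \<noteq> sgn1 (dotp d u x)}"
    if "w \<in> space (vec_space d)" for w
  proof -
    have "Pair w -` X = {x \<in> space (sphere_measure d). sgn1 (dotp d w x) \<noteq> sgn1 (dotp d u x)}"
      using that by (auto simp: X_def space_pair_measure)
    thus ?thesis by (simp add: measure_def)
  qed
  ultimately show ?thesis by (simp cong: measurable_cong)
qed

text \<open>A union bound over two events: the run is incomplete after T draws, or it is complete
  with a bad final iterate. Outside both, completeness also bounds the number of unlabeled draws by
  T. The passage to complements requires the success set itself to be measurable, which is why the
  actual run, and not only \<open>raw_run\<close>, had to be shown measurable.\<close>

lemma ap_success_prob:
  fixes \<epsilon> \<delta> \<tau> :: real and P :: "vec \<Rightarrow> nat \<Rightarrow> bool"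
  assumes p: "p \<in> borel_measurable (vec_space d)" and v0: "v0 \<in> unit_sphere d"
    and \<delta>: "0 \<le> \<delta>"
    and fin: "run_prob d p (\<lambda>r. fst r \<noteq> []) T (band_list ms bs 1 k) v0 \<le> ennreal (\<delta> / 2)"
    and good: "run_prob d p (\<lambda>r. fst r = [] \<and> \<not> (dotp d (snd r) (snd r) = 1 \<and> 1 - dotp d (snd r) u \<le> \<tau>)) T (band_list ms bs 1 k) v0 \<le> ennreal (\<delta> / 2)"
    and Pm: "\<And>n. Measurable.pred (vec_space d) (\<lambda>w. P w n)"
    and P: "\<And>w n. dotp d w w = 1 \<Longrightarrow> 1 - dotp d w u \<le> \<tau> \<Longrightarrow> n \<le> T \<Longrightarrow> P w n"
  shows "1 - \<delta> \<le> measure (sample_space d) {s \<in> space (sample_space d).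
     P (fst (ap_state d p ms bs s v0 k)) (snd (ap_state d p ms bs s v0 k))}"
proof -
  interpret O: prob_space "sample_space d" by (rule prob_space_sample_space)
  define A1 where "A1 = {s \<in> space (sample_space d). fst (raw_run d p T (band_list ms bs 1 k) v0 s) \<noteq> []}"
  define A2 where "A2 = {s \<in> space (sample_space d). fst (raw_run d p T (band_list ms bs 1 k) v0 s) = [] \<and>
     \<not> (dotp d (snd (raw_run d p T (band_list ms bs 1 k) v0 s)) (snd (raw_run d p T (band_list ms bs 1 k) v0 s)) = 1 \<and>
        1 - dotp d (snd (raw_run d p T (band_list ms bs 1 k) v0 s)) u \<le> \<tau>)}"
  define G where "G = {s \<in> space (sample_space d).
     P (fst (ap_state d p ms bs s v0 k)) (snd (ap_state d p ms bs s v0 k))}"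
  have v0s: "(\<lambda>_. v0) \<in> sample_space d \<rightarrow>\<^sub>M vec_space d" using unit_sphere_space[OF v0] by simp
  have id: "(\<lambda>s. s) \<in> sample_space d \<rightarrow>\<^sub>M stream_space (draw d)" by (simp add: sample_space_eq)
  have sets_Q: "{s \<in> space (sample_space d). Q (raw_run d p T (band_list ms bs 1 k) v0 s)} \<in> sets (sample_space d)"
    if "\<And>bl. Measurable.pred (vec_space d) (\<lambda>w. Q (bl, w))" for Q
    using pred_raw_run[OF p that v0s id] by (simp add: pred_def)
  have du: "(\<lambda>w. dotp d w u) \<in> borel_measurable (vec_space d)"
    using measurable_dotp_left[of "\<lambda>x. x" "vec_space d" d u] by (simp add: dotp_commute[of d u])
  have A1: "A1 \<in> sets (sample_space d)" unfolding A1_def by (rule sets_Q) simp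
  have A2: "A2 \<in> sets (sample_space d)"
  proof -
    have [measurable]: "(\<lambda>w. dotp d w w) \<in> borel_measurable (vec_space d)" by measurable
    note du[measurable]
    show ?thesis unfolding A2_def
      by (rule sets_Q[of "\<lambda>r. fst r = [] \<and> \<not> (dotp d (snd r) (snd r) = 1 \<and> 1 - dotp d (snd r) u \<le> \<tau>)"]) simp
  qed
  have mst: "(\<lambda>s. fst (ap_state d p ms bs s v0 k)) \<in> sample_space d \<rightarrow>\<^sub>M vec_space d"
    "(\<lambda>s. snd (ap_state d p ms bs s v0 k)) \<in> sample_space d \<rightarrow>\<^sub>M count_space UNIV"
    unfolding ap_state_eq_fold using measurable_fold_mp_step[OF p, of "\<lambda>_. (v0, 0)"] v0s by auto
  have "Measurable.pred (sample_space d) (\<lambda>s. P (fst (ap_state d p ms bs s v0 k)) (snd (ap_state d p ms bs s v0 k)))"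
    by (rule measurable_compose_countable[OF measurable_compose[OF mst(1) Pm] mst(2)])
  hence G: "G \<in> sets (sample_space d)" unfolding G_def by (simp add: pred_def)
  have sub: "space (sample_space d) - G \<subseteq> A1 \<union> A2"
  proof
    fix s assume s: "s \<in> space (sample_space d) - G"
    show "s \<in> A1 \<union> A2"
    proof (rule ccontr)
      assume n: "s \<notin> A1 \<union> A2"
      let ?r = "raw_run d p T (band_list ms bs 1 k) v0 s"
      have r: "fst ?r = []" "dotp d (snd ?r) (snd ?r) = 1" "1 - dotp d (snd ?r) u \<le> \<tau>"
        using n s by (auto simp: A1_def A2_def)
      have "fst (ap_state d p ms bs s v0 k) = snd ?r \<and> snd (ap_state d p ms bs s v0 k) \<le> T"
        using fold_mp_step_raw_run[of d p T "band_list ms bs 1 k" v0 0 s] r(1) unfolding ap_state_eq_fold by simp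
      hence "s \<in> G" using P r s by (simp add: G_def)
      thus False using s by simp
    qed
  qed
  have "O.prob A1 \<le> \<delta> / 2" using fin \<delta> unfolding run_prob_def A1_def[symmetric]
    by (simp add: O.emeasure_eq_measure)
  moreover have "O.prob A2 \<le> \<delta> / 2" using good \<delta> unfolding run_prob_def A2_def[symmetric]
    by (simp add: O.emeasure_eq_measure)
  moreover have "O.prob (space (sample_space d) - G) \<le> O.prob (A1 \<union> A2)"
    using sub A1 A2 by (intro O.finite_measure_mono) auto
  moreover have "O.prob (A1 \<union> A2) \<le> O.prob A1 + O.prob A2"
    by (rule measure_Un_le[OF A1 A2])
  ultimately have "1 - \<delta> \<le> O.prob G" using O.prob_compl[OF G] by linarith
  thus ?thesis by (simp add: G_def)
qed

section \<open>All epochs\<close>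

text \<open>D stands for d / (1 - 2 eta)^2. The width contains ln (k m / \<delta>) and the query
  count must dominate D times that logarithm, which looks circular; but m enters only
  logarithmically: ln m <= 41 A + ln D + A, so L <= 43 A. The factor 2^40 then exceeds 2560 * 2^20 *
  43.\<close>

lemma schedule_estimates:
  fixes D \<delta> :: real and k m :: nat
  assumes D: "3 \<le> D" and \<delta>: "0 < \<delta>" "\<delta> < 1" and k: "1 \<le> k"
  defines "A \<equiv> ln D + ln (real k / \<delta>)"
  assumes m: "m = nat \<lceil>2^40 * D * A\<rceil>"
  defines "L \<equiv> ln (real k * real m / \<delta>)"
  shows "1 \<le> A" "real m \<le> 2^41 * D * A" "1 \<le> L" "L \<le> 43 * A" "2560 * 2^20 * D * L \<le> real m"
    "exp (- (128 * L)) + real m * exp (- (2 * L)) \<le> \<delta> / (4 * real k) - \<delta> / (4 * real (Suc k))"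
proof -
  have k1: "1 \<le> real k" using k by simp
  have kd: "1 \<le> real k / \<delta>" using k1 \<delta> by (simp add: field_simps)
  have "exp 1 \<le> D" using exp_le D by linarith
  hence lnD: "1 \<le> ln D" using D by (subst ln_ge_iff) auto
  have lnk: "0 \<le> ln (real k / \<delta>)" using kd by simp
  show A: "1 \<le> A" using lnD lnk by (simp add: A_def)
  have DA: "1 \<le> D * A" using D A mult_mono[of 1 D 1 A] by simp
  have m_ge: "2^40 * D * A \<le> real m" unfolding m by linarith
  have "0 \<le> 2^40 * D * A" using D A by simp
  hence "real m \<le> 2^40 * D * A + 1" unfolding m by linarith
  also have "\<dots> \<le> 2^41 * D * A"
  proof -
    have "2^40 * z + 1 \<le> 2^41 * z" if "1 \<le> z" for z :: real using that by simp
    from this[OF DA] show ?thesis by (simp only: mult.assoc)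
  qed
  finally show m_le: "real m \<le> 2^41 * D * A" .
  have m16: "16 \<le> real m"
  proof -
    have "16 \<le> 2^40 * z" if "1 \<le> z" for z :: real using that by simp
    from this[OF DA] show ?thesis using m_ge by (simp only: mult.assoc)
  qed
  have km: "real m \<le> real k * real m / \<delta>"
  proof -
    have "1 * real m \<le> real k / \<delta> * real m" using kd by (intro mult_right_mono) auto
    thus ?thesis by simp
  qed
  have "exp 1 \<le> real k * real m / \<delta>" using exp_le m16 km by linarith
  moreover have kmpos: "0 < real k * real m / \<delta>" using m16 km by linarith
  ultimately show L1: "1 \<le> L" unfolding L_def by (subst ln_ge_iff) auto
  have "L = ln (real k / \<delta>) + ln (real m)"
    unfolding L_def using k1 \<delta> m16 by (simp add: ln_mult ln_div)
  also have "ln (real m) \<le> ln (2^41 * D * A)" using m_le m16 D A by (subst ln_le_cancel_iff) auto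
  also have "ln (2^41 * D * A) = ln (2^41) + ln D + ln A"
    using D A by (simp add: ln_mult)
  also have "ln A \<le> A" using A ln_bound[of A] by simp
  also have "ln (2^41 :: real) = 41 * ln 2" by (subst ln_realpow) auto
  also have "41 * ln 2 \<le> 41 * A"
    using A ln_le_minus_one[of "2::real"] by simp
  finally show L43: "L \<le> 43 * A" by (simp add: A_def)
  have "2560 * 2^20 * D * L \<le> 2560 * 2^20 * D * (43 * A)"
    using L43 D by (intro mult_left_mono) auto
  also have "\<dots> \<le> 2^40 * D * A" using D A by simp
  finally show "2560 * 2^20 * D * L \<le> real m" using m_ge by linarith
  have eL: "exp (- (2 * L)) = (\<delta> / (real k * real m))\<^sup>2"
  proof -
    have "exp (- (2 * L)) = (exp (- L))\<^sup>2" by (simp add: exp_double[symmetric])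
    also have "exp (- L) = \<delta> / (real k * real m)"
      unfolding L_def exp_minus using kmpos by (subst exp_ln) auto
    finally show ?thesis .
  qed
  have "exp (- (128 * L)) \<le> 1 * exp (- (2 * L))" using L1 by simp
  also have "\<dots> \<le> real m * exp (- (2 * L))" using m16 by (intro mult_right_mono) auto
  \<comment> \<open>Since exp (- L) is \<delta> / (k m), the sum is at most 2 \<delta>^2 / (k^2 m).
    With m >= 16 this is below \<delta> / (8 k^2), and k + 1 <= 2 k turns it into the telescoping
    difference \<delta> / (4 k (k + 1)).\<close>
  finally have "exp (- (128 * L)) + real m * exp (- (2 * L)) \<le> 2 * (real m * exp (- (2 * L)))" by simp
  also have "\<dots> = 2 * \<delta>\<^sup>2 / ((real k)\<^sup>2 * real m)"
    unfolding eL using m16 by (simp add: power_divide power_mult_distrib power2_eq_square)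
  also have "\<dots> \<le> 2 * \<delta> / ((real k)\<^sup>2 * 16)"
  proof (rule frac_le)
    show "2 * \<delta>\<^sup>2 \<le> 2 * \<delta>" using \<delta> by (simp add: power2_eq_square mult_left_le)
    show "(real k)\<^sup>2 * 16 \<le> (real k)\<^sup>2 * real m" using m16 by (intro mult_left_mono) auto
  qed (use \<delta> k1 in auto)
  also have "\<dots> = \<delta> / 4 * (1 / (2 * (real k)\<^sup>2))" by simp
  also have "\<dots> \<le> \<delta> / 4 * (1 / (real k * real (Suc k)))"
  proof -
    have "real k * real (Suc k) \<le> real k * (2 * real k)" using k1 by (intro mult_left_mono) auto
    hence "1 / (2 * (real k)\<^sup>2) \<le> 1 / (real k * real (Suc k))"
      using k1 by (intro divide_left_mono) (auto simp: power2_eq_square mult_ac)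
    thus ?thesis using \<delta> by (intro mult_left_mono) auto
  qed
  also have "\<dots> = \<delta> / (4 * real k) - \<delta> / (4 * real (Suc k))"
    using k1 by (simp add: field_simps)
  finally show "exp (- (128 * L)) + real m * exp (- (2 * L)) \<le> \<delta> / (4 * real k) - \<delta> / (4 * real (Suc k))" .
qed

text \<open>The upper bound on 2^-K controls the final error; the lower bound \<epsilon> / 2
  controls the narrowest band and thereby the number of unlabeled draws. The factor 3 comes from ln
  2 >= 1/2 and from rounding up, with \<open>Ln\<close> at least 1.\<close>

lemma num_epochs_bounds:
  assumes \<epsilon>: "0 < \<epsilon>" "\<epsilon> < 1"
  shows "1 \<le> num_epochs \<epsilon>" "(1/2) ^ num_epochs \<epsilon> \<le> \<epsilon>" "\<epsilon> / 2 \<le> (1/2) ^ num_epochs \<epsilon>"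
    "real (num_epochs \<epsilon>) \<le> 3 * Ln (1 / \<epsilon>)"
proof -
  define x where "x = log 2 (1 / \<epsilon>)"
  define k where "k = num_epochs \<epsilon>"
  have x0: "0 < x" using \<epsilon> by (simp add: x_def)
  have k: "x \<le> real k" "real k < x + 1" and k1: "1 \<le> k"
    using x0 unfolding k_def num_epochs_def x_def[symmetric] by linarith+
  have px: "2 powr x = 1 / \<epsilon>" using \<epsilon> by (simp add: x_def)
  have pk: "2 powr real k = 2 ^ k" by (simp add: powr_realpow)
  have "1 / \<epsilon> \<le> 2 ^ k" unfolding px[symmetric] pk[symmetric] using k by simp
  hence "1 / 2 ^ k \<le> \<epsilon>" using \<epsilon> by (simp add: field_simps)
  thus "(1/2) ^ num_epochs \<epsilon> \<le> \<epsilon>" by (simp add: k_def power_one_over)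
  have "2 powr real k \<le> 2 powr (x + 1)" using k by simp
  also have "\<dots> = 2 / \<epsilon>" using px by (simp add: powr_add)
  finally have "2 ^ k \<le> 2 / \<epsilon>" by (simp add: pk)
  hence "\<epsilon> / 2 \<le> 1 / 2 ^ k" using \<epsilon> by (simp add: field_simps)
  thus "\<epsilon> / 2 \<le> (1/2) ^ num_epochs \<epsilon>" by (simp add: k_def power_one_over)
  have "ln (1 / \<epsilon>) = x * ln 2" using \<epsilon> by (simp add: x_def log_def)
  moreover have "x * (1/2) \<le> x * ln 2"
  proof -
    have "1/2 \<le> ln (2::real)" using ln_le_minus_one[of "1/2::real"] by (simp add: ln_div)
    thus ?thesis using x0 by (intro mult_left_mono) auto
  qed
  ultimately have "x \<le> 2 * ln (1 / \<epsilon>)" by linarith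
  moreover have "ln (1 / \<epsilon>) \<le> Ln (1 / \<epsilon>)" "1 \<le> Ln (1 / \<epsilon>)" by (simp_all add: Ln_def)
  ultimately show "real (num_epochs \<epsilon>) \<le> 3 * Ln (1 / \<epsilon>)" using k unfolding k_def by linarith
  show "1 \<le> num_epochs \<epsilon>" using k1 by (simp add: k_def)
qed

lemma band_list_Cons: "i \<le> k \<Longrightarrow> band_list ms bs i k = replicate (ms i) (bs i) @ band_list ms bs (Suc i) k"
  unfolding band_list_def by (subst upt_conv_Cons) auto

lemma raw_run_Nil: "raw_run d p T [] w s = ([], w)"
  by (cases T) auto

lemma length_band_list: "length (band_list ms bs 1 k) = (\<Sum>i=1..k. ms i)"
  by (induction k) (auto simp: band_list_def)

lemma set_band_list: "b \<in> set (band_list ms bs 1 k) \<Longrightarrow> \<exists>i. 1 \<le> i \<and> i \<le> k \<and> b = bs i"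
  by (auto simp: band_list_def)

text \<open>Induction from the last epoch backwards: the bound for epoch i + 1 onwards is the
  \<open>D\<close> of \<open>epoch_step\<close>, and the loss of epoch i is the difference of the
  two consecutive bounds. The case i = K + 1, with no query left, is the base.\<close>

lemma all_epochs:
  fixes \<eta> \<delta> :: real and p :: "vec \<Rightarrow> real" and ms :: "nat \<Rightarrow> nat" and K :: nat
  assumes d: "3 \<le> d" and e: "0 \<le> \<eta>" "\<eta> < 1/2"
    and p: "p \<in> borel_measurable (vec_space d)" "\<And>x. 0 \<le> p x \<and> p x \<le> 1"
    and noise: "bounded_noise d u \<eta> p" and u: "dotp d u u = 1" and \<delta>: "0 < \<delta>" "\<delta> < 1"
    and ms: "\<And>k. ms k = nat \<lceil>2^40 * (d / (1 - 2 * \<eta>)\<^sup>2) * (ln (d / (1 - 2 * \<eta>)\<^sup>2) + ln (k / \<delta>))\<rceil>"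
    and bs: "\<And>k. bs k = 1 / 2^20 * ((1/2)^k * (1 - 2 * \<eta>)) / (sqrt d * ln (real k * real (ms k) / \<delta>))"
    and D: "3 \<le> d / (1 - 2 * \<eta>)\<^sup>2"
  defines "Q \<equiv> \<lambda>r. fst r = [] \<and> \<not> (dotp d (snd r) (snd r) = 1 \<and> 1 - dotp d (snd r) u \<le> ((1/2)^K)\<^sup>2 / 16)"
  assumes i: "1 \<le> i" "i \<le> Suc K" and w: "w \<in> unit_sphere d"
    and f: "1 - dotp d w u \<le> (if i = 1 then 1 else ((1/2)^(i - 1))\<^sup>2 / 16)" and K: "1 \<le> K"
  shows "run_prob d p Q T (band_list ms bs i K) w \<le> ennreal (\<delta> / (4 * real i))"
  using i w f
proof (induction "Suc K - i" arbitrary: i w T)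
  case 0
  hence i: "i = Suc K" by simp
  \<comment> \<open>At i = K + 1 the assumption on w is the very target that \<open>Q\<close>
    negates; 1 <= K excludes the branch i = 1.\<close>
  hence "\<not> Q ([], w)" using 0 K by (simp add: Q_def dotp_unit_sphere)
  hence "run_prob d p Q T [] w = 0" by (simp add: run_prob_def raw_run_Nil)
  thus ?case by (simp add: i band_list_def)
next
  case (Suc n)
  hence iK: "i \<le> K" by simp
  define L where "L = ln (real i * real (ms i) / \<delta>)"
  define h where "h = (1/2::real)^i"
  note est = schedule_estimates[OF D \<delta> Suc.prems(1) ms[of i], folded L_def]
  have Qm: "Measurable.pred (vec_space d) (\<lambda>w. Q (bl, w))" for bl
  proof -
    have [measurable]: "(\<lambda>w. dotp d w w) \<in> borel_measurable (vec_space d)" by measurable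
    have [measurable]: "(\<lambda>w. dotp d w u) \<in> borel_measurable (vec_space d)"
      using measurable_dotp_left[of "\<lambda>x. x" "vec_space d" d u] by (simp add: dotp_commute[of d u])
    show ?thesis unfolding Q_def by simp
  qed
  have h: "0 < h" "h \<le> 1/2"
    using power_decreasing[OF Suc.prems(1), of "1/2::real"] by (auto simp: h_def)
  have "run_prob d p Q T (replicate (ms i) (bs i) @ band_list ms bs (Suc i) K) w \<le>
     ennreal (exp (- (128 * L)) + real (ms i) * exp (- (2 * L)) + \<delta> / (4 * real (Suc i)))"
  proof (rule epoch_step[OF d e p noise u Qm _ h est(3)])
    show "bl = []" if "Q (bl, w)" for bl w using that by (simp add: Q_def)
    show "0 \<le> \<delta> / (4 * real (Suc i))" using \<delta> by simp
    show "bs i = 1 / 2^20 * (h * (1 - 2 * \<eta>)) / (sqrt d * L)" by (simp add: bs h_def L_def)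
    show "2560 * 2^20 * (d / (1 - 2 * \<eta>)\<^sup>2) * L \<le> real (ms i)" by (rule est(5))
    show "run_prob d p Q T (band_list ms bs (Suc i) K) w \<le> ennreal (\<delta> / (4 * real (Suc i)))"
      if "w \<in> unit_sphere d" "1 - dotp d w u \<le> h\<^sup>2 / 16" for w T
      using Suc.hyps(2) Suc.prems(1) iK that by (intro Suc.hyps(1)) (auto simp: h_def)
    show "w \<in> unit_sphere d" by (rule Suc.prems)
    \<comment> \<open>For i = 1 the right side is 1; for later epochs the previous target is (2 h)^2
      / 16.\<close>
    show "1 - dotp d w u \<le> 4 * h\<^sup>2"
    proof (cases "i = 1")
      case True
      thus ?thesis using Suc.prems(4) by (simp add: h_def power2_eq_square)
    next
      case False
      have "(1/2::real)^(i - 1) = 2 * h"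
        unfolding h_def using Suc.prems(1) by (cases i) auto
      hence "1 - dotp d w u \<le> (2 * h)\<^sup>2 / 16" using Suc.prems(4) False by simp
      also have "\<dots> \<le> 4 * h\<^sup>2" by (simp add: power_mult_distrib)
      finally show ?thesis .
    qed
  qed
  also have "\<dots> \<le> ennreal (\<delta> / (4 * real i))"
    using est(6) by (intro ennreal_leI) linarith
  finally show ?case by (simp only: band_list_Cons[OF iK])
qed

theorem theorem2:
  "\<exists>cm>0. \<exists>cb>0. \<exists>C2>0. \<exists>C3>0. \<exists>C4>0.
    \<forall>(d::nat) (\<eta>::real) (\<epsilon>::real) (\<delta>::real) (u::vec) (v0::vec) (p::vec \<Rightarrow> real).
      3 \<le> d \<longrightarrow> 0 \<le> \<eta> \<longrightarrow> \<eta> < 1/2 \<longrightarrow> 0 < \<epsilon> \<longrightarrow> \<epsilon> < 1 \<longrightarrow> 0 < \<delta> \<longrightarrow> \<delta> < 1 \<longrightarrow>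
      u \<in> unit_sphere d \<longrightarrow> v0 \<in> unit_sphere d \<longrightarrow>
      p \<in> borel_measurable (vec_space d) \<longrightarrow> (\<forall>x. 0 \<le> p x \<and> p x \<le> 1) \<longrightarrow>
      bounded_noise d u \<eta> p \<longrightarrow>
      theta d v0 u \<in> {0..pi/2} \<longrightarrow>
      (let ms = (\<lambda>k::nat. nat \<lceil>cm * (d / (1 - 2*\<eta>)^2) *
                      (ln (d / (1 - 2*\<eta>)^2) + ln (k / \<delta>))\<rceil>);
           bs = (\<lambda>k::nat. cb * ((1/2)^k * (1 - 2*\<eta>)) /
                      (sqrt d * ln (k * ms k / \<delta>)));
           L = Ln (d / (1 - 2*\<eta>)^2) + Ln (1/\<delta>) + Ln (Ln (1/\<epsilon>))
       in measure (sample_space d)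
            {s \<in> space (sample_space d).
               measure (sphere_measure d)
                 {x \<in> space (sphere_measure d).
                    sgn1 (dotp d (ap_output d p \<epsilon> ms bs s v0) x) \<noteq> sgn1 (dotp d u x)} \<le> \<epsilon>
             \<and> real (ap_queries \<epsilon> ms) \<le> C2 * (d / (1 - 2*\<eta>)^2) * Ln (1/\<epsilon>) * L
             \<and> real (ap_unlabeled d p \<epsilon> ms bs s v0)
                 \<le> C3 * (d / (1 - 2*\<eta>)^3) * L^2 * (1/\<epsilon>) * Ln (1/\<epsilon>)
             \<and> real (ap_time d p \<epsilon> ms bs s v0)
                 \<le> C4 * (d^2 / (1 - 2*\<eta>)^3) * L^2 * (1/\<epsilon>) * Ln (1/\<epsilon>)}
          \<ge> 1 - \<delta>)"
proof (rule exI[of _ "2^40"], rule conjI[OF zero_less_power[OF zero_less_numeral]],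
    rule exI[of _ "1 / 2^20"], rule conjI, simp,
    rule exI[of _ "2^44"], rule conjI[OF zero_less_power[OF zero_less_numeral]],
    rule exI[of _ "2^80"], rule conjI[OF zero_less_power[OF zero_less_numeral]],
    rule exI[of _ "2^81"], rule conjI[OF zero_less_power[OF zero_less_numeral]], intro allI impI, goal_cases)
  case (1 d \<eta> \<epsilon> \<delta> u v0 p)
  \<comment> \<open>Origin of the witnesses: 2^40 is checked in \<open>schedule_estimates\<close>
    against the width factor 2^-20 used in \<open>epoch_step\<close>; 2^44 exceeds 3 * 2^42, from K
    <= 3 E epochs of at most 2^42 D Lt queries; 2^80 exceeds (2^44 + 1) * 2^35 + 1, with 2^35 from
    \<sigma>; and 2^81 adds the queries to the draws.\<close>
  note d = 1(1) and e = 1(2,3) and \<epsilon> = 1(4,5) and \<delta> = 1(6,7) and u = 1(8) and v0 = 1(9)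
    and pm = 1(10) and p01 = 1(11) and noise = 1(12) and th = 1(13)
  define N where "N = 1 - 2 * \<eta>"
  define D where "D = real d / N\<^sup>2"
  define ms where "ms = (\<lambda>k::nat. nat \<lceil>2^40 * D * (ln D + ln (k / \<delta>))\<rceil>)"
  define bs where "bs = (\<lambda>k::nat. 1 / 2^20 * ((1/2)^k * N) / (sqrt d * ln (k * ms k / \<delta>)))"
  define E where "E = Ln (1 / \<epsilon>)"
  define Lt where "Lt = Ln D + Ln (1/\<delta>) + Ln E"
  define K where "K = num_epochs \<epsilon>"
  have uu: "dotp d u u = 1" using u by (rule dotp_unit_sphere)
  have N: "0 < N" "N \<le> 1" using e by (auto simp: N_def)
  have N2: "N\<^sup>2 \<le> 1" using N by (simp add: power_le_one)
  have D3: "3 \<le> D"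
  proof -
    have "3 * N\<^sup>2 \<le> real d" using d N2 by linarith
    thus ?thesis using N by (simp add: D_def pos_le_divide_eq)
  qed
  have E1: "1 \<le> E" by (simp add: E_def Ln_def)
  have LD: "1 \<le> Ln D" "ln D \<le> Ln D" "1 \<le> Ln (1/\<delta>)" "ln (1/\<delta>) \<le> Ln (1/\<delta>)" "1 \<le> Ln E" "ln E \<le> Ln E"
    by (simp_all add: Ln_def)
  have Lt3: "3 \<le> Lt" using LD by (simp add: Lt_def)
  note Kb = num_epochs_bounds[OF \<epsilon>, folded K_def E_def]
  have A_le: "ln D + ln (real k / \<delta>) \<le> 2 * Lt" if "1 \<le> k" "k \<le> K" for k
  proof -
    \<comment> \<open>Here the iterated logarithm of 1 / \<epsilon> enters: the epoch index is at
      most 3 E.\<close>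
    have "ln (real k) \<le> ln (3 * E)" using Kb(4) that by (subst ln_le_cancel_iff) auto
    also have "\<dots> = ln 3 + ln E" using E1 by (simp add: ln_mult)
    also have "\<dots> \<le> 2 + Ln E" using LD ln_le_minus_one[of "3::real"] by simp
    finally have "ln (real k) \<le> 2 + Ln E" .
    moreover have "ln (real k / \<delta>) = ln (real k) + ln (1 / \<delta>)" using that \<delta> by (simp add: ln_div)
    ultimately have "ln D + ln (real k / \<delta>) \<le> Ln D + ((2 + Ln E) + Ln (1 / \<delta>))"
      using LD(2,4) by (simp only: add_mono)
    also have "\<dots> = Lt + 2" by (simp add: Lt_def)
    also have "\<dots> \<le> 2 * Lt" using Lt3 by simp
    finally show ?thesis .
  qed
  have est: "real (ms k) \<le> 2^42 * D * Lt" "1 \<le> ln (real k * real (ms k) / \<delta>)" "ln (real k * real (ms k) / \<delta>) \<le> 86 * Lt"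
    if k: "1 \<le> k" "k \<le> K" for k
  proof -
    have mk: "ms k = nat \<lceil>2^40 * D * (ln D + ln (real k / \<delta>))\<rceil>" by (simp add: ms_def)
    note s = schedule_estimates[OF D3 \<delta> k(1) mk]
    have "2^41 * D * (ln D + ln (real k / \<delta>)) \<le> 2^41 * D * (2 * Lt)"
      using A_le[OF k] D3 by (intro mult_left_mono) auto
    thus "real (ms k) \<le> 2^42 * D * Lt" using s(2) by simp
    show "1 \<le> ln (real k * real (ms k) / \<delta>)" by (rule s(3))
    show "ln (real k * real (ms k) / \<delta>) \<le> 86 * Lt"
      using order_trans[OF s(4) mult_left_mono[OF A_le[OF k]]] by simp
  qed
  have DEL: "1 \<le> D * E * Lt" using D3 E1 Lt3 by (simp add: mult_ge1_I)
  have queries: "real (ap_queries \<epsilon> ms) \<le> 2^44 * D * E * Lt"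
  proof -
    have "real (ap_queries \<epsilon> ms) = (\<Sum>k=1..K. real (ms k))" by (simp add: ap_queries_def K_def)
    also have "\<dots> \<le> (\<Sum>k=1..K. 2^42 * D * Lt)" by (intro sum_mono est(1)) auto
    also have "\<dots> = real K * (2^42 * D * Lt)" by simp
    also have "\<dots> \<le> (3 * E) * (2^42 * D * Lt)" using Kb(4) D3 Lt3 by (intro mult_right_mono) auto
    also have "\<dots> = 3 * 2^42 * (D * E * Lt)" by simp
    also have "\<dots> \<le> 2^44 * (D * E * Lt)" using DEL by (intro mult_right_mono) auto
    finally show ?thesis by simp
  qed
  \<comment> \<open>Half the guaranteed acceptance rate, uniformly over all epochs: the width in
    epoch k satisfies b sqrt d >= 2^-20 * (\<epsilon> / 2) * N / (86 Lt), and 2 * 86 * 128 = 22016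
    is below 2^15.\<close>
  define \<sigma> where "\<sigma> = \<epsilon> * N / (2^35 * Lt)"
  define n where "n = real (ap_queries \<epsilon> ms)"
  \<comment> \<open>Chosen so that n - \<sigma> T <= - Lt, which is at most - 1 - ln (1 / \<delta>);
    the probability of an incomplete run is then at most \<delta> / e.\<close>
  define T where "T = nat \<lceil>(n + Lt) / \<sigma>\<rceil>"
  have \<sigma>0: "0 < \<sigma>" using \<epsilon> N Lt3 by (simp add: \<sigma>_def)
  have n0: "0 \<le> n" by (simp add: n_def)
  have T_ge: "n + Lt \<le> \<sigma> * real T"
  proof -
    have "(n + Lt) / \<sigma> \<le> real T" unfolding T_def by linarith
    thus ?thesis using \<sigma>0 by (simp add: pos_divide_le_eq mult.commute)
  qed
  \<comment> \<open>The common scale of the draw and time bounds, since D / N is d / N^3. It is the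
    query scale D E Lt times the inverse acceptance rate Lt / (\<epsilon> N), hence the square of Lt
    and the third power of N.\<close>
  define X where "X = D / N * Lt\<^sup>2 * (1 / \<epsilon>) * E"
  have XN: "D * E * Lt * (Lt / (\<epsilon> * N)) = X" by (simp add: X_def power2_eq_square mult_ac)
  have LN: "1 \<le> Lt / (\<epsilon> * N)"
  proof -
    have "\<epsilon> * N \<le> 1 * 1" using \<epsilon> N by (intro mult_mono) auto
    thus ?thesis using Lt3 \<epsilon> N by (simp add: field_simps)
  qed
  have DELX: "D * E * Lt \<le> X"
  proof -
    have "D * E * Lt * 1 \<le> D * E * Lt * (Lt / (\<epsilon> * N))" using DEL LN by (intro mult_left_mono) auto
    thus ?thesis by (simp only: XN mult_1_right)
  qed
  have X1: "1 \<le> X" using DEL DELX by linarith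
  have T_le: "real T \<le> 2^80 * X"
  proof -
    have "0 \<le> (n + Lt) / \<sigma>" using n0 Lt3 \<sigma>0 by simp
    hence "real T \<le> (n + Lt) / \<sigma> + 1" unfolding T_def by linarith
    also have "(n + Lt) / \<sigma> = (n + Lt) * (2^35 * (Lt / (\<epsilon> * N)))" by (simp add: \<sigma>_def)
    also have "\<dots> \<le> (2^44 * (D * E * Lt) + D * E * Lt) * (2^35 * (Lt / (\<epsilon> * N)))"
    proof (rule mult_right_mono)
      have "1 * Lt \<le> D * E * Lt" using D3 E1 Lt3 by (intro mult_right_mono) (auto simp: mult_ge1_I)
      thus "n + Lt \<le> 2^44 * (D * E * Lt) + D * E * Lt" using queries by (simp add: n_def)
    qed (use LN in auto)
    also have "\<dots> = (2^44 + 1) * 2^35 * (D * E * Lt * (Lt / (\<epsilon> * N)))" by (simp add: algebra_simps)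
    also have "\<dots> + 1 \<le> 2^80 * X" unfolding XN using X1 by simp
    finally show ?thesis by simp
  qed
  have bsd: "bs k * sqrt d = 1 / 2^20 * ((1/2)^k * N / ln (real k * real (ms k) / \<delta>))" if "1 \<le> k" for k
    using d by (simp add: bs_def)
  have bs_good: "0 < bs k \<and> (bs k)\<^sup>2 * real d \<le> 1/4 \<and> \<sigma> \<le> bs k * sqrt d / 128" if k: "1 \<le> k" "k \<le> K" for k
  proof -
    define l where "l = ln (real k * real (ms k) / \<delta>)"
    have l: "1 \<le> l" "l \<le> 86 * Lt" using est(2,3)[OF k] by (simp_all add: l_def)
    have pos: "0 < bs k" using d N l(1) by (simp add: bs_def l_def)
    have hN: "(1/2)^k * N \<le> 1 * 1" using N by (intro mult_mono) (auto simp: power_le_one)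
    have "(1/2)^k * N / l \<le> 1 / 1" using hN l N by (intro frac_le) auto
    hence "1 / 2^20 * ((1/2)^k * N / l) \<le> 1 / 2^20 * 1" by (intro mult_left_mono) auto
    also have "\<dots> \<le> (1/2 :: real)" by simp
    finally have "bs k * sqrt d \<le> 1/2" by (simp only: bsd[OF k(1)] l_def)
    hence "(bs k * sqrt d)\<^sup>2 \<le> (1/2)\<^sup>2" using pos by (intro power_mono) auto
    hence sq: "(bs k)\<^sup>2 * real d \<le> 1/4" by (simp add: power_mult_distrib power_divide)
    have "(1/2::real)^K \<le> (1/2)^k" by (rule power_decreasing[OF k(2)]) auto
    hence "\<epsilon> / 2 \<le> (1/2)^k" using Kb(3) by linarith
    hence "\<epsilon> / 2 * N / (86 * Lt) \<le> (1/2)^k * N / l"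
      using l N Lt3 \<epsilon> by (intro frac_le mult_right_mono) auto
    hence low: "1 / 2^20 * (\<epsilon> / 2 * N / (86 * Lt)) \<le> bs k * sqrt d"
      unfolding bsd[OF k(1)] l_def[symmetric] by (rule mult_left_mono) simp
    have "\<sigma> \<le> 1 / 2^20 * (\<epsilon> / 2 * N / (86 * Lt)) / 128"
    proof -
      have "1 / 2^20 * (\<epsilon> / 2 * N / (86 * Lt)) / 128 = \<epsilon> * N / Lt * (1 / (2^20 * 22016))" by simp
      moreover have "\<sigma> = \<epsilon> * N / Lt * (1 / 2^35)" by (simp add: \<sigma>_def)
      moreover have "\<epsilon> * N / Lt * (1 / 2^35) \<le> \<epsilon> * N / Lt * (1 / (2^20 * 22016))"
        using \<epsilon> N Lt3 by (intro mult_left_mono) auto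
      ultimately show ?thesis by linarith
    qed
    also have "\<dots> \<le> bs k * sqrt d / 128" using low by (rule divide_right_mono) simp
    finally have "\<sigma> \<le> bs k * sqrt d / 128" .
    thus ?thesis using pos sq by simp
  qed
  have fin: "run_prob d p (\<lambda>r. fst r \<noteq> []) T (band_list ms bs 1 K) v0 \<le> ennreal (\<delta> / 2)"
  proof -
    have len: "real (length (band_list ms bs 1 K)) = n"
      by (simp only: length_band_list) (simp add: n_def ap_queries_def K_def)
    have "run_prob d p (\<lambda>r. fst r \<noteq> []) T (band_list ms bs 1 K) v0 \<le>
       ennreal (exp (real (length (band_list ms bs 1 K)) - \<sigma> * real T))"
      using set_band_list bs_good \<sigma>0 v0 by (intro run_unfinished_le[OF d pm]) fastforce+
    also have "\<dots> \<le> ennreal (\<delta> / 2)"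
    proof (rule ennreal_leI)
      have "n - \<sigma> * real T \<le> - 1 - ln (1 / \<delta>)" using T_ge LD by (simp add: Lt_def)
      hence "exp (n - \<sigma> * real T) \<le> exp (- 1 - ln (1 / \<delta>))" by simp
      also have "\<dots> = exp (- 1) * \<delta>" using \<delta> by (simp add: exp_diff ln_div exp_minus field_simps)
      also have "\<dots> \<le> 1/2 * \<delta>"
      proof -
        have "2 \<le> exp (1::real)" using exp_ge_add_one_self[of 1] by simp
        hence "exp (- 1) \<le> (1/2 :: real)" by (simp add: exp_minus field_simps)
        thus ?thesis using \<delta> by (intro mult_right_mono) auto
      qed
      finally show "exp (real (length (band_list ms bs 1 K)) - \<sigma> * real T) \<le> \<delta> / 2" by (simp only: len)
    qed
    finally show ?thesis .
  qed
  have start: "1 - dotp d v0 u \<le> 1"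
  proof -
    have c: "\<bar>dotp d v0 u\<bar> \<le> 1" by (rule dotp_abs_le_1[OF dotp_unit_sphere[OF v0] uu])
    have "0 \<le> cos (arccos (dotp d v0 u))" using th by (intro cos_ge_zero) (auto simp: theta_def)
    thus ?thesis using c by (simp add: cos_arccos_abs)
  qed
  have good: "run_prob d p (\<lambda>r. fst r = [] \<and> \<not> (dotp d (snd r) (snd r) = 1 \<and> 1 - dotp d (snd r) u \<le> ((1/2)^K)\<^sup>2 / 16))
     T (band_list ms bs 1 K) v0 \<le> ennreal (\<delta> / 2)"
  proof -
    have "run_prob d p (\<lambda>r. fst r = [] \<and> \<not> (dotp d (snd r) (snd r) = 1 \<and> 1 - dotp d (snd r) u \<le> ((1/2)^K)\<^sup>2 / 16))
     T (band_list ms bs 1 K) v0 \<le> ennreal (\<delta> / (4 * real (1::nat)))"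
    proof (rule all_epochs[OF d e pm _ noise uu \<delta>])
      show "ms k = nat \<lceil>2^40 * (d / (1 - 2 * \<eta>)\<^sup>2) * (ln (d / (1 - 2 * \<eta>)\<^sup>2) + ln (k / \<delta>))\<rceil>" for k
        by (simp add: ms_def D_def N_def)
      show "bs k = 1 / 2^20 * ((1/2)^k * (1 - 2 * \<eta>)) / (sqrt d * ln (real k * real (ms k) / \<delta>))" for k
        by (simp add: bs_def N_def)
      show "3 \<le> d / (1 - 2 * \<eta>)\<^sup>2" using D3 by (simp add: D_def N_def)
    qed (use p01 v0 start Kb(1) in auto)
    also have "\<dots> \<le> ennreal (\<delta> / 2)" using \<delta> by (intro ennreal_leI) simp
    finally show ?thesis .
  qed
  define P where "P w k \<longleftrightarrow> measure (sphere_measure d) {x \<in> space (sphere_measure d). sgn1 (dotp d w x) \<noteq> sgn1 (dotp d u x)} \<le> \<epsilon>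
     \<and> real (ap_queries \<epsilon> ms) \<le> 2^44 * D * E * Lt
     \<and> real k \<le> 2^80 * (d / N^3) * Lt\<^sup>2 * (1/\<epsilon>) * E
     \<and> real (d * (k + ap_queries \<epsilon> ms)) \<le> 2^81 * (d\<^sup>2 / N^3) * Lt\<^sup>2 * (1/\<epsilon>) * E" for w k
  have X_eq: "d / N^3 * Lt\<^sup>2 * (1/\<epsilon>) * E = X"
    by (simp add: X_def D_def power2_eq_square power3_eq_cube)
  have "1 - \<delta> \<le> measure (sample_space d) {s \<in> space (sample_space d).
     P (fst (ap_state d p ms bs s v0 K)) (snd (ap_state d p ms bs s v0 K))}"
  proof (rule ap_success_prob[OF pm v0 _ fin good])
    show "0 \<le> \<delta>" using \<delta> by simp
    show "Measurable.pred (vec_space d) (\<lambda>w. P w k)" for k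
    proof -
      note measurable_disagreement[of d u, measurable]
      show ?thesis unfolding P_def by measurable
    qed
    show "P w k" if w: "dotp d w w = 1" "1 - dotp d w u \<le> ((1/2)^K)\<^sup>2 / 16" and k: "k \<le> T" for w k
    proof -
      \<comment> \<open>A potential of at most h^2 / 16 gives a squared sine of at most h^2 / 8, so
        the sine is at most h / 2, the disagreement at most h, and h <= \<epsilon>.\<close>
      define h where "h = (1/2::real)^K"
      have h: "0 \<le> h" "h \<le> 1" "h \<le> \<epsilon>" using Kb(2) by (auto simp: h_def power_le_one)
      have "h\<^sup>2 \<le> 1" using h by (simp add: power_le_one)
      hence c: "1/2 \<le> dotp d w u" using w(2) unfolding h_def[symmetric] by linarith
      have c1: "\<bar>dotp d w u\<bar> \<le> 1" by (rule dotp_abs_le_1[OF w(1) uu])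
      have "1 - (dotp d w u)\<^sup>2 = (1 - dotp d w u) * (1 + dotp d w u)"
        by (simp add: power2_eq_square algebra_simps)
      also have "\<dots> \<le> (h\<^sup>2 / 16) * 2" using w(2) c1 unfolding h_def[symmetric] by (intro mult_mono) auto
      also have "\<dots> \<le> (h / 2)\<^sup>2" by (simp add: power_divide)
      finally have "sqrt (1 - (dotp d w u)\<^sup>2) \<le> h / 2" using h by (intro real_le_lsqrt) auto
      hence err: "measure (sphere_measure d) {x \<in> space (sphere_measure d). sgn1 (dotp d w x) \<noteq> sgn1 (dotp d u x)} \<le> \<epsilon>"
        using sphere_sgn_disagree_le[OF d w(1) uu c] h by linarith
      have kX: "real k \<le> 2^80 * X" using k T_le by (simp add: order_trans[of "real k" "real T"])
      have "real k + n \<le> 2^81 * X"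
        using kX queries DELX X1 unfolding n_def by simp
      hence "real d * (real k + n) \<le> real d * (2^81 * X)" by (intro mult_left_mono) auto
      also have "\<dots> = 2^81 * (d\<^sup>2 / N^3) * Lt\<^sup>2 * (1/\<epsilon>) * E"
        unfolding X_eq[symmetric] by (simp add: power2_eq_square)
      finally have time: "real (d * (k + ap_queries \<epsilon> ms)) \<le> 2^81 * (d\<^sup>2 / N^3) * Lt\<^sup>2 * (1/\<epsilon>) * E"
        by (simp add: n_def)
      have "real k \<le> 2^80 * (d / N^3) * Lt\<^sup>2 * (1/\<epsilon>) * E"
        using kX unfolding X_eq[symmetric] by (simp only: mult.assoc)
      thus ?thesis unfolding P_def using err queries time by blast
    qed
  qed
  thus ?case
    unfolding Let_def P_def Lt_def E_def K_def bs_def ms_def D_def N_def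
      ap_output_def ap_unlabeled_def ap_time_def .
qed

end
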